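(* Let $M$ be a compact $\mathcal C^2$ manifold (possibly with boundary), let $X$ be a centered Gaussian random element of $\mathcal C^2(M)$, let $E\subset\mathcal C^2(M)$ be the topological support of its law and $\mathcal H_X\subset E$ its Cameron–Martin space. Let $\mathcal V\subset E$ and fix $e\in E$. Assume that for every $f_0\in\mathcal V$ there are a neighborhood $O_{f_0}$ of $f_0$ in $E$, a number $\delta>0$ and an element $h\in\mathcal H_X\setminus\mathbb R e$ such that for all $f\in O_{f_0}$ the set $$T(f,\delta,h):=\{(s,t)\in(-\delta,\delta)^2: f+sh+te\in\mathcal V\}$$ has the property that $T(f,\delta,h)\cap(\{s\}\times\mathbb R)$ is empty for almost every $s\in(-\delta,\delta)$. Then $$\mathbb P(\exists\, t\in\mathbb R: X+te\in\mathcal V)=0.$$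
   Context: $\mathcal C^2(M)$ carries its usual Banach space structure; the topological support is the smallest closed set of full measure (a closed linear subspace, equal to the closure of $\mathcal H_X$).
   Formalization: The set V is assumed to be a Borel subset of C²(M); for arbitrary V ⊂ E the claim fails (a Davies-type covering of the plane gives a non-measurable V for which the event has probability 1). The event is shown to be null for the completion of P. *)

theory Defs
  imports "HOL-Probability.Probability"
begin

definition blin_deriv ::
  "'e::real_normed_vector set \<Rightarrow> ('e \<Rightarrow> 'f::real_normed_vector) \<Rightarrow> 'e \<Rightarrow> 'e \<Rightarrow>\<^sub>L 'f" where
  "blin_deriv D g x = Blinfun (frechet_derivative g (at x within D))"

text \<open>Used only for relatively open subsets of half-spaces (or of the whole space). There the
  derivative within \<open>D\<close> is unique, also at boundary points, and the condition is the usual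
  \<open>C\<^sup>2\<close> regularity up to the boundary.\<close>

definition C2_on :: "'e::real_normed_vector set \<Rightarrow> ('e \<Rightarrow> 'f::real_normed_vector) \<Rightarrow> bool" where
  "C2_on D g \<longleftrightarrow>
     g differentiable_on D \<and>
     blin_deriv D g differentiable_on D \<and>
     continuous_on D (blin_deriv D (blin_deriv D g))"

text \<open>Manifolds, possibly with boundary, are given by a topology and an atlas of pairs
  \<open>(U, \<phi>)\<close>. The set \<open>{x. 0 \<le> x \<bullet> b}\<close> is a closed half-space if \<open>b \<noteq> 0\<close> and the whole space if
  \<open>b = 0\<close>. The model space is a finite-dimensional inner product space; the class
  \<open>euclidean_space\<close> is not used since it excludes dimension 0.\<close>

definition compact_C2_manifold ::
  "'m topology \<Rightarrow> ('m set \<times> ('m \<Rightarrow> 'e::real_inner)) set \<Rightarrow> bool" where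
  "compact_C2_manifold T \<A> \<longleftrightarrow>
     compact_space T \<and> Hausdorff_space T \<and>
     (\<exists>B :: 'e set. finite B \<and> span B = UNIV) \<and>
     (\<forall>(U, \<phi>) \<in> \<A>.
        openin T U \<and>
        (\<exists>b. openin (top_of_set {x. 0 \<le> x \<bullet> b}) (\<phi> ` U)) \<and>
        homeomorphic_map (subtopology T U) (top_of_set (\<phi> ` U)) \<phi>) \<and>
     (\<Union>(U, \<phi>) \<in> \<A>. U) = topspace T \<and>
     (\<forall>(U, \<phi>) \<in> \<A>. \<forall>(W, \<psi>) \<in> \<A>. C2_on (\<phi> ` (U \<inter> W)) (\<psi> \<circ> inv_into U \<phi>))"

text \<open>A function on the manifold is extended by 0 outside \<open>topspace T\<close>, so that distinct elements
  of the following set are distinct functions on the manifold and the set is closed under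
  pointwise linear combinations.\<close>

definition C2_space ::
  "'m topology \<Rightarrow> ('m set \<times> ('m \<Rightarrow> 'e::real_inner)) set \<Rightarrow> ('m \<Rightarrow> real) set" where
  "C2_space T \<A> =
     {f. (\<forall>p. p \<notin> topspace T \<longrightarrow> f p = 0) \<and>
         (\<forall>(U, \<phi>) \<in> \<A>. C2_on (\<phi> ` U) (f \<circ> inv_into U \<phi>))}"

text \<open>The usual norm on \<open>C\<^sup>2(M)\<close> depends, up to equivalence, on the choice of a finite cover of the
  manifold by compact subsets of chart domains.\<close>

definition C2_cover ::
  "'m topology \<Rightarrow> ('m set \<times> ('m \<Rightarrow> 'e::real_inner)) set \<Rightarrow>
   ('m set \<times> ('m \<Rightarrow> 'e) \<times> 'm set) set \<Rightarrow> bool" where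
  "C2_cover T \<A> \<K> \<longleftrightarrow>
     finite \<K> \<and>
     (\<forall>(U, \<phi>, K) \<in> \<K>. (U, \<phi>) \<in> \<A> \<and> K \<subseteq> U \<and> compactin T K \<and> K \<noteq> {}) \<and>
     (\<Union>(U, \<phi>, K) \<in> \<K>. K) = topspace T"

definition C2_norm ::
  "('m set \<times> ('m \<Rightarrow> 'e::real_inner) \<times> 'm set) set \<Rightarrow> ('m \<Rightarrow> real) \<Rightarrow> real" where
  "C2_norm \<K> f =
     (\<Sum>(U, \<phi>, K) \<in> \<K>.
        let D = \<phi> ` U; g = f \<circ> inv_into U \<phi> in
        SUP x \<in> \<phi> ` K.
          \<bar>g x\<bar> + norm (blin_deriv D g x) + norm (blin_deriv D (blin_deriv D g) x))"

definition C2_topology ::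
  "'m topology \<Rightarrow> ('m set \<times> ('m \<Rightarrow> 'e::real_inner)) set \<Rightarrow>
   ('m set \<times> ('m \<Rightarrow> 'e) \<times> 'm set) set \<Rightarrow> ('m \<Rightarrow> real) topology" where
  "C2_topology T \<A> \<K> =
     topology (\<lambda>G. G \<subseteq> C2_space T \<A> \<and>
       (\<forall>f\<in>G. \<exists>\<epsilon>>0. \<forall>g\<in>C2_space T \<A>. C2_norm \<K> (\<lambda>p. g p - f p) < \<epsilon> \<longrightarrow> g \<in> G))"

lemma openin_C2_topology:
  "openin (C2_topology T \<A> \<K>) G \<longleftrightarrow>
     G \<subseteq> C2_space T \<A> \<and>
     (\<forall>f\<in>G. \<exists>\<epsilon>>0. \<forall>g\<in>C2_space T \<A>. C2_norm \<K> (\<lambda>p. g p - f p) < \<epsilon> \<longrightarrow> g \<in> G)"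
proof -
  let ?P = "\<lambda>G. G \<subseteq> C2_space T \<A> \<and>
    (\<forall>f\<in>G. \<exists>\<epsilon>>0. \<forall>g\<in>C2_space T \<A>. C2_norm \<K> (\<lambda>p. g p - f p) < \<epsilon> \<longrightarrow> g \<in> G)"
  have "?P (G1 \<inter> G2)" if 1: "?P G1" and 2: "?P G2" for G1 G2
  proof (intro conjI ballI)
    show "G1 \<inter> G2 \<subseteq> C2_space T \<A>" using 1 by blast
    fix f assume f: "f \<in> G1 \<inter> G2"
    obtain a where a: "a > 0" "\<forall>g\<in>C2_space T \<A>. C2_norm \<K> (\<lambda>p. g p - f p) < a \<longrightarrow> g \<in> G1"
      using 1 f by blast
    obtain b where b: "b > 0" "\<forall>g\<in>C2_space T \<A>. C2_norm \<K> (\<lambda>p. g p - f p) < b \<longrightarrow> g \<in> G2"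
      using 2 f by blast
    show "\<exists>\<epsilon>>0. \<forall>g\<in>C2_space T \<A>. C2_norm \<K> (\<lambda>p. g p - f p) < \<epsilon> \<longrightarrow> g \<in> G1 \<inter> G2"
      using a b by (intro exI[of _ "min a b"]) auto
  qed
  moreover have "?P (\<Union>\<G>)" if "\<forall>G\<in>\<G>. ?P G" for \<G>
    using that by (meson Sup_least UnionE UnionI)
  ultimately have "istopology ?P"
    unfolding istopology_def by blast
  then show ?thesis
    unfolding C2_topology_def by (simp add: topology_inverse')
qed

lemma topspace_C2_topology [simp]: "topspace (C2_topology T \<A> \<K>) = C2_space T \<A>"
proof
  show "topspace (C2_topology T \<A> \<K>) \<subseteq> C2_space T \<A>"
    using openin_C2_topology openin_topspace by blast
  have "openin (C2_topology T \<A> \<K>) (C2_space T \<A>)"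
    unfolding openin_C2_topology by (auto intro: exI[of _ "1::real"])
  then show "C2_space T \<A> \<subseteq> topspace (C2_topology T \<A> \<K>)"
    by (rule openin_subset)
qed

text \<open>In the rest \<open>B\<close> stands for the topology of a topological vector space of real functions with
  pointwise operations.\<close>

definition borel_sigma :: "'a topology \<Rightarrow> 'a measure" where
  "borel_sigma B = sigma (topspace B) {G. openin B G}"

definition continuous_dual :: "('m \<Rightarrow> real) topology \<Rightarrow> (('m \<Rightarrow> real) \<Rightarrow> real) set" where
  "continuous_dual B =
     {l. continuous_map B euclideanreal l \<and>
         (\<forall>f\<in>topspace B. \<forall>g\<in>topspace B. \<forall>a b.
            l (\<lambda>p. a * f p + b * g p) = a * l f + b * l g)}"

definition centered_gaussian_real :: "real measure \<Rightarrow> bool" where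
  "centered_gaussian_real \<nu> \<longleftrightarrow>
     \<nu> = return borel 0 \<or> (\<exists>\<sigma>>0. \<nu> = density lborel (normal_density 0 \<sigma>))"

definition centered_gaussian_element ::
  "'w measure \<Rightarrow> ('m \<Rightarrow> real) topology \<Rightarrow> ('w \<Rightarrow> 'm \<Rightarrow> real) \<Rightarrow> bool" where
  "centered_gaussian_element P B X \<longleftrightarrow>
     X \<in> measurable P (borel_sigma B) \<and>
     (\<forall>l\<in>continuous_dual B. centered_gaussian_real (distr P borel (\<lambda>\<omega>. l (X \<omega>))))"

definition law :: "'w measure \<Rightarrow> 'a topology \<Rightarrow> ('w \<Rightarrow> 'a) \<Rightarrow> 'a measure" where
  "law P B X = distr P (borel_sigma B) X"

definition topological_support :: "'a topology \<Rightarrow> 'a measure \<Rightarrow> 'a set" where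
  "topological_support B \<mu> = \<Inter>{F. closedin B F \<and> emeasure \<mu> (topspace B - F) = 0}"

text \<open>The Cameron--Martin space consists of the vectors \<open>h = \<integral> \<gamma>(x) x d\<mu>(x)\<close> (a weak integral), where
  \<open>\<gamma>\<close> ranges over the closure of the continuous dual in \<open>L\<^sup>2(\<mu>)\<close>.\<close>

definition cameron_martin_space ::
  "('m \<Rightarrow> real) topology \<Rightarrow> ('m \<Rightarrow> real) measure \<Rightarrow> ('m \<Rightarrow> real) set" where
  "cameron_martin_space B \<mu> =
     {h \<in> topspace B. \<exists>\<gamma>.
        \<gamma> \<in> borel_measurable \<mu> \<and> integrable \<mu> (\<lambda>x. (\<gamma> x)\<^sup>2) \<and>
        (\<forall>\<epsilon>>0. \<exists>l\<in>continuous_dual B. (LINT x|\<mu>. (\<gamma> x - l x)\<^sup>2) < \<epsilon>) \<and>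
        (\<forall>l\<in>continuous_dual B. l h = (LINT x|\<mu>. \<gamma> x * l x))}"

definition T_set ::
  "('m \<Rightarrow> real) set \<Rightarrow> ('m \<Rightarrow> real) \<Rightarrow> ('m \<Rightarrow> real) \<Rightarrow> real \<Rightarrow> ('m \<Rightarrow> real) \<Rightarrow> (real \<times> real) set" where
  "T_set V e f \<delta> h =
     {(s, t). s \<in> {-\<delta><..<\<delta>} \<and> t \<in> {-\<delta><..<\<delta>} \<and> (\<lambda>p. f p + s * h p + t * e p) \<in> V}"

end

theory Submission
  imports Defs
begin

text \<open>Let \<open>\<mu>\<close> be the law of \<open>X\<close>. Near \<open>f0 \<in> V\<close> take a ball \<open>W\<close> so small that two points of \<open>W\<close>
  differing by \<open>s h + t e\<close> have \<open>\<bar>s\<bar>, \<bar>t\<bar> < \<delta>\<close>; this is possible since \<open>h\<close> is not a multiple of \<open>e\<close>. Then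
  the hypothesis says that each line parallel to \<open>h\<close> meets the set of all \<open>f\<close> with
  \<open>f + t e \<in> V \<inter> W\<close> for some \<open>t\<close> in a Lebesgue null set. Since \<open>h\<close> is a Cameron--Martin vector, \<open>\<mu>\<close> is a
  mixture of absolutely continuous measures on these lines, so a measurable set with this property is
  \<open>\<mu>\<close>-null. The set in question is only a projection of a Borel set; but the outer measure of the
  projection, with \<open>t\<close> bounded, is a Choquet capacity for the paving of closed sets, and the projection
  of a closed set is closed. Finitely many charts and derivatives suffice to describe the topology of
  \<open>C\<^sup>2(M)\<close>, which makes it separable with Borel sets generated by the dual, and countably many of the
  balls cover \<open>V\<close>.\<close>

section \<open>Capacitability of Borel sets\<close>

text \<open>The hypothesis is available only at base points of a relatively open subset of the
  support, while the disintegration of the Gaussian law yields lines through arbitrary points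
  \<open>f\<close> of the space. The gap closes because a line that meets the projection lies in a
  plane \<open>f + s h + t e\<close> containing a point \<open>g\<close> of \<open>V\<close>, and
  \<open>g\<close> can serve as base point: the exceptional parameters for \<open>f\<close> lie in a
  translate of the null set belonging to \<open>g\<close>.

  A projection of a Borel set need not be Borel, so it cannot be inserted into the mixture of
  measures directly. Closed subsets \<open>K\<close> of \<open>V \<inter> W\<close> can, since their
  projections are measurable and inherit the null lines; capacitability carries nullity from all
  such \<open>K\<close> to the Borel set. For the same reason the final event is a null set of the
  completion of \<open>P\<close>.

  The vector \<open>e\<close> may be 0, so the smallness of \<open>t\<close> is a statement about
  the vector \<open>t e\<close> and not about the coefficient.\<close>

lemma prefix_choice:
  fixes R :: "nat \<Rightarrow> (nat \<Rightarrow> 'b) \<Rightarrow> bool"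
  assumes base: "R 0 m0"
    and step: "\<And>n m. R n m \<Longrightarrow> \<exists>v. R (Suc n) (m(n := v))"
    and cong: "\<And>n m m'. (\<And>i. i < n \<Longrightarrow> m i = m' i) \<Longrightarrow> R n m \<Longrightarrow> R n m'"
  obtains m where "\<And>n. R n m"
proof -
  have "\<exists>M. \<forall>n. R n (M n) \<and> (\<exists>v. M (Suc n) = (M n)(n := v))"
    by (rule dependent_nat_choice) (use base step in blast)+
  then obtain M where M: "\<And>n. R n (M n)" "\<And>n. \<exists>v. M (Suc n) = (M n)(n := v)"
    by blast
  \<comment> \<open>Stage \<open>Suc n\<close> alters entry \<open>n\<close> only, so entry
    \<open>i\<close> is final from stage \<open>Suc i\<close> on and the diagonal sequence agrees
    with every finite prefix.\<close>
  have stable: "M n i = M (Suc i) i" if "i < n" for n i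
    using that
  proof (induction n)
    case (Suc n)
    then show ?case using M(2)[of n] by (cases "i = n") auto
  qed simp
  have "R n (\<lambda>i. M (Suc i) i)" for n
    by (rule cong[OF _ M(1)[of n]]) (rule stable)
  then show thesis by (rule that)
qed

text \<open>Souslin schemes are usually indexed by finite sequences. Here the index is an infinite
  sequence of which level \<open>n\<close> may read only the first \<open>n\<close> entries, so that
  reindexing is plain composition of functions.\<close>

definition souslin_scheme :: "'a set set \<Rightarrow> (nat \<Rightarrow> (nat \<Rightarrow> nat) \<Rightarrow> 'a set) \<Rightarrow> bool" where
  "souslin_scheme \<C> C \<longleftrightarrow>
     (\<forall>n \<sigma>. C n \<sigma> \<in> \<C>) \<and> (\<forall>n \<sigma> \<tau>. (\<forall>i<n. \<sigma> i = \<tau> i) \<longrightarrow> C n \<sigma> = C n \<tau>)"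

definition souslin :: "'a set set \<Rightarrow> 'a set \<Rightarrow> bool" where
  "souslin \<C> A \<longleftrightarrow> (\<exists>C. souslin_scheme \<C> C \<and> A = (\<Union>\<sigma>. \<Inter>n. C n \<sigma>))"

lemma souslin_base: "K \<in> \<C> \<Longrightarrow> souslin \<C> K"
  unfolding souslin_def souslin_scheme_def by (rule exI[of _ "\<lambda>_ _. K"]) auto

text \<open>Entry 0 of the sequence selects the set \<open>A i\<close>, and the remaining entries
  run through its scheme. Level 0 may not read any entry, so it is filled with the largest member
  \<open>\<Omega>\<close> of the paving.\<close>

lemma souslin_UN:
  fixes A :: "nat \<Rightarrow> 'a set"
  assumes A: "\<And>i. souslin \<C> (A i)" and \<Omega>: "\<Omega> \<in> \<C>" "\<And>K. K \<in> \<C> \<Longrightarrow> K \<subseteq> \<Omega>"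
  shows "souslin \<C> (\<Union>i. A i)"
proof -
  from A obtain C where "\<And>i. souslin_scheme \<C> (C i)" and C_A: "\<And>i. A i = (\<Union>\<sigma>. \<Inter>n. C i n \<sigma>)"
    unfolding souslin_def by metis
  then have C: "C i n \<sigma> \<in> \<C>"
    "(\<And>j. j < n \<Longrightarrow> \<sigma> j = \<tau> j) \<Longrightarrow> C i n \<sigma> = C i n \<tau>" for i n \<sigma> \<tau>
    unfolding souslin_scheme_def by blast+
  define C' where "C' n \<sigma> = (case n of 0 \<Rightarrow> \<Omega> | Suc m \<Rightarrow> C (\<sigma> 0) m (\<lambda>j. \<sigma> (Suc j)))"
    for n and \<sigma> :: "nat \<Rightarrow> nat"
  have eq: "(\<Inter>n. C' n \<sigma>) = (\<Inter>n. C (\<sigma> 0) n (\<lambda>j. \<sigma> (Suc j)))" for \<sigma>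
  proof
    show "(\<Inter>n. C' n \<sigma>) \<subseteq> (\<Inter>n. C (\<sigma> 0) n (\<lambda>j. \<sigma> (Suc j)))"
    proof
      fix x assume "x \<in> (\<Inter>n. C' n \<sigma>)"
      then have "x \<in> C' (Suc n) \<sigma>" for n by blast
      then show "x \<in> (\<Inter>n. C (\<sigma> 0) n (\<lambda>j. \<sigma> (Suc j)))" by (simp add: C'_def)
    qed
    show "(\<Inter>n. C (\<sigma> 0) n (\<lambda>j. \<sigma> (Suc j))) \<subseteq> (\<Inter>n. C' n \<sigma>)"
      using C(1) \<Omega>(2) by (fastforce simp: C'_def split: nat.split)
  qed
  show ?thesis unfolding souslin_def souslin_scheme_def
  proof (intro exI[of _ C'] conjI allI impI)
    show "C' n \<sigma> \<in> \<C>" for n \<sigma> using C(1) \<Omega>(1) by (simp add: C'_def split: nat.split)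
    show "C' n \<sigma> = C' n \<tau>" if "\<forall>i<n. \<sigma> i = \<tau> i" for n \<sigma> \<tau>
      using that by (auto simp: C'_def split: nat.split intro!: C(2))
    show "(\<Union>i. A i) = (\<Union>\<sigma>. \<Inter>n. C' n \<sigma>)"
    proof -
      have "(\<Union>\<sigma>. \<Inter>n. C' n \<sigma>) = (\<Union>i. \<Union>\<sigma>. \<Inter>n. C i n \<sigma>)"
      proof (unfold eq, intro equalityI subsetI)
        fix x assume "x \<in> (\<Union>i. \<Union>\<sigma>. \<Inter>n. C i n \<sigma>)"
        then obtain i \<sigma> where "x \<in> (\<Inter>n. C i n \<sigma>)" by blast
        then have "x \<in> (\<Inter>n. C (case_nat i \<sigma> 0) n (\<lambda>j. case_nat i \<sigma> (Suc j)))" by simp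
        then show "x \<in> (\<Union>\<sigma>. \<Inter>n. C (\<sigma> 0) n (\<lambda>j. \<sigma> (Suc j)))" by blast
      qed blast
      then show ?thesis using C_A by simp
    qed
  qed
qed

text \<open>One sequence codes countably many through the pairing function, and level
  \<open>prod_encode (i, k)\<close> carries level \<open>k\<close> of the \<open>i\<close>-th
  scheme. It reads the entries \<open>prod_encode (i, j)\<close> with \<open>j < k\<close>, which
  are admissible because pairing is increasing in its second argument.\<close>

lemma souslin_INT:
  fixes A :: "nat \<Rightarrow> 'a set"
  assumes A: "\<And>i. souslin \<C> (A i)"
  shows "souslin \<C> (\<Inter>i. A i)"
proof -
  from A obtain C where "\<And>i. souslin_scheme \<C> (C i)" and C_A: "\<And>i. A i = (\<Union>\<sigma>. \<Inter>n. C i n \<sigma>)"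
    unfolding souslin_def by metis
  then have C: "C i n \<sigma> \<in> \<C>"
    "(\<And>j. j < n \<Longrightarrow> \<sigma> j = \<tau> j) \<Longrightarrow> C i n \<sigma> = C i n \<tau>" for i n \<sigma> \<tau>
    unfolding souslin_scheme_def by blast+
  define C' where "C' n \<sigma> = C (fst (prod_decode n)) (snd (prod_decode n))
      (\<lambda>j. \<sigma> (prod_encode (fst (prod_decode n), j)))" for n and \<sigma> :: "nat \<Rightarrow> nat"
  have C'_encode: "C' (prod_encode (i, k)) \<sigma> = C i k (\<lambda>j. \<sigma> (prod_encode (i, j)))" for i k \<sigma>
    by (simp add: C'_def)
  have triangle_mono: "triangle a < triangle b" if "a < b" for a b
    using that by (induction b) (auto simp: less_Suc_eq)
  have mono: "prod_encode (i, j) < prod_encode (i, k)" if "j < k" for i j k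
    using triangle_mono[of "i + j" "i + k"] that by (simp add: prod_encode_def)
  show ?thesis unfolding souslin_def souslin_scheme_def
  proof (intro exI[of _ C'] conjI allI impI)
    show "C' n \<sigma> \<in> \<C>" for n \<sigma> using C(1) by (simp add: C'_def)
    show "C' n \<sigma> = C' n \<tau>" if *: "\<forall>i<n. \<sigma> i = \<tau> i" for n \<sigma> \<tau>
    proof -
      obtain i k where n: "n = prod_encode (i, k)" by (metis prod_decode_inverse surj_pair)
      show ?thesis unfolding n C'_encode using * mono n by (intro C(2)) auto
    qed
    show "(\<Inter>i. A i) = (\<Union>\<sigma>. \<Inter>n. C' n \<sigma>)"
    proof (intro equalityI subsetI)
      fix x assume "x \<in> (\<Inter>i. A i)"
      then have "\<forall>i. \<exists>\<sigma>. \<forall>n. x \<in> C i n \<sigma>" using C_A by auto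
      then obtain \<sigma> where \<sigma>: "\<And>i n. x \<in> C i n (\<sigma> i)" by metis
      define \<tau> where "\<tau> n = \<sigma> (fst (prod_decode n)) (snd (prod_decode n))" for n
      have "x \<in> C' n \<tau>" for n
        using \<sigma> by (simp add: C'_def \<tau>_def)
      then show "x \<in> (\<Union>\<sigma>. \<Inter>n. C' n \<sigma>)" by blast
    next
      fix x assume "x \<in> (\<Union>\<sigma>. \<Inter>n. C' n \<sigma>)"
      then obtain \<sigma> where "\<And>n. x \<in> C' n \<sigma>" by blast
      then have "x \<in> C i k (\<lambda>j. \<sigma> (prod_encode (i, j)))" for i k
        using C'_encode by blast
      then show "x \<in> (\<Inter>i. A i)" using C_A by blast
    qed
  qed
qed

text \<open>Souslin sets are in general not closed under complements, so the induction carries a set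
  together with its complement. Open sets enter as countable unions of closed ones.\<close>

lemma borel_souslin:
  assumes A: "A \<in> sigma_sets \<Omega> {G. openin B G}" and \<Omega>: "\<Omega> = topspace B"
    and fsigma: "\<And>G. openin B G \<Longrightarrow> \<exists>F :: nat \<Rightarrow> 'a set. (\<forall>n. closedin B (F n)) \<and> G = (\<Union>n. F n)"
  shows "souslin {F. closedin B F} A"
proof -
  let ?S = "souslin {F. closedin B F}"
  have \<Omega>': "\<Omega> \<in> {F. closedin B F}" "\<And>K. K \<in> {F. closedin B F} \<Longrightarrow> K \<subseteq> \<Omega>"
    using \<Omega> closedin_subset by auto
  have "?S A \<and> ?S (\<Omega> - A)" using A
  proof induction
    case (Basic G)
    then obtain F :: "nat \<Rightarrow> 'a set" where "\<And>n. closedin B (F n)" "G = (\<Union>n. F n)"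
      using fsigma by blast
    then show ?case
      using Basic \<Omega> by (auto intro!: souslin_UN[OF _ \<Omega>'] intro: souslin_base)
  next
    case Empty
    then show ?case using \<Omega>' by (auto intro!: souslin_base)
  next
    case (Compl a)
    have "a \<subseteq> \<Omega>"
      by (rule sigma_sets_into_sp[OF _ Compl(1)]) (use \<Omega> openin_subset in auto)
    then show ?case using Compl.IH by (simp add: double_diff)
  next
    case (Union a)
    have eq: "\<Omega> - (\<Union>i. a i) = (\<Inter>i. \<Omega> - a i)" by auto
    show ?case unfolding eq
      by (intro conjI souslin_UN[OF _ \<Omega>'] souslin_INT) (use Union.IH in blast)+
  qed
  then show ?thesis ..
qed

text \<open>Koenig's lemma for the finitely branching tree of sequences bounded by \<open>m\<close>.
  The invariant \<open>R n \<tau>\<close> says that the first \<open>n\<close> entries of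
  \<open>\<tau>\<close> extend to admissible prefixes of every length.\<close>

lemma konig_bounded:
  fixes C :: "nat \<Rightarrow> (nat \<Rightarrow> nat) \<Rightarrow> 'a set"
  assumes dep: "\<And>n \<sigma> \<tau>. (\<And>i. i < n \<Longrightarrow> \<sigma> i = \<tau> i) \<Longrightarrow> C n \<sigma> = C n \<tau>"
    and ex: "\<And>n. \<exists>\<sigma>. (\<forall>i<n. \<sigma> i \<le> m i) \<and> (\<forall>k\<le>n. x \<in> C k \<sigma>)"
  obtains \<sigma> where "\<And>k. x \<in> C k \<sigma>"
proof -
  define R where "R n \<tau> \<longleftrightarrow>
      (\<forall>N\<ge>n. \<exists>\<sigma>. (\<forall>i<n. \<sigma> i = \<tau> i) \<and> (\<forall>i<N. \<sigma> i \<le> m i) \<and> (\<forall>k\<le>N. x \<in> C k \<sigma>))"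
    for n \<tau>
  have step: "\<exists>v. R (Suc n) (\<tau>(n := v))" if R: "R n \<tau>" for n \<tau>
  proof (rule ccontr)
    assume "\<not> ?thesis"
    then have "\<forall>v. \<exists>N\<ge>Suc n. \<not> (\<exists>\<sigma>. (\<forall>i<Suc n. \<sigma> i = (\<tau>(n := v)) i) \<and> (\<forall>i<N. \<sigma> i \<le> m i) \<and>
        (\<forall>k\<le>N. x \<in> C k \<sigma>))" by (auto simp: R_def)
    then obtain N where N: "\<And>v. N v \<ge> Suc n" "\<And>v. \<not> (\<exists>\<sigma>. (\<forall>i<Suc n. \<sigma> i = (\<tau>(n := v)) i) \<and>
        (\<forall>i<N v. \<sigma> i \<le> m i) \<and> (\<forall>k\<le>N v. x \<in> C k \<sigma>))" by metis
    \<comment> \<open>If every next entry \<open>v\<close> fails at some length \<open>N v\<close>,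
      then the finitely many \<open>v \<le> m n\<close> all fail by the common length
      \<open>M\<close>, although an admissible prefix of length \<open>M\<close> exists.\<close>
    define M where "M = Max (N ` {..m n})"
    have M: "N v \<le> M" if "v \<le> m n" for v using that by (simp add: M_def)
    have "Suc n \<le> M" using N(1)[of 0] M[of 0] by simp
    then have "n \<le> M" by simp
    then obtain \<sigma> where \<sigma>: "\<forall>i<n. \<sigma> i = \<tau> i" "\<forall>i<M. \<sigma> i \<le> m i" "\<forall>k\<le>M. x \<in> C k \<sigma>"
      using R[unfolded R_def, rule_format, of M] by metis
    have "N (\<sigma> n) \<le> M" using M \<sigma>(2) \<open>Suc n \<le> M\<close> by simp
    with \<sigma> N(2)[of "\<sigma> n"] show False by (auto simp: less_Suc_eq)
  qed
  have cong: "R n \<tau>'" if "\<And>i. i < n \<Longrightarrow> \<tau> i = \<tau>' i" "R n \<tau>" for n \<tau> \<tau>'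
    using that by (simp add: R_def)
  have base: "R 0 \<tau>" for \<tau> using ex by (simp add: R_def)
  obtain \<tau> where \<tau>: "\<And>n. R n \<tau>"
  proof (rule prefix_choice[of R, OF base])
    show "\<exists>v. R (Suc n) (\<tau>(n := v))" if "R n \<tau>" for n \<tau>
      using that by (rule step)
    show "R n \<tau>'" if "\<And>i. i < n \<Longrightarrow> \<tau> i = \<tau>' i" "R n \<tau>" for n \<tau> \<tau>'
      using that by (rule cong)
  qed (rule that)
  have "x \<in> C k \<tau>" for k
  proof -
    obtain \<sigma> where "\<forall>i<k. \<sigma> i = \<tau> i" "x \<in> C k \<sigma>"
      using \<tau>[of k] by (auto simp: R_def)
    then show ?thesis using dep[of k \<sigma> \<tau>] by auto
  qed
  then show thesis by (rule that)
qed

text \<open>The entries of the index sequences are bounded one after the other. Raising the bound on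
  the next entry exhausts the current set increasingly, so continuity from below keeps the capacity
  above \<open>c\<close> for some finite bound. The sequences bounded by the resulting
  \<open>m\<close> form a compact set, which makes the approximation by finitely many levels exact
  in the limit.\<close>

theorem choquet_capacitability:
  fixes \<Phi> :: "'a set \<Rightarrow> ennreal"
  assumes A: "souslin {F. closedin B F} A"
    and mono: "\<And>X Y. X \<subseteq> Y \<Longrightarrow> \<Phi> X \<le> \<Phi> Y"
    and inc: "\<And>X :: nat \<Rightarrow> 'a set. incseq X \<Longrightarrow> \<Phi> (\<Union>n. X n) = (SUP n. \<Phi> (X n))"
    and dec: "\<And>F :: nat \<Rightarrow> 'a set. decseq F \<Longrightarrow> (\<And>n. closedin B (F n)) \<Longrightarrow> (INF n. \<Phi> (F n)) \<le> \<Phi> (\<Inter>n. F n)"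
    and c: "c < \<Phi> A"
  obtains K where "closedin B K" "K \<subseteq> A" "c \<le> \<Phi> K"
proof -
  from A obtain C where C0: "souslin_scheme {F. closedin B F} C" and C3: "A = (\<Union>\<sigma>. \<Inter>n. C n \<sigma>)"
    unfolding souslin_def by metis
  have C: "closedin B (C n \<sigma>)" "(\<And>i. i < n \<Longrightarrow> \<sigma> i = \<tau> i) \<Longrightarrow> C n \<sigma> = C n \<tau>" for n \<sigma> \<tau>
    using C0 unfolding souslin_scheme_def by blast+
  define W where "W n m = {\<sigma> :: nat \<Rightarrow> nat. \<forall>i<n. \<sigma> i \<le> m i}" for n m
  define D where "D n m = (\<Union>\<sigma>\<in>W n m. \<Inter>k. C k \<sigma>)" for n m
  have "\<exists>v. c < \<Phi> (D (Suc n) (m(n := v)))" if "c < \<Phi> (D n m)" for n m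
  proof -
    have "W (Suc n) (m(n := v)) \<subseteq> W (Suc n) (m(n := v'))" if "v \<le> v'" for v v'
      using that by (auto simp: W_def less_Suc_eq)
    then have "incseq (\<lambda>v. D (Suc n) (m(n := v)))"
      unfolding D_def by (intro monoI UN_mono) auto
    moreover have "W n m = (\<Union>v. W (Suc n) (m(n := v)))"
      by (auto simp: W_def less_Suc_eq)
    then have "D n m = (\<Union>v. D (Suc n) (m(n := v)))" by (auto simp: D_def)
    ultimately have "\<Phi> (D n m) = (SUP v. \<Phi> (D (Suc n) (m(n := v))))" using inc by metis
    then show ?thesis using that by (simp add: less_SUP_iff)
  qed
  moreover have "c < \<Phi> (D 0 m)" for m using c by (simp add: D_def W_def C3)
  moreover have "c < \<Phi> (D n m')" if "\<And>i. i < n \<Longrightarrow> m i = m' i" "c < \<Phi> (D n m)" for n m m'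
    using that by (simp add: D_def W_def)
  ultimately obtain m where m: "\<And>n. c < \<Phi> (D n m)"
    using prefix_choice[of "\<lambda>n m. c < \<Phi> (D n m)"] by blast
  \<comment> \<open>Cutting off after level \<open>n\<close> leaves a dependence on finitely many
    bounded prefixes only, so \<open>F n\<close> is a finite union of closed sets. It still contains
    \<open>D n m\<close> and thus has capacity above \<open>c\<close>.\<close>
  define F where "F n = (\<Union>\<sigma>\<in>W n m. \<Inter>k\<le>n. C k \<sigma>)" for n
  have "closedin B (F n)" for n
  proof -
    let ?P = "PiE {..<n} (\<lambda>i. {..m i})"
    have "F n = (\<Union>\<sigma>\<in>?P. \<Inter>k\<le>n. C k \<sigma>)"
    proof (intro equalityI subsetI)
      fix x assume "x \<in> F n"
      then obtain \<sigma> where \<sigma>: "\<sigma> \<in> W n m" "\<And>k. k \<le> n \<Longrightarrow> x \<in> C k \<sigma>" by (auto simp: F_def)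
      have P: "restrict \<sigma> {..<n} \<in> ?P" using \<sigma>(1) by (auto simp: W_def)
      have "C k (restrict \<sigma> {..<n}) = C k \<sigma>" if "k \<le> n" for k
        using that by (intro C(2)) simp
      then show "x \<in> (\<Union>\<sigma>\<in>?P. \<Inter>k\<le>n. C k \<sigma>)"
        using \<sigma>(2) by (intro UN_I[OF P]) simp
    next
      fix x assume "x \<in> (\<Union>\<sigma>\<in>?P. \<Inter>k\<le>n. C k \<sigma>)"
      then obtain \<sigma> where "\<sigma> \<in> ?P" "x \<in> (\<Inter>k\<le>n. C k \<sigma>)" by blast
      moreover from this(1) have "\<sigma> \<in> W n m" by (auto simp: W_def)
      ultimately show "x \<in> F n" unfolding F_def by blast
    qed
    moreover have "finite ?P" by (intro finite_PiE) auto
    ultimately show ?thesis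
      using C(1) by (auto intro!: closedin_Union closedin_Inter)
  qed
  moreover have "decseq F"
  proof (rule decseq_SucI, rule subsetI)
    fix n x assume "x \<in> F (Suc n)"
    then obtain \<sigma> where "\<sigma> \<in> W (Suc n) m" "\<And>k. k \<le> Suc n \<Longrightarrow> x \<in> C k \<sigma>"
      unfolding F_def by blast
    then have "\<sigma> \<in> W n m" "\<And>k. k \<le> n \<Longrightarrow> x \<in> C k \<sigma>" by (simp_all add: W_def)
    then show "x \<in> F n" unfolding F_def by blast
  qed
  ultimately have "(INF n. \<Phi> (F n)) \<le> \<Phi> (\<Inter>n. F n)" by (intro dec)
  moreover have "c \<le> (INF n. \<Phi> (F n))"
  proof (rule INF_greatest)
    fix n
    have "D n m \<subseteq> F n" by (auto simp: D_def F_def)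
    then show "c \<le> \<Phi> (F n)" using m[of n] mono by (meson less_imp_le order_trans)
  qed
  moreover have "(\<Inter>n. F n) \<subseteq> A"
  proof
    fix x assume "x \<in> (\<Inter>n. F n)"
    then have F: "x \<in> F n" for n by blast
    have "\<exists>\<sigma>. (\<forall>i<n. \<sigma> i \<le> m i) \<and> (\<forall>k\<le>n. x \<in> C k \<sigma>)" for n
    proof -
      obtain \<sigma> where "\<sigma> \<in> W n m" "x \<in> (\<Inter>k\<le>n. C k \<sigma>)"
        using F[of n] unfolding F_def by blast
      then show ?thesis by (auto simp: W_def)
    qed
    then obtain \<sigma> where "\<And>k. x \<in> C k \<sigma>"
      using konig_bounded[of C m x] C(2) by blast
    then show "x \<in> A" using C3 by blast
  qed
  moreover have "closedin B (\<Inter>n. F n)"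
    using \<open>\<And>n. closedin B (F n)\<close> by (intro closedin_INT) auto
  ultimately show thesis by (intro that) auto
qed

section \<open>Measures determined by their characteristic functional\<close>

text \<open>The common mass is the value at \<open>t = 0\<close>. Dividing by it reduces the claim
  to the uniqueness theorem for probability measures; mass 0 is treated apart.\<close>

lemma finite_real_measure_eqI_char:
  fixes M1 M2 :: "real measure"
  assumes fin: "finite_measure M1" "finite_measure M2"
    and sets: "sets M1 = sets borel" "sets M2 = sets borel"
    and eq: "\<And>t. (CLINT x|M1. iexp (t * x)) = (CLINT x|M2. iexp (t * x))"
  shows "M1 = M2"
proof -
  interpret M1: finite_measure M1 by (rule fin)
  interpret M2: finite_measure M2 by (rule fin)
  have sp: "space M1 = UNIV" "space M2 = UNIV" using sets[THEN sets_eq_imp_space_eq] by auto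
  have "complex_of_real (measure M1 UNIV) = complex_of_real (measure M2 UNIV)"
    using eq[of 0] sp by simp
  then have mass: "measure M1 UNIV = measure M2 UNIV" by simp
  define c where "c = measure M1 UNIV"
  show ?thesis
  proof (cases "c = 0")
    case True
    have "emeasure M A = 0" if "finite_measure M" "space M = UNIV" "measure M UNIV = 0"
      for M :: "real measure" and A
    proof -
      have "emeasure M A \<le> emeasure M (space M)" by (rule emeasure_space)
      also have "\<dots> = 0" using that by (simp add: finite_measure.emeasure_eq_measure)
      finally show ?thesis by simp
    qed
    then show ?thesis
      using True mass sp fin by (intro measure_eqI) (auto simp: sets c_def)
  next
    case False
    then have c: "c > 0" by (simp add: c_def less_le)
    let ?N = "\<lambda>M :: real measure. density M (\<lambda>_. ennreal (1 / c))"
    have dist: "real_distribution (?N M)"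
      if "finite_measure M" "sets M = sets borel" "measure M UNIV = c" "space M = UNIV" for M
    proof -
      have "emeasure M UNIV = ennreal c"
        using that by (simp add: finite_measure.emeasure_eq_measure)
      moreover have "UNIV \<in> sets M" using that by simp
      ultimately have "emeasure (?N M) UNIV = 1"
        using c by (simp add: emeasure_density_const flip: ennreal_mult)
      then have "prob_space (?N M)" using that by (intro prob_spaceI) simp
      then show ?thesis
        using that by (auto simp: real_distribution_def real_distribution_axioms_def)
    qed
    have char: "char (?N M) t = (CLINT x|M. iexp (t * x)) / c" if "sets M = sets borel" for M t
    proof -
      have "(\<lambda>x. iexp (t * x)) \<in> borel_measurable M"
        using that by (simp cong: measurable_cong_sets)
      then have "char (?N M) t = (1 / c) *\<^sub>R (CLINT x|M. iexp (t * x))"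
        unfolding char_def using c by (subst integral_density) auto
      then show ?thesis by (simp add: scaleR_conv_of_real)
    qed
    have N: "?N M1 = ?N M2"
      using dist[OF fin(1) sets(1)] dist[OF fin(2) sets(2)] mass sp
      by (intro Levy_uniqueness ext) (simp_all only: c_def[symmetric] char sets eq mass[symmetric])
    have "emeasure M1 A = emeasure M2 A" if A: "A \<in> sets borel" for A
    proof -
      have "ennreal (1 / c) * emeasure M1 A = ennreal (1 / c) * emeasure M2 A"
        using arg_cong[OF N, of "\<lambda>M. emeasure M A"] A by (simp add: sets emeasure_density_const)
      then show ?thesis using c by (simp add: ennreal_mult_cancel_left)
    qed
    then show ?thesis by (intro measure_eqI) (auto simp: sets)
  qed
qed

definition cylinder_sigma :: "'a set \<Rightarrow> ('a \<Rightarrow> real) set \<Rightarrow> 'a measure" where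
  "cylinder_sigma S L = sigma S {l -` A \<inter> S |l A. l \<in> L \<and> A \<in> sets borel}"

lemma space_cylinder_sigma [simp]: "space (cylinder_sigma S L) = S"
  unfolding cylinder_sigma_def by (rule space_measure_of) auto

lemma sets_cylinder_sigma:
  "sets (cylinder_sigma S L) = sigma_sets S {l -` A \<inter> S |l A. l \<in> L \<and> A \<in> sets borel}"
  unfolding cylinder_sigma_def by (rule sets_measure_of) auto

lemma measurable_cylinder_sigmaI:
  assumes "\<And>x. x \<in> space M \<Longrightarrow> F x \<in> S" "\<And>l. l \<in> L \<Longrightarrow> (\<lambda>x. l (F x)) \<in> borel_measurable M"
  shows "F \<in> measurable M (cylinder_sigma S L)"
  unfolding cylinder_sigma_def
proof (rule measurable_measure_of)
  fix D assume "D \<in> {l -` A \<inter> S |l A. l \<in> L \<and> A \<in> sets borel}"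
  then obtain l A where D: "D = l -` A \<inter> S" "l \<in> L" "A \<in> sets borel" by blast
  then have "F -` D \<inter> space M = (\<lambda>x. l (F x)) -` A \<inter> space M" using assms(1) by auto
  then show "F -` D \<inter> space M \<in> sets M" using assms(2) D(2,3) by (simp add: measurable_sets)
qed (use assms(1) in auto)

lemma measurable_cylinder_sigma_functional:
  "l \<in> L \<Longrightarrow> l \<in> borel_measurable (cylinder_sigma S L)"
  by (rule measurableI) (auto simp: sets_cylinder_sigma)

text \<open>The equality of the characteristic functionals is propagated to the measures restricted to one
  cylinder after the other; the weights \<open>1 + cos (l - \<theta>)\<close> keep these restrictions positive, so that
  the uniqueness theorem on the real line applies.\<close>

theorem cylinder_measure_eqI_char:
  fixes \<mu> \<nu> :: "'a measure"
  assumes prob: "prob_space \<mu>" "prob_space \<nu>"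
    and sets: "sets \<mu> = sets (cylinder_sigma S L)" "sets \<nu> = sets (cylinder_sigma S L)"
    and nonempty: "L \<noteq> {}"
    and lin: "\<And>l l' a b. l \<in> L \<Longrightarrow> l' \<in> L \<Longrightarrow> (\<lambda>x. a * l x + b * l' x) \<in> L"
    and eq: "\<And>l. l \<in> L \<Longrightarrow> (CLINT x|\<mu>. iexp (l x)) = (CLINT x|\<nu>. iexp (l x))"
  shows "\<mu> = \<nu>"
proof -
  interpret \<mu>: prob_space \<mu> by (rule prob)
  interpret \<nu>: prob_space \<nu> by (rule prob)
  let ?G = "sets (cylinder_sigma S L)"
  have sp: "space \<mu> = S" "space \<nu> = S" using sets[THEN sets_eq_imp_space_eq] by simp_all
  have meas: "l \<in> borel_measurable M" if "l \<in> L" "sets M = ?G" for l and M :: "'a measure"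
    using measurable_cylinder_sigma_functional[OF that(1), of S] that(2)
    by (simp cong: measurable_cong_sets)
  \<comment> \<open>Goodness means that the restrictions of both measures to \<open>D\<close> have
    the same characteristic functional.\<close>
  define good where "good D \<longleftrightarrow> D \<in> ?G \<and>
    (\<forall>l\<in>L. (CLINT x|\<mu>. indicator D x *\<^sub>R iexp (l x)) = (CLINT x|\<nu>. indicator D x *\<^sub>R iexp (l x)))" for D
  have int: "integrable M (\<lambda>x. indicator D x *\<^sub>R iexp (l x))"
    if "prob_space M" "sets M = ?G" "D \<in> ?G" "l \<in> L" for M :: "'a measure" and D l
  proof -
    interpret prob_space M by fact
    show ?thesis
      using that meas[OF that(4,2)]
      by (intro integrable_const_bound[of _ 1]) (auto simp: indicator_def)
  qed
  \<comment> \<open>By Euler's formula the weight turns one exponential into a combination of three,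
    whose exponents are again functionals in \<open>L\<close>; their integrals over a good set are
    known to agree.\<close>
  have weight: "complex_of_real (1 + cos (l x - \<theta>)) * iexp y =
      iexp y + (iexp (- \<theta>) / 2) * iexp (y + l x) + (iexp \<theta> / 2) * iexp (y - l x)" for l x \<theta> y
    by (simp add: cos_of_real[symmetric] cos_exp_eq exp_diff exp_add exp_minus field_simps)
  have trig: "(LINT x|\<mu>. indicator D' x * cos (l x - \<theta>)) = (LINT x|\<nu>. indicator D' x * cos (l x - \<theta>))"
    if D: "good D" and l': "l' \<in> L" and A: "A \<in> sets borel" and l: "l \<in> L"
      and D': "D' = D \<inter> (l' -` A \<inter> S)" for D D' l l' A \<theta>
  proof -
    have DG: "D \<in> ?G" using D by (simp add: good_def)
    have D'G: "D' \<in> ?G"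
      using DG A measurable_sets[OF measurable_cylinder_sigma_functional[OF l', of S] A] by (simp add: D')
    have "(LINT x|\<mu>. indicator D' x * (1 + cos (k x - \<theta>))) = (LINT x|\<nu>. indicator D' x * (1 + cos (k x - \<theta>)))"
      if k: "k \<in> L" for k \<theta>
    proof -
      \<comment> \<open>The weight is nonnegative, so \<open>N M\<close> is a finite measure on the
        line. Its characteristic function involves only integrals over the good set
        \<open>D\<close>; uniqueness on the line gives \<open>N \<mu> = N \<nu>\<close>, and
        evaluation at \<open>A\<close> gives the weighted integrals over \<open>D'\<close>.\<close>
      define w where "w x = indicator D x * (1 + cos (k x - \<theta>))" for x
      define N where "N M = distr (density M (\<lambda>x. ennreal (w x))) borel l'" for M :: "'a measure"
      have w0: "w x \<ge> 0" for x
        unfolding w_def using cos_ge_minus_one[of "k x - \<theta>"] by (intro mult_nonneg_nonneg) (simp, linarith)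
      have w2: "w x \<le> 2" for x
        unfolding w_def using cos_le_one[of "k x - \<theta>"] by (auto simp: indicator_def)
      have N: "finite_measure (N M)"
          "(CLINT y|N M. iexp (t * y)) = (CLINT x|M. indicator D x *\<^sub>R iexp (t * l' x))
            + (iexp (- \<theta>) / 2) * (CLINT x|M. indicator D x *\<^sub>R iexp (t * l' x + 1 * k x))
            + (iexp \<theta> / 2) * (CLINT x|M. indicator D x *\<^sub>R iexp (t * l' x + (-1) * k x))"
          "measure (N M) A = (LINT x|M. indicator D' x * (1 + cos (k x - \<theta>)))"
        if M: "prob_space M" "sets M = ?G" for M t
      proof -
        interpret prob_space M by fact
        have spM: "space M = S" using sets_eq_imp_space_eq[OF M(2)] by simp
        have [measurable]: "l' \<in> borel_measurable M" "k \<in> borel_measurable M" "D \<in> sets M" "D' \<in> sets M"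
          using meas[OF l' M(2)] meas[OF k M(2)] DG D'G M(2) by simp_all
        have w[measurable]: "w \<in> borel_measurable M" unfolding w_def by measurable
        have wint: "integrable M w"
          by (rule integrable_const_bound[of _ 2]) (use w0 w2 in auto)
        have "emeasure (density M (\<lambda>x. ennreal (w x))) (space M) = ennreal (LINT x|M. w x)"
          using wint w0 by (simp add: emeasure_density nn_integral_eq_integral cong: nn_integral_cong)
        then have "finite_measure (density M (\<lambda>x. ennreal (w x)))"
          by (intro finite_measureI) simp
        then show "finite_measure (N M)"
          unfolding N_def by (rule finite_measure.finite_measure_distr) simp
        have "(CLINT y|N M. iexp (t * y)) = (CLINT x|M. w x *\<^sub>R iexp (t * l' x))"
          unfolding N_def using w0 by (simp add: integral_distr integral_density)
        also have "\<dots> = (CLINT x|M. indicator D x *\<^sub>R iexp (t * l' x + 0 * k x)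
            + ((iexp (- \<theta>) / 2) * (indicator D x *\<^sub>R iexp (t * l' x + 1 * k x))
            + (iexp \<theta> / 2) * (indicator D x *\<^sub>R iexp (t * l' x + (-1) * k x))))"
        proof (intro Bochner_Integration.integral_cong refl)
          fix x
          have "w x *\<^sub>R iexp (t * l' x) = indicator D x *\<^sub>R (complex_of_real (1 + cos (k x - \<theta>)) * iexp (t * l' x))"
            by (simp add: w_def scaleR_conv_of_real)
          then show "w x *\<^sub>R iexp (t * l' x) = indicator D x *\<^sub>R iexp (t * l' x + 0 * k x)
            + ((iexp (- \<theta>) / 2) * (indicator D x *\<^sub>R iexp (t * l' x + 1 * k x))
            + (iexp \<theta> / 2) * (indicator D x *\<^sub>R iexp (t * l' x + (-1) * k x)))"
            unfolding weight by (auto simp: indicator_def)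
        qed
        also have "\<dots> = (CLINT x|M. indicator D x *\<^sub>R iexp (t * l' x + 0 * k x))
            + ((iexp (- \<theta>) / 2) * (CLINT x|M. indicator D x *\<^sub>R iexp (t * l' x + 1 * k x))
            + (iexp \<theta> / 2) * (CLINT x|M. indicator D x *\<^sub>R iexp (t * l' x + (-1) * k x)))"
        proof -
          note i = int[OF M DG lin[OF l' k]]
          have m: "integrable M (\<lambda>x. c * (indicator D x *\<^sub>R iexp (a * l' x + b * k x)))" for a b c
            using i by (intro integrable_mult_right)
          show ?thesis
            by (simp only: Bochner_Integration.integral_add[OF i Bochner_Integration.integrable_add[OF m m]]
                Bochner_Integration.integral_add[OF m m] integral_mult_right_zero)
        qed
        finally show "(CLINT y|N M. iexp (t * y)) = (CLINT x|M. indicator D x *\<^sub>R iexp (t * l' x))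
            + (iexp (- \<theta>) / 2) * (CLINT x|M. indicator D x *\<^sub>R iexp (t * l' x + 1 * k x))
            + (iexp \<theta> / 2) * (CLINT x|M. indicator D x *\<^sub>R iexp (t * l' x + (-1) * k x))"
          by (simp add: add.assoc)
        have "measure (N M) A = (LINT y|N M. indicator A y)"
          unfolding N_def using A by simp
        also have "\<dots> = (LINT x|M. w x * indicator A (l' x))"
          unfolding N_def using w0 A by (subst integral_distr) (auto simp: integral_density)
        also have "\<dots> = (LINT x|M. indicator D' x * (1 + cos (k x - \<theta>)))"
          by (intro Bochner_Integration.integral_cong) (auto simp: w_def D' indicator_def spM)
        finally show "measure (N M) A = (LINT x|M. indicator D' x * (1 + cos (k x - \<theta>)))" .
      qed
      have g: "(CLINT x|\<mu>. indicator D x *\<^sub>R iexp (t * l' x + a * k x)) =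
          (CLINT x|\<nu>. indicator D x *\<^sub>R iexp (t * l' x + a * k x))" for t a
        using D lin[OF l' k, of t a] by (auto simp: good_def)
      have g0: "(CLINT x|\<mu>. indicator D x *\<^sub>R iexp (t * l' x)) = (CLINT x|\<nu>. indicator D x *\<^sub>R iexp (t * l' x))" for t
        using g[of t 0] by simp
      have "(CLINT y|N \<mu>. iexp (t * y)) = (CLINT y|N \<nu>. iexp (t * y))" for t
        by (simp only: N(2)[OF prob(1) sets(1)] N(2)[OF prob(2) sets(2)] g g0)
      then have "N \<mu> = N \<nu>"
        by (intro finite_real_measure_eqI_char N(1) prob sets) (simp_all add: N_def)
      then show ?thesis
        using N(3)[OF prob(1) sets(1)] N(3)[OF prob(2) sets(2)] by metis
    qed
    note one = this
    have zero: "(\<lambda>x. 0) \<in> L" using lin[OF l l, of 0 0] by simp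
    \<comment> \<open>The zero functional with \<open>\<theta> = 0\<close> has the constant weight
      2, which yields equal masses of \<open>D'\<close>. Subtracting them from the weighted
      integrals isolates the cosine.\<close>
    have ind: "(LINT x|\<mu>. indicator D' x :: real) = (LINT x|\<nu>. indicator D' x)"
      using one[OF zero, of 0] by simp
    have split: "(LINT x|M. indicator D' x * (1 + cos (l x - \<theta>))) =
        (LINT x|M. indicator D' x) + (LINT x|M. indicator D' x * cos (l x - \<theta>))"
      if M: "prob_space M" "sets M = ?G" for M
    proof -
      interpret prob_space M by fact
      have [measurable]: "l \<in> borel_measurable M" "D' \<in> sets M" using meas[OF l M(2)] D'G M(2) by simp_all
      have "integrable M (\<lambda>x. indicator D' x * cos (l x - \<theta>))"
        by (rule integrable_const_bound[of _ 1]) (auto simp: indicator_def)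
      moreover have "integrable M (\<lambda>x. indicator D' x :: real)"
        by (rule integrable_const_bound[of _ 1]) (auto simp: indicator_def)
      ultimately show ?thesis by (simp add: distrib_left)
    qed
    show ?thesis
      using one[OF l, of \<theta>] ind unfolding split[OF prob(1) sets(1)] split[OF prob(2) sets(2)] by simp
  qed
  have good_Int: "good (D \<inter> (l' -` A \<inter> S))" if D: "good D" "l' \<in> L" "A \<in> sets borel" for D l' A
  proof -
    let ?D = "D \<inter> (l' -` A \<inter> S)"
    have DG: "?D \<in> ?G"
      using D measurable_sets[OF measurable_cylinder_sigma_functional[OF D(2), of S] D(3)] by (auto simp: good_def)
    have "(CLINT x|\<mu>. indicator ?D x *\<^sub>R iexp (l x)) = (CLINT x|\<nu>. indicator ?D x *\<^sub>R iexp (l x))"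
      if l: "l \<in> L" for l
    proof -
      \<comment> \<open>The phases \<open>0\<close> and \<open>pi/2\<close> produce the real part
        \<open>cos (l x)\<close> and the imaginary part \<open>sin (l x)\<close>.\<close>
      have split: "(CLINT x|M. indicator ?D x *\<^sub>R iexp (l x)) =
          Complex (LINT x|M. indicator ?D x * cos (l x - 0)) (LINT x|M. indicator ?D x * cos (l x - pi/2))"
        if M: "prob_space M" "sets M = ?G" for M
      proof -
        note i = int[OF M DG l]
        show ?thesis
          using integral_Re[OF i] integral_Im[OF i]
          by (intro complex_eqI) (simp_all add: Re_exp Im_exp cos_diff)
      qed
      show ?thesis
        unfolding split[OF prob(1) sets(1)] split[OF prob(2) sets(2)]
        using trig[OF D l refl, of 0] trig[OF D l refl, of "pi/2"] by (simp only:)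
    qed
    with DG show ?thesis by (simp add: good_def)
  qed
  define \<P> where "\<P> = {S \<inter> (\<Inter>(l, A)\<in>F. l -` A) |F. finite F \<and> F \<subseteq> L \<times> sets borel}"
  have good_S: "good S"
  proof -
    have "(CLINT x|M. indicator S x *\<^sub>R iexp (l x)) = (CLINT x|M. iexp (l x))" if "space M = S" for M l
      by (intro Bochner_Integration.integral_cong) (simp_all add: that)
    moreover have "S \<in> ?G" using sets.top[of "cylinder_sigma S L"] by simp
    ultimately show ?thesis using eq sp by (simp add: good_def)
  qed
  have good: "good D" if "D \<in> \<P>" for D
  proof -
    from that obtain F where F: "finite F" "F \<subseteq> L \<times> sets borel" "D = S \<inter> (\<Inter>(l, A)\<in>F. l -` A)"
      unfolding \<P>_def by blast
    from F(1,2) have "good (S \<inter> (\<Inter>(l, A)\<in>F. l -` A))"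
    proof induction
      case empty
      then show ?case using good_S by simp
    next
      case (insert lA F)
      obtain l A where lA: "lA = (l, A)" by fastforce
      have "S \<inter> (\<Inter>(l, A)\<in>insert lA F. l -` A) = (S \<inter> (\<Inter>(l, A)\<in>F. l -` A)) \<inter> (l -` A \<inter> S)"
        by (auto simp: lA)
      then show ?case using insert good_Int[of _ l A] by (simp add: lA)
    qed
    then show ?thesis using F(3) by simp
  qed
  show ?thesis
  proof (rule measure_eqI_generator_eq[where E = \<P> and \<Omega> = S and A = "\<lambda>_. S"])
    show "Int_stable \<P>"
    proof (rule Int_stableI)
      fix a b assume "a \<in> \<P>" "b \<in> \<P>"
      then obtain F F' where F: "finite F" "F \<subseteq> L \<times> sets borel" "a = S \<inter> (\<Inter>(l, A)\<in>F. l -` A)"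
        "finite F'" "F' \<subseteq> L \<times> sets borel" "b = S \<inter> (\<Inter>(l, A)\<in>F'. l -` A)"
        unfolding \<P>_def by blast
      then have "a \<inter> b = S \<inter> (\<Inter>(l, A)\<in>F \<union> F'. l -` A)" by blast
      with F show "a \<inter> b \<in> \<P>"
        unfolding \<P>_def by (intro CollectI exI[of _ "F \<union> F'"]) simp
    qed
    show "emeasure \<mu> D = emeasure \<nu> D" if "D \<in> \<P>" for D
    proof -
      obtain l where "l \<in> L" using nonempty by blast
      then have "(\<lambda>x. 0) \<in> L" using lin[of l l 0 0] by simp
      then have zero: "(\<lambda>x. 0) \<in> L" using lin[of l l 0 0] by simp
      note g = good[OF that, unfolded good_def]
      from conjunct1[OF g] bspec[OF conjunct2[OF g] zero]
      have "measure \<mu> D = measure \<nu> D"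
        using sets by (simp add: scaleR_conv_of_real)
      then show ?thesis by (simp add: \<mu>.emeasure_eq_measure \<nu>.emeasure_eq_measure)
    qed
    have "?G = sigma_sets S \<P>"
    proof
      have "l -` A \<inter> S \<in> \<P>" if "l \<in> L" "A \<in> sets borel" for l A
        unfolding \<P>_def using that by (intro CollectI exI[of _ "{(l, A)}"]) auto
      then show "?G \<subseteq> sigma_sets S \<P>"
        unfolding sets_cylinder_sigma by (intro sigma_sets_mono') blast
      show "sigma_sets S \<P> \<subseteq> ?G"
        using good sets.sigma_sets_subset[of \<P> "cylinder_sigma S L"] by (auto simp: good_def)
    qed
    then show "sets \<mu> = sigma_sets S \<P>" "sets \<nu> = sigma_sets S \<P>" using sets by simp_all
    show "range (\<lambda>_ :: nat. S) \<subseteq> \<P>"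
      unfolding \<P>_def by (auto intro!: exI[of _ "{}"])
  qed (auto simp: \<P>_def)
qed

section \<open>Gaussian measures on cylinder sigma-algebras\<close>

text \<open>Both sides of the identity are continuous in \<open>L\<^sup>2\<close>. This is required
  because a Cameron-Martin vector is represented by a function \<open>\<gamma>\<close> that is only
  an \<open>L\<^sup>2\<close> limit of continuous functionals.\<close>

lemma gaussian_char_L2_closure:
  fixes M :: "'a measure" and X :: "'a \<Rightarrow> real"
  assumes "prob_space M" and X: "X \<in> borel_measurable M" "integrable M (\<lambda>x. (X x)\<^sup>2)"
    and approx: "\<And>\<epsilon>. \<epsilon> > 0 \<Longrightarrow> \<exists>Y. Y \<in> borel_measurable M \<and> integrable M (\<lambda>x. (Y x)\<^sup>2) \<and>
      (LINT x|M. (Y x - X x)\<^sup>2) < \<epsilon> \<and> (CLINT x|M. iexp (Y x)) = exp (- (LINT x|M. (Y x)\<^sup>2) / 2)"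
  shows "(CLINT x|M. iexp (X x)) = exp (- (LINT x|M. (X x)\<^sup>2) / 2)"
proof -
  interpret prob_space M by fact
  define \<delta> where "\<delta> n = 1 / real (Suc n)" for n
  have \<delta>: "\<delta> n > 0" for n by (simp add: \<delta>_def)
  have \<delta>_lim: "\<delta> \<longlonglongrightarrow> 0" unfolding \<delta>_def by (rule lim_inverse_n'[THEN LIMSEQ_Suc])
  define close where "close n Y \<longleftrightarrow> Y \<in> borel_measurable M \<and> integrable M (\<lambda>x. (Y x)\<^sup>2) \<and>
      (LINT x|M. (Y x - X x)\<^sup>2) < (\<delta> n)\<^sup>2 \<and> (CLINT x|M. iexp (Y x)) = exp (- (LINT x|M. (Y x)\<^sup>2) / 2)" for n Y
  have "\<exists>Y. close n Y" for n
    unfolding close_def by (intro approx zero_less_power \<delta>)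
  then obtain Y where close: "\<And>n. close n (Y n)" by metis
  have Y: "Y n \<in> borel_measurable M" "integrable M (\<lambda>x. (Y n x)\<^sup>2)" "(LINT x|M. (Y n x - X x)\<^sup>2) < (\<delta> n)\<^sup>2"
      "(CLINT x|M. iexp (Y n x)) = exp (- (LINT x|M. (Y n x)\<^sup>2) / 2)" for n
    using close[of n] unfolding close_def by blast+
  note [measurable] = X(1) Y(1)
  have D: "integrable M (\<lambda>x. (Y n x - X x)\<^sup>2)" for n
  proof (rule Bochner_Integration.integrable_bound[where f = "\<lambda>x. 2 * (Y n x)\<^sup>2 + 2 * (X x)\<^sup>2"])
    show "integrable M (\<lambda>x. 2 * (Y n x)\<^sup>2 + 2 * (X x)\<^sup>2)" using X(2) Y(2) by simp
    have "(y - x)\<^sup>2 \<le> 2 * y\<^sup>2 + 2 * x\<^sup>2" for x y :: real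
      using zero_le_power2[of "y + x"] by (simp add: power2_eq_square algebra_simps)
    then show "AE x in M. norm ((Y n x - X x)\<^sup>2) \<le> norm (2 * (Y n x)\<^sup>2 + 2 * (X x)\<^sup>2)" by simp
  qed simp
  have sq: "(\<lambda>n. LINT x|M. (Y n x)\<^sup>2) \<longlonglongrightarrow> (LINT x|M. (X x)\<^sup>2)"
  proof (rule Lim_null_comparison[where g = "\<lambda>n. \<delta> n * (LINT x|M. (X x)\<^sup>2) + \<delta> n ^ 2 + \<delta> n", THEN LIM_zero_cancel])
    \<comment> \<open>Young's inequality with parameter \<epsilon> splits the mixed term
      \<open>2 x (y - x)\<close>. After integration with \<open>\<epsilon> = \<delta> n\<close> only
      second moments occur, and the error is at most a multiple of
      \<open>\<delta> n\<close>.\<close>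
    have pt: "\<bar>y\<^sup>2 - x\<^sup>2\<bar> \<le> \<epsilon> * x\<^sup>2 + (1 + 1 / \<epsilon>) * (y - x)\<^sup>2" if "\<epsilon> > 0" for x y \<epsilon> :: real
    proof -
      define d where "d = y - x"
      have "0 \<le> (\<epsilon> * \<bar>x\<bar> - \<bar>d\<bar>)\<^sup>2 / \<epsilon>" using that by simp
      also have "\<dots> = \<epsilon> * x\<^sup>2 + (1 / \<epsilon>) * d\<^sup>2 - 2 * \<bar>x * d\<bar>"
        using that by (simp add: power2_eq_square field_simps abs_mult)
      finally have "2 * \<bar>x * d\<bar> \<le> \<epsilon> * x\<^sup>2 + (1 / \<epsilon>) * d\<^sup>2" by simp
      moreover have "y\<^sup>2 - x\<^sup>2 = 2 * (x * d) + d\<^sup>2" by (simp add: d_def power2_eq_square algebra_simps)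
      then have "\<bar>y\<^sup>2 - x\<^sup>2\<bar> \<le> 2 * \<bar>x * d\<bar> + d\<^sup>2"
        using abs_triangle_ineq[of "2 * (x * d)" "d\<^sup>2"] by (simp add: abs_mult)
      ultimately show ?thesis by (simp add: d_def algebra_simps)
    qed
    have "\<bar>(LINT x|M. (Y n x)\<^sup>2) - (LINT x|M. (X x)\<^sup>2)\<bar> \<le> \<delta> n * (LINT x|M. (X x)\<^sup>2) + \<delta> n ^ 2 + \<delta> n" for n
    proof -
      have "\<bar>(LINT x|M. (Y n x)\<^sup>2) - (LINT x|M. (X x)\<^sup>2)\<bar> = \<bar>LINT x|M. (Y n x)\<^sup>2 - (X x)\<^sup>2\<bar>"
        using X(2) Y(2) by simp
      also have "\<dots> \<le> (LINT x|M. \<bar>(Y n x)\<^sup>2 - (X x)\<^sup>2\<bar>)" by (rule integral_abs_bound)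
      also have "\<dots> \<le> (LINT x|M. \<delta> n * (X x)\<^sup>2 + (1 + 1 / \<delta> n) * (Y n x - X x)\<^sup>2)"
        using X(2) Y(2) D pt \<delta> by (intro integral_mono) auto
      also have "\<dots> = \<delta> n * (LINT x|M. (X x)\<^sup>2) + (1 + 1 / \<delta> n) * (LINT x|M. (Y n x - X x)\<^sup>2)"
        using X(2) D by simp
      also have "\<dots> \<le> \<delta> n * (LINT x|M. (X x)\<^sup>2) + (1 + 1 / \<delta> n) * (\<delta> n)\<^sup>2"
        using Y(3)[of n] \<delta>[of n] by (intro add_left_mono mult_left_mono) auto
      also have "\<dots> = \<delta> n * (LINT x|M. (X x)\<^sup>2) + \<delta> n ^ 2 + \<delta> n"
        using \<delta>[of n] by (simp add: power2_eq_square field_simps)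
      finally show ?thesis .
    qed
    then show "\<forall>\<^sub>F n in sequentially. norm ((LINT x|M. (Y n x)\<^sup>2) - (LINT x|M. (X x)\<^sup>2))
        \<le> \<delta> n * (LINT x|M. (X x)\<^sup>2) + \<delta> n ^ 2 + \<delta> n" by simp
    show "(\<lambda>n. \<delta> n * (LINT x|M. (X x)\<^sup>2) + \<delta> n ^ 2 + \<delta> n) \<longlonglongrightarrow> 0"
      using \<delta>_lim by (auto intro!: tendsto_eq_intros)
  qed
  have iexp_int: "integrable M (\<lambda>x. iexp (Z x))" if "Z \<in> borel_measurable M" for Z
    using that by (intro integrable_const_bound[of _ 1]) auto
  have "(\<lambda>n. CLINT x|M. iexp (Y n x)) \<longlonglongrightarrow> (CLINT x|M. iexp (X x))"
  proof (rule Lim_null_comparison[where g = "\<lambda>n. 2 * \<delta> n", THEN LIM_zero_cancel])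
    \<comment> \<open>Either the difference is at most \<epsilon>, or it is at most its square
      divided by \<epsilon>; again only the second moment of the difference has to be
      integrated.\<close>
    have pt: "cmod (iexp y - iexp x) \<le> \<epsilon> + (y - x)\<^sup>2 / \<epsilon>" if "\<epsilon> > 0" for x y \<epsilon> :: real
    proof -
      have "iexp y - iexp x = iexp x * (iexp (y - x) - 1)"
        by (simp add: algebra_simps exp_add[symmetric])
      then have "cmod (iexp y - iexp x) = cmod (iexp (y - x) - 1)" by (simp add: norm_mult)
      also have "\<dots> \<le> \<bar>y - x\<bar>" using iexp_approx1[of "y - x" 0] by simp
      also have "\<dots> \<le> \<epsilon> + (y - x)\<^sup>2 / \<epsilon>"
      proof (cases "\<bar>y - x\<bar> \<le> \<epsilon>")
        case True
        then show ?thesis using that by (smt (verit) divide_nonneg_pos zero_le_power2)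
      next
        case False
        then have "\<bar>y - x\<bar> * \<epsilon> \<le> \<bar>y - x\<bar> * \<bar>y - x\<bar>" by (intro mult_left_mono) auto
        then have "\<bar>y - x\<bar> \<le> (y - x)\<^sup>2 / \<epsilon>" using that by (simp add: pos_le_divide_eq power2_eq_square)
        then show ?thesis using that by simp
      qed
      finally show ?thesis .
    qed
    have "cmod ((CLINT x|M. iexp (Y n x)) - (CLINT x|M. iexp (X x))) \<le> 2 * \<delta> n" for n
    proof -
      have "cmod ((CLINT x|M. iexp (Y n x)) - (CLINT x|M. iexp (X x))) = cmod (CLINT x|M. iexp (Y n x) - iexp (X x))"
        using iexp_int[OF X(1)] iexp_int[OF Y(1)] by simp
      also have "\<dots> \<le> (LINT x|M. cmod (iexp (Y n x) - iexp (X x)))" by (rule integral_norm_bound)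
      also have "\<dots> \<le> (LINT x|M. \<delta> n + (Y n x - X x)\<^sup>2 / \<delta> n)"
        using iexp_int[OF X(1)] iexp_int[OF Y(1)] D pt \<delta> by (intro integral_mono) auto
      also have "\<dots> = \<delta> n + (LINT x|M. (Y n x - X x)\<^sup>2) / \<delta> n"
        using D by (simp add: prob_space)
      also have "\<dots> \<le> \<delta> n + (\<delta> n)\<^sup>2 / \<delta> n"
        using Y(3)[of n] \<delta>[of n] by (intro add_left_mono divide_right_mono) auto
      also have "\<dots> = 2 * \<delta> n" using \<delta>[of n] by (simp add: power2_eq_square)
      finally show ?thesis .
    qed
    then show "\<forall>\<^sub>F n in sequentially. cmod ((CLINT x|M. iexp (Y n x)) - (CLINT x|M. iexp (X x))) \<le> 2 * \<delta> n"
      by simp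
    show "(\<lambda>n. 2 * \<delta> n) \<longlonglongrightarrow> 0" using \<delta>_lim by (auto intro!: tendsto_eq_intros)
  qed
  moreover have "(\<lambda>n. CLINT x|M. iexp (Y n x)) \<longlonglongrightarrow> exp (- (LINT x|M. (X x)\<^sup>2) / 2)"
    unfolding Y(4) using sq by (intro tendsto_intros) auto
  ultimately show ?thesis by (rule LIMSEQ_unique)
qed

text \<open>With \<open>c = \<integral> \<gamma>\<^sup>2 d\<mu>\<close>, the vector \<open>f - (\<gamma> f / c) h\<close> is independent of \<open>\<gamma> f\<close>, so \<open>\<mu>\<close> is also the law
  of \<open>f - (\<gamma> f / c) h + (z / sqrt c) h\<close> for an independent standard normal \<open>z\<close>. Hence \<open>\<mu>\<close> is a
  mixture of absolutely continuous measures on the lines parallel to \<open>h\<close>.\<close>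

theorem gaussian_null_if_lines_null:
  fixes \<mu> :: "('m \<Rightarrow> real) measure"
  assumes \<mu>: "prob_space \<mu>" "sets \<mu> = sets (cylinder_sigma S L)"
    and S_lin: "\<And>f g a. f \<in> S \<Longrightarrow> g \<in> S \<Longrightarrow> (\<lambda>p. f p + a * g p) \<in> S"
    and L: "L \<noteq> {}" "\<And>l l' a b. l \<in> L \<Longrightarrow> l' \<in> L \<Longrightarrow> (\<lambda>x. a * l x + b * l' x) \<in> L"
    and lin: "\<And>l f g a. l \<in> L \<Longrightarrow> f \<in> S \<Longrightarrow> g \<in> S \<Longrightarrow> l (\<lambda>p. f p + a * g p) = l f + a * l g"
    and sq: "\<And>l. l \<in> L \<Longrightarrow> integrable \<mu> (\<lambda>x. (l x)\<^sup>2)"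
    and char: "\<And>l. l \<in> L \<Longrightarrow> (CLINT x|\<mu>. iexp (l x)) = exp (- (LINT x|\<mu>. (l x)\<^sup>2) / 2)"
    and h: "h \<in> S"
    and \<gamma>: "\<gamma> \<in> borel_measurable \<mu>" "integrable \<mu> (\<lambda>x. (\<gamma> x)\<^sup>2)"
    and \<gamma>_approx: "\<And>\<epsilon>. \<epsilon> > 0 \<Longrightarrow> \<exists>l\<in>L. (LINT x|\<mu>. (\<gamma> x - l x)\<^sup>2) < \<epsilon>"
    and l_h: "\<And>l. l \<in> L \<Longrightarrow> l h = (LINT x|\<mu>. \<gamma> x * l x)"
    and \<gamma>_nonzero: "(LINT x|\<mu>. (\<gamma> x)\<^sup>2) \<noteq> 0"
    and A: "A \<in> sets \<mu>" and lines: "\<And>f. f \<in> S \<Longrightarrow> {s. (\<lambda>p. f p + s * h p) \<in> A} \<in> null_sets lborel"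
  shows "emeasure \<mu> A = 0"
proof -
  interpret prob_space \<mu> by (rule \<mu>)
  interpret N: prob_space std_normal_distribution
    by (rule real_distribution.axioms(1)[OF real_dist_normal_dist])
  interpret P: pair_prob_space \<mu> std_normal_distribution ..
  have sp: "space \<mu> = S" using sets_eq_imp_space_eq[OF \<mu>(2)] by simp
  have meas: "l \<in> borel_measurable \<mu>" if "l \<in> L" for l
    using measurable_cylinder_sigma_functional[OF that, of S] \<mu>(2) by (simp cong: measurable_cong_sets)
  have prod_int: "integrable \<mu> (\<lambda>x. X x * Y x)"
    if "X \<in> borel_measurable \<mu>" "Y \<in> borel_measurable \<mu>" "integrable \<mu> (\<lambda>x. (X x)\<^sup>2)" "integrable \<mu> (\<lambda>x. (Y x)\<^sup>2)"
    for X Y :: "_ \<Rightarrow> real"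
  proof (rule Bochner_Integration.integrable_bound[where f = "\<lambda>x. (X x)\<^sup>2 + (Y x)\<^sup>2"])
    have "\<bar>x * y\<bar> \<le> x\<^sup>2 + y\<^sup>2" for x y :: real
    proof -
      have "0 \<le> \<bar>x\<bar> * \<bar>y\<bar>" by simp
      then show ?thesis
        using sum_squares_bound[of "\<bar>x\<bar>" "\<bar>y\<bar>"] unfolding abs_mult power2_abs by linarith
    qed
    then show "AE x in \<mu>. norm (X x * Y x) \<le> norm ((X x)\<^sup>2 + (Y x)\<^sup>2)" by simp
  qed (use that in auto)
  define c where "c = (LINT x|\<mu>. (\<gamma> x)\<^sup>2)"
  have c: "c > 0" using \<gamma>_nonzero by (simp add: c_def less_le)
  \<comment> \<open>The coordinate \<open>\<gamma> f\<close> is replaced by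
    \<open>z * sqrt c\<close>, an independent normal variable with the same second moment
    \<open>c\<close>.\<close>
  define m where "m = (\<lambda>(f, z) p. f p + (z * sqrt c - \<gamma> f) / c * h p)"
  have l_m: "l (m (f, z)) = (l f - l h / c * \<gamma> f) + sqrt c * l h / c * z" if "l \<in> L" "f \<in> S" for l f z
    unfolding m_def prod.case lin[OF that h] by (simp add: field_simps diff_divide_distrib)
  have m: "m \<in> measurable (\<mu> \<Otimes>\<^sub>M std_normal_distribution) \<mu>"
  proof -
    have "m \<in> measurable (\<mu> \<Otimes>\<^sub>M std_normal_distribution) (cylinder_sigma S L)"
    proof (rule measurable_cylinder_sigmaI)
      show "m x \<in> S" if "x \<in> space (\<mu> \<Otimes>\<^sub>M std_normal_distribution)" for x
        using that by (auto simp: space_pair_measure sp m_def intro!: S_lin h simp del: times_divide_eq_left)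
      fix l assume l: "l \<in> L"
      note [measurable] = meas[OF l] \<gamma>(1)
      have "(\<lambda>x. (l (fst x) - l h / c * \<gamma> (fst x)) + sqrt c * l h / c * snd x)
          \<in> borel_measurable (\<mu> \<Otimes>\<^sub>M std_normal_distribution)" by measurable
      then show "(\<lambda>x. l (m x)) \<in> borel_measurable (\<mu> \<Otimes>\<^sub>M std_normal_distribution)"
        by (rule measurable_cong[THEN iffD1, rotated]) (auto simp: l_m[OF l] space_pair_measure sp)
    qed
    then show ?thesis using \<mu>(2) by (simp cong: measurable_cong_sets)
  qed
  \<comment> \<open>The covariance of \<open>l\<close> and \<gamma> is \<open>l h\<close>, by the
    defining property of the Cameron-Martin vector. With \<open>a = l h / c\<close> the second
    moment of \<open>l - a \<gamma>\<close> is that of \<open>l\<close> minus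
    \<open>(l h)\<^sup>2 / c\<close>.\<close>
  have \<eta>: "(CLINT x|\<mu>. iexp (l x - a * \<gamma> x)) =
      exp (- ((LINT x|\<mu>. (l x)\<^sup>2) - 2 * a * l h + a\<^sup>2 * c) / 2)" if l: "l \<in> L" for l a
  proof -
    note [measurable] = meas[OF l] \<gamma>(1)
    have eq: "(l x - a * \<gamma> x)\<^sup>2 = (l x)\<^sup>2 - 2 * a * (\<gamma> x * l x) + a\<^sup>2 * (\<gamma> x)\<^sup>2" for x
      by (simp add: power2_eq_square algebra_simps)
    note ints = sq[OF l] \<gamma>(2) prod_int[OF \<gamma>(1) meas[OF l] \<gamma>(2) sq[OF l]]
    have i: "integrable \<mu> (\<lambda>x. (l x - a * \<gamma> x)\<^sup>2)"
      unfolding eq using ints by simp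
    have "(LINT x|\<mu>. (l x - a * \<gamma> x)\<^sup>2) = (LINT x|\<mu>. (l x)\<^sup>2) - 2 * a * l h + a\<^sup>2 * c"
      unfolding eq using ints by (simp add: l_h[OF l] c_def)
    moreover have "(CLINT x|\<mu>. iexp (l x - a * \<gamma> x)) = exp (- (LINT x|\<mu>. (l x - a * \<gamma> x)\<^sup>2) / 2)"
    proof (rule gaussian_char_L2_closure[OF \<mu>(1) _ i])
      fix \<epsilon> :: real assume \<epsilon>: "\<epsilon> > 0"
      \<comment> \<open>The approximation error of \<gamma> is multiplied by
        \<open>a\<^sup>2\<close>; the added 1 keeps the denominator positive for
        \<open>a = 0\<close>.\<close>
      then have "\<epsilon> / (a\<^sup>2 + 1) > 0" by (intro divide_pos_pos add_nonneg_pos) auto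
      then obtain l' where l': "l' \<in> L" "(LINT x|\<mu>. (\<gamma> x - l' x)\<^sup>2) < \<epsilon> / (a\<^sup>2 + 1)" using \<gamma>_approx by blast
      have k: "(\<lambda>x. 1 * l x + (- a) * l' x) \<in> L" by (rule L(2)[OF l l'(1)])
      have "(LINT x|\<mu>. (1 * l x + (- a) * l' x - (l x - a * \<gamma> x))\<^sup>2) = (LINT x|\<mu>. a\<^sup>2 * (\<gamma> x - l' x)\<^sup>2)"
        by (intro Bochner_Integration.integral_cong) (auto simp: power2_eq_square algebra_simps)
      also have "\<dots> = a\<^sup>2 * (LINT x|\<mu>. (\<gamma> x - l' x)\<^sup>2)" by simp
      also have "\<dots> \<le> (a\<^sup>2 + 1) * (LINT x|\<mu>. (\<gamma> x - l' x)\<^sup>2)" by (intro mult_right_mono) auto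
      also have "\<dots> < \<epsilon>"
        using l'(2) by (simp add: pos_less_divide_eq add_nonneg_pos mult.commute)
      finally have "(LINT x|\<mu>. (1 * l x + (- a) * l' x - (l x - a * \<gamma> x))\<^sup>2) < \<epsilon>" .
      then show "\<exists>Y. Y \<in> borel_measurable \<mu> \<and> integrable \<mu> (\<lambda>x. (Y x)\<^sup>2) \<and>
          (LINT x|\<mu>. (Y x - (l x - a * \<gamma> x))\<^sup>2) < \<epsilon> \<and> (CLINT x|\<mu>. iexp (Y x)) = exp (- (LINT x|\<mu>. (Y x)\<^sup>2) / 2)"
        using meas[OF k] sq[OF k] char[OF k] by blast
    qed simp
    ultimately show ?thesis by simp
  qed
  have "\<mu> = distr (\<mu> \<Otimes>\<^sub>M std_normal_distribution) \<mu> m"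
  proof (rule cylinder_measure_eqI_char[OF \<mu>(1) _ \<mu>(2) _ L])
    show "prob_space (distr (\<mu> \<Otimes>\<^sub>M std_normal_distribution) \<mu> m)" by (rule P.prob_space_distr[OF m])
    fix l assume l: "l \<in> L"
    note [measurable] = meas[OF l] \<gamma>(1) m
    define t where "t = sqrt c * l h / c"
    define \<eta> where "\<eta> f = l f - l h / c * \<gamma> f" for f
    have [measurable]: "\<eta> \<in> borel_measurable \<mu>" unfolding \<eta>_def by measurable
    have "(CLINT x|distr (\<mu> \<Otimes>\<^sub>M std_normal_distribution) \<mu> m. iexp (l x)) =
        (CLINT x|\<mu> \<Otimes>\<^sub>M std_normal_distribution. iexp (l (m x)))"
      by (rule integral_distr[OF m]) measurable
    also have "\<dots> = (CLINT x|\<mu> \<Otimes>\<^sub>M std_normal_distribution. iexp (\<eta> (fst x)) * iexp (t * snd x))"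
      by (intro Bochner_Integration.integral_cong)
         (auto simp: space_pair_measure sp l_m[OF l] \<eta>_def t_def exp_add[symmetric] algebra_simps)
    also have "\<dots> = (CLINT f|\<mu>. (CLINT z|std_normal_distribution. iexp (\<eta> f) * iexp (t * z)))"
    proof (subst P.integral_fst'[symmetric])
      show "integrable (\<mu> \<Otimes>\<^sub>M std_normal_distribution) (\<lambda>x. iexp (\<eta> (fst x)) * iexp (t * snd x))"
        by (rule P.integrable_const_bound[of _ 1]) (auto simp: norm_mult)
    qed simp
    also have "\<dots> = (CLINT f|\<mu>. iexp (\<eta> f)) * char std_normal_distribution t"
      by (simp add: char_def)
    also have "\<dots> = exp (- ((LINT x|\<mu>. (l x)\<^sup>2) - 2 * (l h / c) * l h + (l h / c)\<^sup>2 * c) / 2) * exp (- (t\<^sup>2) / 2)"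
      using \<eta>[OF l, of "l h / c"] unfolding \<eta>_def by (simp add: char_std_normal_distribution)
    also have "\<dots> = exp (- (LINT x|\<mu>. (l x)\<^sup>2) / 2)"
    proof -
      \<comment> \<open>The normal factor restores exactly the amount
        \<open>(l h)\<^sup>2 / c\<close> that was removed from the second moment of
        \<open>l\<close>.\<close>
      have "t\<^sup>2 = c * (l h)\<^sup>2 / (c * c)"
        using c by (simp add: t_def power_divide power_mult_distrib flip: power2_eq_square)
      then have "t\<^sup>2 = (l h)\<^sup>2 / c" by simp
      then have "- ((LINT x|\<mu>. (l x)\<^sup>2) - 2 * (l h / c) * l h + (l h / c)\<^sup>2 * c) / 2 + - (t\<^sup>2) / 2 = - (LINT x|\<mu>. (l x)\<^sup>2) / 2"
        using c by (simp add: field_simps power2_eq_square)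
      then show ?thesis by (metis exp_add of_real_mult)
    qed
    finally show "(CLINT x|\<mu>. iexp (l x)) = (CLINT x|distr (\<mu> \<Otimes>\<^sub>M std_normal_distribution) \<mu> m. iexp (l x))"
      using char[OF l] by simp
  qed (use \<mu>(2) in auto)
  then have "emeasure \<mu> A = emeasure (distr (\<mu> \<Otimes>\<^sub>M std_normal_distribution) \<mu> m) A" by simp
  also have "\<dots> = emeasure (\<mu> \<Otimes>\<^sub>M std_normal_distribution) (m -` A \<inter> space (\<mu> \<Otimes>\<^sub>M std_normal_distribution))"
    using m A by (rule emeasure_distr)
  also have "\<dots> = (\<integral>\<^sup>+ f. emeasure std_normal_distribution
      (Pair f -` (m -` A \<inter> space (\<mu> \<Otimes>\<^sub>M std_normal_distribution))) \<partial>\<mu>)"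
    using m A by (intro N.emeasure_pair_measure_alt) (rule measurable_sets)
  also have "\<dots> = (\<integral>\<^sup>+ f. 0 \<partial>\<mu>)"
  proof (rule nn_integral_cong)
    fix f assume "f \<in> space \<mu>"
    then have f: "f \<in> S" by (simp add: sp)
    define Z where "Z = {s. (\<lambda>p. f p + s * h p) \<in> A}"
    have Z: "Z \<in> null_sets lborel" using lines[OF f] by (simp add: Z_def)
    have [measurable]: "Z \<in> sets borel" using null_setsD2[OF Z] by simp
    \<comment> \<open>For fixed \<open>f\<close> the map sends \<open>z\<close> affinely, with slope
      \<open>sqrt c / c > 0\<close>, to the position on the line through \<open>f\<close>. The
      preimage of the null set \<open>Z\<close> is Lebesgue null, hence null for the normal law,
      which has a density.\<close>
    have "AE z in lborel. - \<gamma> f / c + (sqrt c / c) * z \<notin> Z"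
      using c by (intro AE_borel_affine AE_not_in[OF Z]) (simp, measurable)
    then have "AE z in lborel. z \<notin> Pair f -` (m -` A \<inter> space (\<mu> \<Otimes>\<^sub>M std_normal_distribution))"
      by eventually_elim (auto simp: m_def Z_def add_divide_distrib diff_divide_distrib algebra_simps)
    then have "AE z in std_normal_distribution. z \<notin> Pair f -` (m -` A \<inter> space (\<mu> \<Otimes>\<^sub>M std_normal_distribution))"
      by (auto simp: AE_density)
    moreover have "Pair f -` (m -` A \<inter> space (\<mu> \<Otimes>\<^sub>M std_normal_distribution)) \<in> sets std_normal_distribution"
      by (rule sets_Pair1) (rule measurable_sets[OF m A])
    ultimately show "emeasure std_normal_distribution
        (Pair f -` (m -` A \<inter> space (\<mu> \<Otimes>\<^sub>M std_normal_distribution))) = 0"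
      using AE_iff_null_sets by (metis null_setsD1)
  qed
  finally show ?thesis by simp
qed

text \<open>The degenerate and the nondegenerate case collapse into one formula in the second
  moment, the only form in which Gaussianity is used from here on. Division by \<sigma> reduces the
  second case to the standard normal law.\<close>

lemma centered_gaussian_real_moments:
  assumes "centered_gaussian_real \<nu>"
  shows "integrable \<nu> (\<lambda>x. x\<^sup>2)"
    and "(CLINT x|\<nu>. iexp x) = exp (- (LINT x|\<nu>. x\<^sup>2) / 2)"
proof -
  have "integrable \<nu> (\<lambda>x. x\<^sup>2) \<and> (CLINT x|\<nu>. iexp x) = exp (- (LINT x|\<nu>. x\<^sup>2) / 2)"
    using assms unfolding centered_gaussian_real_def
  proof (elim disjE exE conjE)
    assume \<nu>: "\<nu> = return borel 0"
    have "integrable (return borel (0::real)) (\<lambda>x. x\<^sup>2)"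
      by (subst integrable_iff_bounded) (simp add: nn_integral_return)
    then show ?thesis unfolding \<nu> by (simp add: integral_return)
  next
    fix \<sigma> :: real assume \<sigma>: "\<sigma> > 0" and \<nu>: "\<nu> = density lborel (normal_density 0 \<sigma>)"
    have "distributed \<nu> lborel (\<lambda>x. x) (normal_density 0 \<sigma>)"
      unfolding distributed_def \<nu> by (simp add: distr_id2)
    then have "distributed \<nu> lborel (\<lambda>x. (x - 0) / \<sigma>) std_normal_density"
      using prob_space.normal_standard_normal_convert[OF prob_space_normal_density[OF \<sigma>, of 0] \<sigma>,
          folded \<nu>, of "\<lambda>x. x" 0] by (simp only:)
    then have std: "std_normal_distribution = distr \<nu> lborel (\<lambda>x. x / \<sigma>)"
      by (simp add: distributed_def)
    have [measurable_cong]: "sets \<nu> = sets borel" by (simp add: \<nu>)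
    have sq: "(\<lambda>x. x\<^sup>2) = (\<lambda>x. \<sigma>\<^sup>2 * (x / \<sigma>)\<^sup>2)"
      using \<sigma> by (simp add: power_divide)
    have int: "integrable \<nu> (\<lambda>x. (x / \<sigma>)\<^sup>2)"
      using integrable_std_normal_distribution_moment[of 2] unfolding std
      by (subst (asm) integrable_distr_eq) auto
    have "(LINT x|\<nu>. (x / \<sigma>)\<^sup>2) = (LINT x|std_normal_distribution. x\<^sup>2)"
      unfolding std by (subst integral_distr) auto
    also have "\<dots> = 1" using std_normal_distribution_even_moments(1)[of 1] by (simp add: fact_2)
    finally have "(LINT x|\<nu>. x\<^sup>2) = \<sigma>\<^sup>2" by (subst sq) simp
    moreover have "integrable \<nu> (\<lambda>x. x\<^sup>2)" using int by (subst sq) (rule integrable_mult_right)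
    moreover have "(CLINT x|\<nu>. iexp x) = char std_normal_distribution \<sigma>"
      unfolding char_def std using \<sigma> by (subst integral_distr) auto
    ultimately show ?thesis by (simp add: char_std_normal_distribution)
  qed
  then show "integrable \<nu> (\<lambda>x. x\<^sup>2)" "(CLINT x|\<nu>. iexp x) = exp (- (LINT x|\<nu>. x\<^sup>2) / 2)"
    by blast+
qed

section \<open>Function spaces normed by suprema of functionals\<close>

text \<open>Scalar functionals take the place of the operator norms in \<open>C2_norm\<close>, so
  that the norm is a supremum of elements of the dual and hence accessible to cylinder sets.
  \<open>sup_normed_functions_C2\<close> shows that the topology is the same.\<close>

definition sup_nrm ::
  "'j set \<Rightarrow> ('j \<Rightarrow> 'x set) \<Rightarrow> ('j \<Rightarrow> 'x \<Rightarrow> ('m \<Rightarrow> real) \<Rightarrow> real) \<Rightarrow> ('m \<Rightarrow> real) \<Rightarrow> real" where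
  "sup_nrm J Q d f = (\<Sum>j\<in>J. SUP x\<in>Q j. \<bar>d j x f\<bar>)"

text \<open>In the application \<open>d j x\<close> is a value or partial derivative at the point
  \<open>x\<close> of a chart. Finitely many families of functionals, each depending continuously on
  a parameter in a compact set, yield separability and the generation of the Borel sets by the
  dual.\<close>

locale sup_normed_functions =
  fixes S :: "('m \<Rightarrow> real) set"
    and J :: "'j set" and Q :: "'j \<Rightarrow> 'x::metric_space set"
    and d :: "'j \<Rightarrow> 'x \<Rightarrow> ('m \<Rightarrow> real) \<Rightarrow> real"
    and B :: "('m \<Rightarrow> real) topology"
  assumes finite_J: "finite J"
    and compact_Q: "\<And>j. j \<in> J \<Longrightarrow> compact (Q j)" and Q_nonempty: "\<And>j. j \<in> J \<Longrightarrow> Q j \<noteq> {}"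
    and S_nonempty: "S \<noteq> {}"
    and S_lin: "\<And>f g a b. f \<in> S \<Longrightarrow> g \<in> S \<Longrightarrow> (\<lambda>p. a * f p + b * g p) \<in> S"
    and d_lin: "\<And>j x f g a b. \<lbrakk>j \<in> J; x \<in> Q j; f \<in> S; g \<in> S\<rbrakk> \<Longrightarrow>
      d j x (\<lambda>p. a * f p + b * g p) = a * d j x f + b * d j x g"
    and d_cont: "\<And>j f. j \<in> J \<Longrightarrow> f \<in> S \<Longrightarrow> continuous_on (Q j) (\<lambda>x. d j x f)"
    and d_separating: "\<And>f. f \<in> S \<Longrightarrow> (\<And>j x. j \<in> J \<Longrightarrow> x \<in> Q j \<Longrightarrow> d j x f = 0) \<Longrightarrow> f = (\<lambda>_. 0)"
    and openin_B: "\<And>G. openin B G \<longleftrightarrow> G \<subseteq> S \<and>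
      (\<forall>f\<in>G. \<exists>\<epsilon>>0. \<forall>g\<in>S. sup_nrm J Q d (\<lambda>p. g p - f p) < \<epsilon> \<longrightarrow> g \<in> G)"
begin

section \<open>The norm and its closed sets\<close>

abbreviation nrm where "nrm \<equiv> sup_nrm J Q d"

lemma topspace_B: "topspace B = S"
proof
  show "topspace B \<subseteq> S" using openin_B openin_topspace by blast
  have "openin B S" unfolding openin_B by (auto intro: exI[of _ "1::real"])
  then show "S \<subseteq> topspace B" by (rule openin_subset)
qed

lemma S_line: "f \<in> S \<Longrightarrow> g \<in> S \<Longrightarrow> (\<lambda>p. f p + a * g p) \<in> S"
  using S_lin[of f g 1 a] by simp

lemma S_diff: "f \<in> S \<Longrightarrow> g \<in> S \<Longrightarrow> (\<lambda>p. f p - g p) \<in> S"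
  using S_lin[of f g 1 "-1"] by simp

lemma S_scale: "f \<in> S \<Longrightarrow> (\<lambda>p. a * f p) \<in> S"
  using S_lin[of f f a 0] by simp

lemma d_add: "\<lbrakk>j \<in> J; x \<in> Q j; f \<in> S; g \<in> S\<rbrakk> \<Longrightarrow> d j x (\<lambda>p. f p + g p) = d j x f + d j x g"
  using d_lin[of j x f g 1 1] by simp

lemma d_diff: "\<lbrakk>j \<in> J; x \<in> Q j; f \<in> S; g \<in> S\<rbrakk> \<Longrightarrow> d j x (\<lambda>p. f p - g p) = d j x f - d j x g"
  using d_lin[of j x f g 1 "-1"] by simp

lemma d_scale: "\<lbrakk>j \<in> J; x \<in> Q j; f \<in> S\<rbrakk> \<Longrightarrow> d j x (\<lambda>p. a * f p) = a * d j x f"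
  using d_lin[of j x f f a 0] by simp

lemma d_bdd_above: "j \<in> J \<Longrightarrow> f \<in> S \<Longrightarrow> bdd_above ((\<lambda>x. \<bar>d j x f\<bar>) ` Q j)"
  by (intro bounded_imp_bdd_above compact_imp_bounded compact_continuous_image
      continuous_intros d_cont compact_Q)

lemma sup_nonneg: "j \<in> J \<Longrightarrow> f \<in> S \<Longrightarrow> 0 \<le> (SUP x\<in>Q j. \<bar>d j x f\<bar>)"
  using some_in_eq[of "Q j"] Q_nonempty by (intro cSUP_upper2[OF d_bdd_above]) auto

lemma d_le_nrm:
  assumes "j \<in> J" "x \<in> Q j" "f \<in> S"
  shows "\<bar>d j x f\<bar> \<le> nrm f"
proof -
  have "\<bar>d j x f\<bar> \<le> (SUP x\<in>Q j. \<bar>d j x f\<bar>)" using assms by (intro cSUP_upper d_bdd_above)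
  also have "\<dots> \<le> nrm f"
    unfolding sup_nrm_def using assms finite_J sup_nonneg by (intro member_le_sum) auto
  finally show ?thesis .
qed

lemma nrm_nonneg: "f \<in> S \<Longrightarrow> 0 \<le> nrm f"
  unfolding sup_nrm_def by (intro sum_nonneg sup_nonneg)

lemma nrm_le:
  fixes K :: real
  assumes "\<And>j x. j \<in> J \<Longrightarrow> x \<in> Q j \<Longrightarrow> \<bar>d j x f\<bar> \<le> K"
  shows "nrm f \<le> card J * K"
proof -
  have "nrm f \<le> (\<Sum>j\<in>J. K)"
    unfolding sup_nrm_def using assms Q_nonempty by (intro sum_mono cSUP_least)
  then show ?thesis by simp
qed

lemma nrm_add:
  assumes f: "f \<in> S" and g: "g \<in> S"
  shows "nrm (\<lambda>p. f p + g p) \<le> nrm f + nrm g"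
  unfolding sup_nrm_def sum.distrib[symmetric]
proof (rule sum_mono)
  fix j assume j: "j \<in> J"
  show "(SUP x\<in>Q j. \<bar>d j x (\<lambda>p. f p + g p)\<bar>) \<le> (SUP x\<in>Q j. \<bar>d j x f\<bar>) + (SUP x\<in>Q j. \<bar>d j x g\<bar>)"
  proof (rule cSUP_least[OF Q_nonempty[OF j]])
    fix x assume x: "x \<in> Q j"
    have "\<bar>d j x f\<bar> \<le> (SUP x\<in>Q j. \<bar>d j x f\<bar>)" "\<bar>d j x g\<bar> \<le> (SUP x\<in>Q j. \<bar>d j x g\<bar>)"
      using j x f g by (auto intro!: cSUP_upper d_bdd_above)
    then show "\<bar>d j x (\<lambda>p. f p + g p)\<bar> \<le> (SUP x\<in>Q j. \<bar>d j x f\<bar>) + (SUP x\<in>Q j. \<bar>d j x g\<bar>)"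
      using d_add[OF j x f g] by linarith
  qed
qed

lemma nrm_scale_le:
  assumes f: "f \<in> S"
  shows "nrm (\<lambda>p. a * f p) \<le> \<bar>a\<bar> * nrm f"
  unfolding sup_nrm_def sum_distrib_left
proof (rule sum_mono)
  fix j assume j: "j \<in> J"
  show "(SUP x\<in>Q j. \<bar>d j x (\<lambda>p. a * f p)\<bar>) \<le> \<bar>a\<bar> * (SUP x\<in>Q j. \<bar>d j x f\<bar>)"
    using j f by (intro cSUP_least Q_nonempty) (auto simp: d_scale abs_mult intro!: mult_left_mono cSUP_upper d_bdd_above)
qed

lemma nrm_scale:
  assumes f: "f \<in> S"
  shows "nrm (\<lambda>p. a * f p) = \<bar>a\<bar> * nrm f"
proof (rule antisym[OF nrm_scale_le[OF f]])
  show "\<bar>a\<bar> * nrm f \<le> nrm (\<lambda>p. a * f p)"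
  proof (cases "a = 0")
    case True
    then show ?thesis using nrm_nonneg[OF S_scale[OF f, of 0]] by simp
  next
    case False
    have "nrm (\<lambda>p. inverse a * (a * f p)) \<le> \<bar>inverse a\<bar> * nrm (\<lambda>p. a * f p)"
      using S_scale[OF f] by (rule nrm_scale_le)
    moreover have "(\<lambda>p. inverse a * (a * f p)) = f" using False by auto
    ultimately show ?thesis using False by (simp add: field_simps)
  qed
qed

lemma nrm_minus: "f \<in> S \<Longrightarrow> g \<in> S \<Longrightarrow> nrm (\<lambda>p. f p - g p) = nrm (\<lambda>p. g p - f p)"
  using nrm_scale[OF S_diff, of g f "-1"] by (simp add: algebra_simps)

lemma nrm_triangle:
  assumes "f \<in> S" "g \<in> S" "k \<in> S"
  shows "nrm (\<lambda>p. f p - k p) \<le> nrm (\<lambda>p. f p - g p) + nrm (\<lambda>p. g p - k p)"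
  using nrm_add[OF S_diff S_diff, of f g g k] assms by simp

lemma nrm_0: "nrm (\<lambda>p. 0) = 0"
proof -
  obtain f where "f \<in> S" using S_nonempty by blast
  from nrm_scale[OF this, of 0] show ?thesis by simp
qed

lemma nrm_eq_0:
  assumes "f \<in> S" "nrm f = 0"
  shows "f = (\<lambda>_. 0)"
  using d_le_nrm[OF _ _ assms(1)] assms by (intro d_separating) force+

lemma closedinI:
  assumes "F \<subseteq> S" and "\<And>f. f \<in> S \<Longrightarrow> (\<And>\<epsilon>. \<epsilon> > 0 \<Longrightarrow> \<exists>g\<in>F. nrm (\<lambda>p. g p - f p) < \<epsilon>) \<Longrightarrow> f \<in> F"
  shows "closedin B F"
  unfolding closedin_def topspace_B openin_B
  using assms by (metis Diff_iff Diff_subset)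

lemma closedinD:
  assumes "closedin B F" "f \<in> S" "\<And>\<epsilon>. \<epsilon> > 0 \<Longrightarrow> \<exists>g\<in>F. nrm (\<lambda>p. g p - f p) < \<epsilon>"
  shows "f \<in> F"
  using assms unfolding closedin_def topspace_B openin_B by (metis Diff_iff subsetD)

lemma closedin_subset_S: "closedin B F \<Longrightarrow> F \<subseteq> S"
  using closedin_subset topspace_B by blast

text \<open>The closed sets consist of the points whose ball of radius
  \<open>1 / real (Suc n)\<close> stays in \<open>G\<close>. They make open sets accessible to
  \<open>borel_souslin\<close>.\<close>

lemma openin_fsigma:
  assumes "openin B G"
  shows "\<exists>F :: nat \<Rightarrow> _. (\<forall>n. closedin B (F n)) \<and> G = (\<Union>n. F n)"
proof (intro exI conjI allI)
  define F where "F n = {f \<in> S. \<forall>g\<in>S. nrm (\<lambda>p. g p - f p) < 1 / real (Suc n) \<longrightarrow> g \<in> G}" for n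
  have G: "G \<subseteq> S" using assms openin_B by blast
  show "closedin B (F n)" for n
  proof (rule closedinI)
    fix f assume f: "f \<in> S" and near: "\<And>\<epsilon>. \<epsilon> > 0 \<Longrightarrow> \<exists>g\<in>F n. nrm (\<lambda>p. g p - f p) < \<epsilon>"
    have "g \<in> G" if g: "g \<in> S" "nrm (\<lambda>p. g p - f p) < 1 / real (Suc n)" for g
    proof -
      obtain k where k: "k \<in> F n" "nrm (\<lambda>p. k p - f p) < 1 / real (Suc n) - nrm (\<lambda>p. g p - f p)"
        using near[of "1 / real (Suc n) - nrm (\<lambda>p. g p - f p)"] g(2) by auto
      then have kS: "k \<in> S" by (simp add: F_def)
      have "nrm (\<lambda>p. g p - k p) < 1 / real (Suc n)"
        using nrm_triangle[OF g(1) f kS] nrm_minus[OF f kS] k(2) by linarith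
      then show ?thesis using k(1) g(1) by (simp add: F_def)
    qed
    with f show "f \<in> F n" by (simp add: F_def)
  qed (auto simp: F_def)
  show "G = (\<Union>n. F n)"
  proof
    show "G \<subseteq> (\<Union>n. F n)"
    proof
      fix f assume f: "f \<in> G"
      then obtain \<epsilon> where \<epsilon>: "\<epsilon> > 0" "\<And>g. g \<in> S \<Longrightarrow> nrm (\<lambda>p. g p - f p) < \<epsilon> \<Longrightarrow> g \<in> G"
        using assms openin_B by metis
      obtain n where "1 / real (Suc n) < \<epsilon>" using nat_approx_posE[OF \<epsilon>(1)] by blast
      then have "f \<in> F n" using f G \<epsilon>(2) by (auto simp: F_def)
      then show "f \<in> (\<Union>n. F n)" by blast
    qed
    show "(\<Union>n. F n) \<subseteq> G" using nrm_0 by (auto simp: F_def)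
  qed
qed

section \<open>Separability and countable covers by balls\<close>

lemma finite_net:
  assumes "j \<in> J" "\<epsilon> > 0"
  shows "\<exists>X. finite X \<and> X \<subseteq> Q j \<and> (\<forall>x\<in>Q j. \<exists>y\<in>X. dist y x < \<epsilon>)"
proof -
  from seq_compact_imp_totally_bounded[OF compact_imp_seq_compact[OF compact_Q[OF assms(1)]], rule_format, OF assms(2)]
  obtain X where X: "finite X" "X \<subseteq> Q j" "Q j \<subseteq> (\<Union>x\<in>X. ball x \<epsilon>)" by (elim exE conjE)
  have "\<exists>y\<in>X. dist y x < \<epsilon>" if "x \<in> Q j" for x
    using subsetD[OF X(3) that] by simp
  with X(1,2) show ?thesis by blast
qed

text \<open>Separability: \<open>f\<close> is determined up to \<open>\<epsilon>\<close> by a modulus of continuity and by the rounded values of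
  the \<open>d j x f\<close> on the finite net given by the modulus.\<close>

lemma countable_code:
  assumes "\<epsilon> > 0"
  shows "\<exists>code :: ('m \<Rightarrow> real) \<Rightarrow> nat. \<forall>f\<in>S. \<forall>g\<in>S. code f = code g \<longrightarrow> nrm (\<lambda>p. g p - f p) < \<epsilon>"
proof -
  \<comment> \<open>Two moduli of continuity and one rounding error contribute
    \<open>3 * \<eta>\<close> for each index in \<open>J\<close>; the added 1 covers an empty
    \<open>J\<close> and makes the final bound strict.\<close>
  define \<eta> where "\<eta> = \<epsilon> / (3 * real (card J) + 1)"
  have \<eta>: "\<eta> > 0" using assms by (simp add: \<eta>_def)
  have "\<forall>k j. \<exists>X. j \<in> J \<longrightarrow> finite X \<and> X \<subseteq> Q j \<and> (\<forall>x\<in>Q j. \<exists>y\<in>X. dist y x < 1 / real (Suc k))"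
    using finite_net by simp
  then obtain X where X: "\<And>k j. j \<in> J \<Longrightarrow> finite (X k j)" "\<And>k j. j \<in> J \<Longrightarrow> X k j \<subseteq> Q j"
    "\<And>k j x. j \<in> J \<Longrightarrow> x \<in> Q j \<Longrightarrow> \<exists>y\<in>X k j. dist y x < 1 / real (Suc k)" by metis
  define modulus where "modulus f k \<longleftrightarrow>
      (\<forall>j\<in>J. \<forall>x\<in>Q j. \<forall>y\<in>Q j. dist y x < 1 / real (Suc k) \<longrightarrow> \<bar>d j y f - d j x f\<bar> < \<eta>)" for f k
  have modulus: "\<exists>k. modulus f k" if f: "f \<in> S" for f
  proof -
    have "\<forall>j\<in>J. \<exists>r>0. \<forall>x\<in>Q j. \<forall>y\<in>Q j. dist y x < r \<longrightarrow> \<bar>d j y f - d j x f\<bar> < \<eta>"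
      using compact_uniformly_continuous[OF d_cont[OF _ f] compact_Q] \<eta>
      unfolding uniformly_continuous_on_def dist_real_def by blast
    then obtain r where r: "\<And>j. j \<in> J \<Longrightarrow> r j > 0"
      "\<And>j x y. j \<in> J \<Longrightarrow> x \<in> Q j \<Longrightarrow> y \<in> Q j \<Longrightarrow> dist y x < r j \<Longrightarrow> \<bar>d j y f - d j x f\<bar> < \<eta>" by metis
    have "0 < Min (insert 1 (r ` J))" using r(1) finite_J by simp
    then obtain k where "1 / real (Suc k) < Min (insert 1 (r ` J))" by (rule nat_approx_posE)
    then have "\<And>j. j \<in> J \<Longrightarrow> 1 / real (Suc k) < r j" using finite_J by simp
    then show ?thesis using r(2) unfolding modulus_def by (meson less_trans)
  qed
  define k where "k f = (SOME k. modulus f k)" for f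
  have k: "modulus f (k f)" if "f \<in> S" for f unfolding k_def by (rule someI_ex[OF modulus[OF that]])
  \<comment> \<open>The enumeration of the net depends on \<open>k\<close> only, so equal codes
    compare values at the same points.\<close>
  define pts where "pts k = (SOME xs. set xs = (SIGMA j:J. X k j))" for k
  have pts: "set (pts k) = (SIGMA j:J. X k j)" for k
    unfolding pts_def by (rule someI_ex) (intro finite_list finite_SigmaI finite_J X(1))
  define code where "code f = to_nat (k f, map (\<lambda>(j, x). \<lfloor>d j x f / \<eta>\<rfloor>) (pts (k f)))" for f
  have "nrm (\<lambda>p. g p - f p) < \<epsilon>" if f: "f \<in> S" and g: "g \<in> S" and eq: "code f = code g" for f g
  proof -
    have kk: "k g = k f" and maps: "map (\<lambda>(j, x). \<lfloor>d j x f / \<eta>\<rfloor>) (pts (k f)) = map (\<lambda>(j, x). \<lfloor>d j x g / \<eta>\<rfloor>) (pts (k f))"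
      using eq by (auto simp: code_def)
    have "\<bar>d j x (\<lambda>p. g p - f p)\<bar> \<le> 3 * \<eta>" if j: "j \<in> J" and x: "x \<in> Q j" for j x
    proof -
      obtain y where y: "y \<in> X (k f) j" "dist y x < 1 / real (Suc (k f))" using X(3)[OF j x] by blast
      then have yQ: "y \<in> Q j" using X(2)[OF j] by blast
      have "(j, y) \<in> set (pts (k f))" using pts y j by simp
      with maps have fl: "\<lfloor>d j y f / \<eta>\<rfloor> = \<lfloor>d j y g / \<eta>\<rfloor>" by (auto simp: map_eq_conv)
      have "\<bar>d j y g / \<eta> - d j y f / \<eta>\<bar> < 1"
        using floor_correct[of "d j y f / \<eta>"] floor_correct[of "d j y g / \<eta>"] fl by linarith
      then have "\<bar>(d j y g - d j y f) / \<eta>\<bar> < 1" by (simp add: diff_divide_distrib)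
      then have "\<bar>d j y g - d j y f\<bar> < \<eta>" using \<eta> by (simp add: abs_divide)
      moreover have "\<bar>d j y f - d j x f\<bar> < \<eta>" "\<bar>d j y g - d j x g\<bar> < \<eta>"
        using k[OF f] k[OF g] y(2) j x yQ kk by (auto simp: modulus_def)
      ultimately show ?thesis using d_diff[OF j x g f] by linarith
    qed
    then have "nrm (\<lambda>p. g p - f p) \<le> card J * (3 * \<eta>)" by (rule nrm_le)
    also have "\<dots> < \<epsilon>" using assms by (simp add: \<eta>_def field_simps)
    finally show ?thesis .
  qed
  then show ?thesis by blast
qed

text \<open>A Lindeloef argument: for each level \<open>n\<close> and code \<open>i\<close> one
  center \<open>f\<close> is selected among those with \<open>1 / real (Suc n) < \<rho> f\<close>. A
  point \<open>g\<close> shares its code, at a level fine enough for \<open>\<rho> g\<close>, with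
  such a center; the condition on \<open>\<rho> f\<close> ensures that the ball of the selected
  center, and not only that of \<open>g\<close>, is large enough.\<close>

lemma countable_subcover:
  assumes V: "V \<subseteq> S" and \<rho>: "\<And>f. f \<in> V \<Longrightarrow> \<rho> f > 0"
  obtains V0 where "countable V0" "V0 \<subseteq> V" "\<And>g. g \<in> V \<Longrightarrow> \<exists>f\<in>V0. nrm (\<lambda>p. g p - f p) < \<rho> f"
proof -
  have "\<forall>n. \<exists>code :: ('m \<Rightarrow> real) \<Rightarrow> nat. \<forall>f\<in>S. \<forall>g\<in>S. code f = code g \<longrightarrow> nrm (\<lambda>p. g p - f p) < 1 / real (Suc n)"
    using countable_code by simp
  then obtain c :: "nat \<Rightarrow> ('m \<Rightarrow> real) \<Rightarrow> nat" where
    c: "\<And>n f g. f \<in> S \<Longrightarrow> g \<in> S \<Longrightarrow> c n f = c n g \<Longrightarrow> nrm (\<lambda>p. g p - f p) < 1 / real (Suc n)" by metis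
  define R where "R n i f \<longleftrightarrow> f \<in> V \<and> c n f = i \<and> 1 / real (Suc n) < \<rho> f" for n i f
  define V0 where "V0 = (\<lambda>(n, i). SOME f. R n i f) ` {(n, i). \<exists>f. R n i f}"
  show thesis
  proof
    show "countable V0" unfolding V0_def by (intro countable_image) simp
    show "V0 \<subseteq> V"
    proof
      fix f assume "f \<in> V0"
      then obtain n i where "\<exists>f. R n i f" "f = (SOME f. R n i f)" by (auto simp: V0_def)
      then have "R n i f" by (metis someI_ex)
      then show "f \<in> V" by (simp add: R_def)
    qed
    fix g assume g: "g \<in> V"
    obtain n where "1 / real (Suc n) < \<rho> g" using nat_approx_posE[OF \<rho>[OF g]] by blast
    then have Rg: "R n (c n g) g" using g by (simp add: R_def)
    define f where "f = (SOME f. R n (c n g) f)"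
    have f: "R n (c n g) f" unfolding f_def by (rule someI[of "R n (c n g)", OF Rg])
    have "f \<in> V0" unfolding V0_def f_def using Rg by (intro image_eqI[of _ _ "(n, c n g)"]) auto
    moreover have "nrm (\<lambda>p. g p - f p) < \<rho> f"
    proof -
      have "nrm (\<lambda>p. g p - f p) < 1 / real (Suc n)" using f g V by (intro c) (auto simp: R_def)
      then show ?thesis using f by (simp add: R_def)
    qed
    ultimately show "\<exists>f\<in>V0. nrm (\<lambda>p. g p - f p) < \<rho> f" by blast
  qed
qed

section \<open>Continuous functionals and Borel sets\<close>

lemma d_dual: "j \<in> J \<Longrightarrow> x \<in> Q j \<Longrightarrow> d j x \<in> continuous_dual B"
  unfolding continuous_dual_def
proof (intro CollectI conjI ballI allI)
  assume j: "j \<in> J" and x: "x \<in> Q j"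
  show "continuous_map B euclideanreal (d j x)"
    unfolding continuous_map_def topspace_B
  proof (intro conjI allI impI)
    fix U :: "real set" assume "openin euclideanreal U"
    then have U: "open U" by simp
    show "openin B {f \<in> S. d j x f \<in> U}"
      unfolding openin_B
    proof (intro conjI ballI)
      fix f assume "f \<in> {f \<in> S. d j x f \<in> U}"
      then have f: "f \<in> S" "d j x f \<in> U" by auto
      then obtain r where r: "r > 0" "\<And>y. dist y (d j x f) < r \<Longrightarrow> y \<in> U"
        using U open_dist by metis
      have "d j x g \<in> U" if "g \<in> S" "nrm (\<lambda>p. g p - f p) < r" for g
        using d_le_nrm[OF j x S_diff[OF that(1) f(1)]] d_diff[OF j x that(1) f(1)] that(2)
        by (intro r(2)) (simp add: dist_real_def)
      then show "\<exists>\<epsilon>>0. \<forall>g\<in>S. nrm (\<lambda>p. g p - f p) < \<epsilon> \<longrightarrow> g \<in> {f \<in> S. d j x f \<in> U}"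
        using r(1) by auto
    qed auto
  qed auto
  show "d j x (\<lambda>p. a * f p + b * g p) = a * d j x f + b * d j x g"
    if "f \<in> topspace B" "g \<in> topspace B" for f g a b
    using that d_lin[OF j x] by (simp add: topspace_B)
qed

lemma dual_linear:
  "l \<in> continuous_dual B \<Longrightarrow> f \<in> S \<Longrightarrow> g \<in> S \<Longrightarrow> l (\<lambda>p. f p + a * g p) = l f + a * l g"
  unfolding continuous_dual_def topspace_B by (elim CollectE conjE) (drule bspec[of S _ f], simp, drule bspec[of S _ g], simp, drule spec[of _ 1], drule spec[of _ a], simp)

lemma dual_lin_comb:
  "l \<in> continuous_dual B \<Longrightarrow> l' \<in> continuous_dual B \<Longrightarrow> (\<lambda>x. a * l x + b * l' x) \<in> continuous_dual B"
  unfolding continuous_dual_def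
  by (auto intro!: continuous_map_add continuous_map_real_mult_left simp: algebra_simps)

lemma dual_nonempty: "continuous_dual B \<noteq> {}"
proof -
  have "(\<lambda>_. 0) \<in> continuous_dual B" by (simp add: continuous_dual_def)
  then show ?thesis by blast
qed

text \<open>By continuity in the parameter, each supremum may be taken over the countable dense
  union of finite nets, and a countable supremum of functionals is measurable.\<close>

lemma nrm_measurable: "nrm \<in> borel_measurable (cylinder_sigma S (continuous_dual B))"
proof -
  have "(\<lambda>f. SUP x\<in>Q j. \<bar>d j x f\<bar>) \<in> borel_measurable (cylinder_sigma S (continuous_dual B))" if j: "j \<in> J" for j
  proof -
    have "\<forall>k. \<exists>X. finite X \<and> X \<subseteq> Q j \<and> (\<forall>x\<in>Q j. \<exists>y\<in>X. dist y x < 1 / real (Suc k))"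
      using finite_net[OF j] by simp
    then obtain X where X: "\<And>k. finite (X k)" "\<And>k. X k \<subseteq> Q j"
        "\<And>k x. x \<in> Q j \<Longrightarrow> \<exists>y\<in>X k. dist y x < 1 / real (Suc k)" by metis
    define D where "D = (\<Union>k. X k)"
    have D: "D \<subseteq> Q j" "countable D" using X by (auto simp: D_def countable_finite)
    have D_ne: "D \<noteq> {}" using X(3) Q_nonempty[OF j] by (fastforce simp: D_def)
    have eq: "(SUP x\<in>Q j. \<bar>d j x f\<bar>) = (SUP x\<in>D. \<bar>d j x f\<bar>)" if f: "f \<in> S" for f
    proof (rule antisym)
      have bddD: "bdd_above ((\<lambda>x. \<bar>d j x f\<bar>) ` D)" using d_bdd_above[OF j f] D(1) by (rule bdd_above_mono[OF _ image_mono])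
      show "(SUP x\<in>D. \<bar>d j x f\<bar>) \<le> (SUP x\<in>Q j. \<bar>d j x f\<bar>)"
        using D D_ne d_bdd_above[OF j f] by (intro cSUP_subset_mono) auto
      show "(SUP x\<in>Q j. \<bar>d j x f\<bar>) \<le> (SUP x\<in>D. \<bar>d j x f\<bar>)"
      proof (rule cSUP_least[OF Q_nonempty[OF j]], rule field_le_epsilon)
        fix x and e :: real assume x: "x \<in> Q j" and e: "e > 0"
        obtain r where r: "r > 0" "\<And>y. y \<in> Q j \<Longrightarrow> dist y x < r \<Longrightarrow> \<bar>d j y f - d j x f\<bar> < e"
          using d_cont[OF j f] x e unfolding continuous_on_iff dist_real_def by blast
        obtain k where k: "1 / real (Suc k) < r" using nat_approx_posE[OF r(1)] by blast
        obtain y where y: "y \<in> X k" "dist y x < 1 / real (Suc k)" using X(3)[OF x] by blast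
        then have "\<bar>d j y f - d j x f\<bar> < e" using X(2) k by (intro r(2)) auto
        moreover have "\<bar>d j y f\<bar> \<le> (SUP x\<in>D. \<bar>d j x f\<bar>)"
          using y by (intro cSUP_upper bddD) (auto simp: D_def)
        ultimately show "\<bar>d j x f\<bar> \<le> (SUP x\<in>D. \<bar>d j x f\<bar>) + e" by linarith
      qed
    qed
    have "(\<lambda>f. SUP x\<in>D. \<bar>d j x f\<bar>) \<in> borel_measurable (cylinder_sigma S (continuous_dual B))"
    proof (rule borel_measurable_cSUP[OF D(2)])
      show "(\<lambda>f. \<bar>d j x f\<bar>) \<in> borel_measurable (cylinder_sigma S (continuous_dual B))" if "x \<in> D" for x
        using measurable_cylinder_sigma_functional[OF d_dual[OF j subsetD[OF D(1) that]], of S] by measurable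
      show "bdd_above ((\<lambda>x. \<bar>d j x f\<bar>) ` D)" if "f \<in> space (cylinder_sigma S (continuous_dual B))" for f
        using that by (intro bdd_above_mono[OF d_bdd_above[OF j] image_mono] D(1)) simp
    qed
    then show ?thesis
      by (rule measurable_cong[THEN iffD1, rotated]) (simp add: eq)
  qed
  then show ?thesis unfolding sup_nrm_def by (rule borel_measurable_sum)
qed

lemma sets_borel_sigma: "sets (borel_sigma B) = sigma_sets S {G. openin B G}"
  unfolding borel_sigma_def topspace_B by (rule sets_measure_of) (auto simp: openin_B)

lemma space_borel_sigma: "space (borel_sigma B) = S"
  unfolding borel_sigma_def topspace_B by (rule space_measure_of) (auto simp: openin_B)

lemma closed_sets: "closedin B F \<Longrightarrow> F \<in> sets (borel_sigma B)"
proof -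
  assume F: "closedin B F"
  then have "S - F \<in> sets (borel_sigma B)" unfolding sets_borel_sigma by (auto simp: closedin_def topspace_B)
  then have "space (borel_sigma B) - (S - F) \<in> sets (borel_sigma B)" by (rule sets.compl_sets)
  then show ?thesis using closedin_subset_S[OF F] by (simp add: space_borel_sigma double_diff)
qed

lemma ball_cylinder:
  assumes f: "f \<in> S"
  shows "{g \<in> S. nrm (\<lambda>p. g p - f p) < r} \<in> sets (cylinder_sigma S (continuous_dual B))"
proof -
  let ?M = "cylinder_sigma S (continuous_dual B)"
  have "(\<lambda>g p. g p - f p) \<in> measurable ?M ?M"
  proof (rule measurable_cylinder_sigmaI)
    fix l assume l: "l \<in> continuous_dual B"
    note [measurable] = measurable_cylinder_sigma_functional[OF l, of S]
    have "(\<lambda>g. l g + (-1) * l f) \<in> borel_measurable ?M" by measurable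
    then show "(\<lambda>g. l (\<lambda>p. g p - f p)) \<in> borel_measurable ?M"
      using dual_linear[OF l _ f, of _ "-1"] by (rule_tac measurable_cong[THEN iffD1, rotated]) simp_all
  qed (simp add: S_diff f)
  then have [measurable]: "(\<lambda>g. nrm (\<lambda>p. g p - f p)) \<in> borel_measurable ?M"
    using nrm_measurable by (rule measurable_compose)
  have "{g \<in> space ?M. nrm (\<lambda>p. g p - f p) < r} \<in> sets ?M" by measurable
  then show ?thesis by simp
qed

text \<open>Separability writes an open set as a countable union of balls, which are cylinder
  measurable. This makes the law on Borel sets identifiable from its characteristic
  functional.\<close>

lemma sets_borel_sigma_cylinder: "sets (borel_sigma B) = sets (cylinder_sigma S (continuous_dual B))"
proof
  let ?M = "cylinder_sigma S (continuous_dual B)"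
  have "G \<in> sets ?M" if G: "openin B G" for G
  proof -
    have GS: "G \<subseteq> S" using G openin_B by blast
    have "\<forall>f\<in>G. \<exists>\<epsilon>>0. \<forall>g\<in>S. nrm (\<lambda>p. g p - f p) < \<epsilon> \<longrightarrow> g \<in> G" using G openin_B by blast
    then obtain \<rho> where \<rho>: "\<And>f. f \<in> G \<Longrightarrow> \<rho> f > 0"
        "\<And>f g. f \<in> G \<Longrightarrow> g \<in> S \<Longrightarrow> nrm (\<lambda>p. g p - f p) < \<rho> f \<Longrightarrow> g \<in> G" by metis
    obtain V0 where V0: "countable V0" "V0 \<subseteq> G" "\<And>g. g \<in> G \<Longrightarrow> \<exists>f\<in>V0. nrm (\<lambda>p. g p - f p) < \<rho> f"
      using countable_subcover[OF GS, of \<rho>] \<rho>(1) by blast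
    have "G = (\<Union>f\<in>V0. {g \<in> S. nrm (\<lambda>p. g p - f p) < \<rho> f})"
    proof (intro equalityI subsetI)
      fix g assume g: "g \<in> G"
      then have "g \<in> S" using GS by blast
      with V0(3)[OF g] show "g \<in> (\<Union>f\<in>V0. {g \<in> S. nrm (\<lambda>p. g p - f p) < \<rho> f})" by simp
    next
      fix g assume "g \<in> (\<Union>f\<in>V0. {g \<in> S. nrm (\<lambda>p. g p - f p) < \<rho> f})"
      then obtain f where f: "f \<in> V0" "g \<in> S" "nrm (\<lambda>p. g p - f p) < \<rho> f" by blast
      show "g \<in> G" by (rule \<rho>(2)[OF subsetD[OF V0(2) f(1)] f(2,3)])
    qed
    also have "\<dots> \<in> sets ?M"
      using ball_cylinder V0(1,2) GS by (intro sets.countable_UN') blast+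
    finally show ?thesis .
  qed
  then show "sets (borel_sigma B) \<subseteq> sets ?M"
    unfolding sets_borel_sigma using sets.sigma_sets_subset[of "{G. openin B G}" ?M] by auto
  have "l -` A \<inter> S \<in> sets (borel_sigma B)" if l: "l \<in> continuous_dual B" and A: "A \<in> sets borel" for l A
  proof -
    have "l \<in> borel_measurable (borel_sigma B)"
    proof (rule borel_measurableI)
      fix U :: "real set" assume "open U"
      then have "openin B {f \<in> topspace B. l f \<in> U}"
        using l by (intro openin_continuous_map_preimage[of B euclideanreal]) (auto simp: continuous_dual_def)
      moreover have "{f \<in> topspace B. l f \<in> U} = l -` U \<inter> space (borel_sigma B)"
        by (auto simp: topspace_B space_borel_sigma)
      ultimately show "l -` U \<inter> space (borel_sigma B) \<in> sets (borel_sigma B)"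
        unfolding sets_borel_sigma by auto
    qed
    from measurable_sets[OF this A] show ?thesis by (simp add: space_borel_sigma)
  qed
  then show "sets ?M \<subseteq> sets (borel_sigma B)"
    unfolding sets_cylinder_sigma
    using sets.sigma_sets_subset[of "{l -` A \<inter> S |l A. l \<in> continuous_dual B \<and> A \<in> sets borel}" "borel_sigma B"]
    unfolding space_borel_sigma by blast
qed

section \<open>Projections along \<open>e\<close> and their capacity\<close>

definition shadow :: "('m \<Rightarrow> real) \<Rightarrow> real \<Rightarrow> ('m \<Rightarrow> real) set \<Rightarrow> ('m \<Rightarrow> real) set" where
  "shadow e r A = {f \<in> S. \<exists>t\<in>{-r..r}. (\<lambda>p. f p + t * e p) \<in> A}"

text \<open>The compact range of \<open>t\<close> provides a limit \<open>\<tau>\<close> of a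
  subsequence of the translation parameters, and monotonicity of \<open>F\<close> puts
  \<open>f + \<tau> e\<close> in every \<open>F n\<close>. A constant \<open>F\<close> shows that
  shadows of closed sets are closed; taking \<open>f\<close> itself as approximant shows that
  shadows commute with decreasing intersections of closed sets.\<close>

lemma shadow_limit:
  assumes e: "e \<in> S" and f: "f \<in> S" and F: "decseq F" "\<And>n. closedin B (F n)"
    and near: "\<And>n. \<exists>g \<in> shadow e r (F n). nrm (\<lambda>p. g p - f p) < 1 / real (Suc n)"
  shows "f \<in> shadow e r (\<Inter>n. F n)"
proof -
  define ok where "ok n u \<longleftrightarrow> fst u \<in> S \<and> snd u \<in> {-r..r} \<and> (\<lambda>p. fst u p + snd u * e p) \<in> F n \<and>
      nrm (\<lambda>p. fst u p - f p) < 1 / real (Suc n)" for n u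
  have "\<exists>u. ok n u" for n
  proof -
    obtain g t where "g \<in> S" "t \<in> {-r..r}" "(\<lambda>p. g p + t * e p) \<in> F n" "nrm (\<lambda>p. g p - f p) < 1 / real (Suc n)"
      using near[of n] by (auto simp: shadow_def)
    then show ?thesis by (intro exI[of _ "(g, t)"]) (simp add: ok_def)
  qed
  then obtain u where u: "\<And>n. ok n (u n)" by metis
  define g t where "g n = fst (u n)" and "t n = snd (u n)" for n
  have gt: "g n \<in> S" "t n \<in> {-r..r}" "(\<lambda>p. g n p + t n * e p) \<in> F n"
      "nrm (\<lambda>p. g n p - f p) < 1 / real (Suc n)" for n
    using u[of n] by (simp_all add: ok_def g_def t_def)
  obtain \<tau> s where \<tau>: "\<tau> \<in> {-r..r}" "strict_mono s" "(t \<circ> s) \<longlonglongrightarrow> \<tau>"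
    using compact_imp_seq_compact[OF compact_Icc[of "-r" r]] gt(2) unfolding seq_compact_def by metis
  have "(\<lambda>p. f p + \<tau> * e p) \<in> F n" for n
  proof (rule closedinD[OF F(2)])
    show "(\<lambda>p. f p + \<tau> * e p) \<in> S" using f e by (rule S_line)
    fix \<epsilon> :: real assume \<epsilon>: "\<epsilon> > 0"
    define \<eta> where "\<eta> = \<epsilon> / 2 / (nrm e + 1)"
    have e1: "nrm e + 1 > 0" using nrm_nonneg[OF e] by simp
    have "\<eta> > 0" using \<epsilon> e1 by (simp add: \<eta>_def)
    then obtain N where N: "\<And>k. k \<ge> N \<Longrightarrow> \<bar>t (s k) - \<tau>\<bar> < \<eta>"
      using LIMSEQ_D[OF \<tau>(3)] by fastforce
    obtain M where M: "1 / real (Suc M) < \<epsilon> / 2" using nat_approx_posE[of "\<epsilon> / 2"] \<epsilon> by auto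
    \<comment> \<open>The three summands make the translation parameter close to
      \<open>\<tau>\<close>, the approximant close to \<open>f\<close>, and \<open>F (s k)\<close> a
      subset of \<open>F n\<close>.\<close>
    define k where "k = N + M + n"
    have sk: "k \<le> s k" using \<tau>(2) by (rule seq_suble)
    have "(\<lambda>p. g (s k) p + t (s k) * e p) \<in> F n"
      using gt(3)[of "s k"] decseqD[OF F(1), of n "s k"] sk by (auto simp: k_def)
    moreover have "nrm (\<lambda>p. (g (s k) p + t (s k) * e p) - (f p + \<tau> * e p)) < \<epsilon>"
    proof -
      have "nrm (\<lambda>p. (g (s k) p + t (s k) * e p) - (f p + \<tau> * e p)) =
          nrm (\<lambda>p. (g (s k) p - f p) + (t (s k) - \<tau>) * e p)" by (simp add: algebra_simps)
      also have "\<dots> \<le> nrm (\<lambda>p. g (s k) p - f p) + nrm (\<lambda>p. (t (s k) - \<tau>) * e p)"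
        by (intro nrm_add S_diff S_scale gt f e)
      also have "\<dots> = nrm (\<lambda>p. g (s k) p - f p) + \<bar>t (s k) - \<tau>\<bar> * nrm e"
        using nrm_scale[OF e] by simp
      also have "\<dots> < \<epsilon> / 2 + \<epsilon> / 2"
      proof (rule add_less_le_mono)
        have "1 / real (Suc (s k)) \<le> 1 / real (Suc M)" using sk by (simp add: k_def frac_le)
        then show "nrm (\<lambda>p. g (s k) p - f p) < \<epsilon> / 2" using gt(4)[of "s k"] M by linarith
        have "\<bar>t (s k) - \<tau>\<bar> * nrm e \<le> \<eta> * (nrm e + 1)"
          using N[of k] nrm_nonneg[OF e] by (intro mult_mono) (auto simp: k_def)
        also have "\<dots> = \<epsilon> / 2"
          by (metis e1 \<eta>_def less_irrefl nonzero_eq_divide_eq)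
        finally show "\<bar>t (s k) - \<tau>\<bar> * nrm e \<le> \<epsilon> / 2" .
      qed
      finally show ?thesis by simp
    qed
    ultimately show "\<exists>g\<in>F n. nrm (\<lambda>p. g p - (f p + \<tau> * e p)) < \<epsilon>"
      by (intro bexI[where x = "\<lambda>p. g (s k) p + t (s k) * e p"])
  qed
  then show ?thesis using \<tau>(1) f unfolding shadow_def by blast
qed

lemma closedin_shadow:
  assumes "e \<in> S" "closedin B K"
  shows "closedin B (shadow e r K)"
proof (rule closedinI)
  fix f assume f: "f \<in> S" and "\<And>\<epsilon>. \<epsilon> > 0 \<Longrightarrow> \<exists>g\<in>shadow e r K. nrm (\<lambda>p. g p - f p) < \<epsilon>"
  then have "f \<in> shadow e r (\<Inter>n::nat. K)"
    using assms by (intro shadow_limit) (auto simp: decseq_def)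
  then show "f \<in> shadow e r K" by simp
qed (auto simp: shadow_def)

text \<open>A positive outer measure of the shadow would already be attained up to
  \<open>c > 0\<close> by a closed \<open>K \<subseteq> A\<close>. Continuity from below is a
  property of outer measures of arbitrary sets; along decreasing closed sets it follows from
  \<open>shadow_limit\<close> and the finiteness of \<mu>. The shadow of \<open>A\<close> itself may
  fail to be measurable, hence the covering null set.\<close>

lemma shadow_capacity:
  assumes \<mu>: "finite_measure \<mu>" "sets \<mu> = sets (borel_sigma B)" and e: "e \<in> S"
    and A: "A \<in> sets (borel_sigma B)"
    and null: "\<And>K. closedin B K \<Longrightarrow> K \<subseteq> A \<Longrightarrow> emeasure \<mu> (shadow e r K) = 0"
  shows "\<exists>N\<in>null_sets \<mu>. shadow e r A \<subseteq> N"
proof -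
  interpret finite_measure \<mu> by fact
  have sp: "space \<mu> = S" using sets_eq_imp_space_eq[OF \<mu>(2)] by (simp add: space_borel_sigma)
  let ?\<Phi> = "\<lambda>A. outer_measure_of \<mu> (shadow e r A)"
  have closed_meas: "shadow e r K \<in> sets \<mu>" if "closedin B K" for K
    unfolding \<mu>(2) using closedin_shadow[OF e that] by (rule closed_sets)
  have "?\<Phi> A = 0"
  proof (rule ccontr)
    assume "?\<Phi> A \<noteq> 0"
    then have "0 < ?\<Phi> A" by (simp add: zero_less_iff_neq_zero)
    then obtain c where c: "0 < c" "c < ?\<Phi> A" using dense by blast
    have "souslin {F. closedin B F} A"
      using A openin_fsigma unfolding sets_borel_sigma by (intro borel_souslin) (auto simp: topspace_B)
    then obtain K where K: "closedin B K" "K \<subseteq> A" "c \<le> ?\<Phi> K"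
    proof (rule choquet_capacitability[where \<Phi> = ?\<Phi>])
      show "?\<Phi> X \<le> ?\<Phi> Y" if "X \<subseteq> Y" for X Y
        using that by (intro outer_measure_of_mono) (auto simp: shadow_def)
      show "?\<Phi> (\<Union>n. X n) = (SUP n. ?\<Phi> (X n))" if X: "incseq X" for X :: "nat \<Rightarrow> _"
      proof -
        have "incseq (\<lambda>n. shadow e r (X n))" using X by (fastforce simp: incseq_def shadow_def)
        then have "(SUP n. ?\<Phi> (X n)) = outer_measure_of \<mu> (\<Union>n. shadow e r (X n))"
          by (intro SUP_outer_measure_of_incseq) (auto simp: shadow_def sp)
        moreover have "(\<Union>n. shadow e r (X n)) = shadow e r (\<Union>n. X n)" by (auto simp: shadow_def)
        ultimately show ?thesis by simp
      qed
      show "(INF n. ?\<Phi> (F n)) \<le> ?\<Phi> (\<Inter>n. F n)" if F: "decseq F" "\<And>n. closedin B (F n)" for F :: "nat \<Rightarrow> _"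
      proof -
        have "(\<Inter>n. shadow e r (F n)) = shadow e r (\<Inter>n. F n)"
        proof
          show "(\<Inter>n. shadow e r (F n)) \<subseteq> shadow e r (\<Inter>n. F n)"
          proof
            fix f assume f: "f \<in> (\<Inter>n. shadow e r (F n))"
            then have "f \<in> S" by (auto simp: shadow_def)
            with f show "f \<in> shadow e r (\<Inter>n. F n)"
              using e F nrm_0 by (intro shadow_limit) (auto intro!: bexI[of _ f])
          qed
        qed (auto simp: shadow_def)
        moreover have "decseq (\<lambda>n. shadow e r (F n))" using F(1) by (fastforce simp: decseq_def shadow_def)
        then have "(INF n. emeasure \<mu> (shadow e r (F n))) = emeasure \<mu> (\<Inter>n. shadow e r (F n))"
          using closed_meas[OF F(2)] by (intro INF_emeasure_decseq) auto
        moreover have "closedin B (\<Inter>n. F n)" using F(2) by (intro closedin_INT) auto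
        ultimately show ?thesis using closed_meas F(2) by simp
      qed
    qed (use c in auto)
    then show False using null closed_meas c(1) by simp
  qed
  moreover obtain N where "N \<in> sets \<mu>" "shadow e r A \<subseteq> N" "?\<Phi> A = emeasure \<mu> N"
    using outer_measure_of_attain[of "shadow e r A" \<mu>] by (auto simp: shadow_def sp)
  ultimately show ?thesis by auto
qed

text \<open>For \<open>e\<close> nonzero this is the comparison of the norm of
  \<open>s h + t e\<close> with the sizes of the coefficients. For \<open>e = 0\<close> nothing
  bounds \<open>t\<close>, but then \<open>t' = 0\<close> gives the same vector; this is why the
  conclusion speaks of \<open>t'\<close>.\<close>

lemma independent_bound:
  assumes h: "h \<in> S" and e: "e \<in> S" and indep: "h \<notin> range (\<lambda>c p. c * e p)" and \<delta>: "\<delta> > 0"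
  obtains \<rho> where "\<rho> > 0" "\<And>s t. nrm (\<lambda>p. s * h p + t * e p) < \<rho> \<Longrightarrow>
    \<bar>s\<bar> < \<delta> \<and> (\<exists>t'. \<bar>t'\<bar> < \<delta> \<and> (\<forall>p. t' * e p = t * e p))"
proof (cases "e = (\<lambda>_. 0)")
  case True
  have "h \<noteq> (\<lambda>_. 0)" using indep True by auto
  then have h0: "nrm h > 0" using nrm_eq_0[OF h] nrm_nonneg[OF h] by fastforce
  show thesis
  proof (rule that[of "\<delta> * nrm h"])
    show "\<delta> * nrm h > 0" using \<delta> h0 by simp
    fix s t assume "nrm (\<lambda>p. s * h p + t * e p) < \<delta> * nrm h"
    then have "\<bar>s\<bar> * nrm h < \<delta> * nrm h" using nrm_scale[OF h] True by simp
    then show "\<bar>s\<bar> < \<delta> \<and> (\<exists>t'. \<bar>t'\<bar> < \<delta> \<and> (\<forall>p. t' * e p = t * e p))"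
      using h0 \<delta> True by (auto intro!: exI[of _ 0])
  qed
next
  case False
  then have e0: "nrm e > 0" using nrm_eq_0[OF e] nrm_nonneg[OF e] by fastforce
  define \<phi> where "\<phi> t = nrm (\<lambda>p. h p + t * e p)" for t
  have \<phi>S: "(\<lambda>p. h p + t * e p) \<in> S" for t using h e by (rule S_line)
  have lip: "\<phi> t \<le> \<phi> u + \<bar>t - u\<bar> * nrm e" for t u
  proof -
    have "\<phi> t = nrm (\<lambda>p. (h p + u * e p) + (t - u) * e p)" by (simp add: \<phi>_def algebra_simps)
    also have "\<dots> \<le> \<phi> u + nrm (\<lambda>p. (t - u) * e p)"
      unfolding \<phi>_def by (intro nrm_add \<phi>S S_scale e)
    finally show ?thesis using nrm_scale[OF e] by simp
  qed
  have "continuous_on UNIV \<phi>"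
    unfolding continuous_on_iff
  proof (intro ballI allI impI)
    fix t \<epsilon> :: real assume "\<epsilon> > 0"
    then show "\<exists>d>0. \<forall>u\<in>UNIV. dist u t < d \<longrightarrow> dist (\<phi> u) (\<phi> t) < \<epsilon>"
      using e0 lip[of _ t] lip[of t]
      by (intro exI[of _ "\<epsilon> / nrm e"]) (auto simp: dist_real_def pos_less_divide_eq abs_less_iff abs_minus_commute, smt+)
  qed
  \<comment> \<open>Beyond \<open>T\<close> the triangle inequality gives
    \<open>\<phi> t \<ge> 1\<close>; on \<open>{-T..T}\<close> the minimum is attained and nonzero.
    So \<open>\<kappa>\<close> is a positive lower bound for the distance of \<open>h\<close> to the
    line spanned by \<open>e\<close>.\<close>
  define T where "T = (nrm h + 1) / nrm e"
  have T: "T > 0" using e0 nrm_nonneg[OF h] by (simp add: T_def)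
  obtain t0 where t0: "t0 \<in> {-T..T}" "\<And>t. t \<in> {-T..T} \<Longrightarrow> \<phi> t0 \<le> \<phi> t"
    using continuous_attains_inf[of "{-T..T}" \<phi>] T continuous_on_subset[OF \<open>continuous_on UNIV \<phi>\<close>] by auto
  have "\<phi> t0 \<noteq> 0"
  proof
    assume "\<phi> t0 = 0"
    then have "(\<lambda>p. h p + t0 * e p) = (\<lambda>_. 0)" unfolding \<phi>_def by (rule nrm_eq_0[OF \<phi>S])
    then have "h p = (- t0) * e p" for p by (metis add_eq_0_iff mult_minus_left add.commute)
    then have "h = (\<lambda>p. (- t0) * e p)" by blast
    then show False using indep by blast
  qed
  then have \<phi>0: "\<phi> t0 > 0" using nrm_nonneg[OF \<phi>S] by (simp add: \<phi>_def less_le)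
  define \<kappa> where "\<kappa> = min 1 (\<phi> t0)"
  have \<kappa>: "\<kappa> > 0" "\<kappa> \<le> \<phi> t" for t
  proof -
    show "\<kappa> > 0" using \<phi>0 by (simp add: \<kappa>_def)
    show "\<kappa> \<le> \<phi> t"
    proof (cases "t \<in> {-T..T}")
      case True
      then show ?thesis using t0(2) by (fastforce simp: \<kappa>_def)
    next
      case False
      then have "T \<le> \<bar>t\<bar>" by auto
      then have "nrm h + 1 \<le> \<bar>t\<bar> * nrm e" using e0 by (simp add: T_def pos_divide_le_eq)
      also have "\<dots> = nrm (\<lambda>p. (h p + t * e p) + (-1) * h p)" using nrm_scale[OF e] by simp
      also have "\<dots> \<le> \<phi> t + nrm (\<lambda>p. (-1) * h p)" unfolding \<phi>_def by (intro nrm_add \<phi>S S_scale h)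
      finally show ?thesis using nrm_scale[OF h, of "-1"] by (simp add: \<kappa>_def)
    qed
  qed
  have lower: "\<bar>s\<bar> * \<kappa> \<le> nrm (\<lambda>p. s * h p + t * e p)" for s t
  proof (cases "s = 0")
    case True
    then show ?thesis using nrm_nonneg[OF S_scale[OF e]] by simp
  next
    case False
    have "\<bar>s\<bar> * \<kappa> \<le> \<bar>s\<bar> * \<phi> (t / s)" using \<kappa>(2) by (intro mult_left_mono) auto
    also have "\<dots> = nrm (\<lambda>p. s * (h p + t / s * e p))" unfolding \<phi>_def by (rule nrm_scale[OF \<phi>S, symmetric])
    finally show ?thesis using False by (simp add: algebra_simps)
  qed
  \<comment> \<open>The first bound makes \<open>s\<close> small. The second makes \<open>t\<close>
    small, since \<open>t e\<close> differs from \<open>s h + t e\<close> by \<open>s h\<close>,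
    whose norm is at most \<open>nrm h / \<kappa>\<close> times that of
    \<open>s h + t e\<close>.\<close>
  define \<rho> where "\<rho> = min (\<delta> * \<kappa>) (\<delta> * nrm e / (1 + nrm h / \<kappa>))"
  have den: "1 + nrm h / \<kappa> > 0" using \<kappa>(1) nrm_nonneg[OF h] by (simp add: add_pos_nonneg)
  show thesis
  proof (rule that[of \<rho>])
    show "\<rho> > 0" using \<delta> \<kappa>(1) e0 den by (simp add: \<rho>_def)
    fix s t assume less: "nrm (\<lambda>p. s * h p + t * e p) < \<rho>"
    let ?n = "nrm (\<lambda>p. s * h p + t * e p)"
    have "\<bar>s\<bar> * \<kappa> < \<delta> * \<kappa>" using lower[of s t] less by (simp add: \<rho>_def)
    then have s: "\<bar>s\<bar> < \<delta>" using \<kappa>(1) by simp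
    have "\<bar>t\<bar> * nrm e = nrm (\<lambda>p. (s * h p + t * e p) + (- s) * h p)" using nrm_scale[OF e] by simp
    also have "\<dots> \<le> ?n + \<bar>s\<bar> * nrm h"
      using nrm_add[OF S_lin[OF h e, of s t] S_scale[OF h, of "- s"]] nrm_scale[OF h, of "- s"] by simp
    also have "\<dots> \<le> ?n + ?n / \<kappa> * nrm h"
      using lower[of s t] \<kappa>(1) nrm_nonneg[OF h] by (intro add_left_mono mult_right_mono) (auto simp: pos_le_divide_eq)
    also have "\<dots> = ?n * (1 + nrm h / \<kappa>)" by (simp add: algebra_simps)
    also have "\<dots> < \<delta> * nrm e" using less den by (simp add: \<rho>_def pos_less_divide_eq)
    finally have "\<bar>t\<bar> < \<delta>" using e0 by simp
    with s show "\<bar>s\<bar> < \<delta> \<and> (\<exists>t'. \<bar>t'\<bar> < \<delta> \<and> (\<forall>p. t' * e p = t * e p))" by blast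
  qed
qed

theorem gaussian_null:
  assumes P: "prob_space P" and X: "centered_gaussian_element P B X"
    and E: "E \<subseteq> S" and V: "V \<subseteq> E" "V \<in> sets (borel_sigma B)" and e: "e \<in> S"
    and local: "\<forall>f0\<in>V. \<exists>N \<delta> h.
           openin (subtopology B E) N \<and> f0 \<in> N \<and> \<delta> > 0 \<and>
           h \<in> cameron_martin_space B (law P B X) - range (\<lambda>c p. c * e p) \<and>
           (\<forall>f\<in>N. AE s in lborel. s \<in> {-\<delta><..<\<delta>} \<longrightarrow>
              T_set V e f \<delta> h \<inter> ({s} \<times> UNIV) = {})"
  shows "{\<omega> \<in> space P. \<exists>t. (\<lambda>p. X \<omega> p + t * e p) \<in> V} \<in> null_sets (completion P)"
proof -
  interpret P: prob_space P by fact
  let ?L = "continuous_dual B"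
  define \<mu> where "\<mu> = law P B X"
  have Xm: "X \<in> measurable P (borel_sigma B)" using X by (simp add: centered_gaussian_element_def)
  have \<mu>: "prob_space \<mu>" unfolding \<mu>_def law_def by (rule P.prob_space_distr[OF Xm])
  interpret \<mu>: prob_space \<mu> by fact
  have sets_B: "sets \<mu> = sets (borel_sigma B)" by (simp add: \<mu>_def law_def)
  then have sets_L: "sets \<mu> = sets (cylinder_sigma S ?L)" by (simp add: sets_borel_sigma_cylinder)
  have sp: "space \<mu> = S" using sets_eq_imp_space_eq[OF sets_L] by simp
  have l_meas: "l \<in> borel_measurable \<mu>" if "l \<in> ?L" for l
    using measurable_cylinder_sigma_functional[OF that, of S] sets_L by (simp cong: measurable_cong_sets)
  have gauss: "integrable \<mu> (\<lambda>x. (l x)\<^sup>2)" "(CLINT x|\<mu>. iexp (l x)) = exp (- (LINT x|\<mu>. (l x)\<^sup>2) / 2)"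
    if l: "l \<in> ?L" for l
  proof -
    note [measurable] = l_meas[OF l]
    have "distr \<mu> borel l = distr P borel (\<lambda>\<omega>. l (X \<omega>))"
      unfolding \<mu>_def law_def using Xm l_meas[OF l] sets_B
      by (subst distr_distr) (auto simp: comp_def cong: measurable_cong_sets)
    then have "centered_gaussian_real (distr \<mu> borel l)"
      using X l by (simp add: centered_gaussian_element_def)
    note m = centered_gaussian_real_moments[OF this]
    show "integrable \<mu> (\<lambda>x. (l x)\<^sup>2)"
      using m(1) by (subst (asm) integrable_distr_eq) auto
    have "(CLINT x|\<mu>. iexp (l x)) = (CLINT x|distr \<mu> borel l. iexp x)"
      by (subst integral_distr) auto
    moreover have "(LINT x|\<mu>. (l x)\<^sup>2) = (LINT x|distr \<mu> borel l. x\<^sup>2)"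
      by (subst integral_distr) auto
    ultimately show "(CLINT x|\<mu>. iexp (l x)) = exp (- (LINT x|\<mu>. (l x)\<^sup>2) / 2)" using m(2) by simp
  qed
  have cover: "\<exists>r>0. \<forall>n. \<exists>N\<in>null_sets \<mu>. shadow e (real n) (V \<inter> {g \<in> S. nrm (\<lambda>p. g p - f0 p) < r}) \<subseteq> N"
    if f0: "f0 \<in> V" for f0
  proof -
    from bspec[OF local f0, folded \<mu>_def]
    obtain N \<delta> h where N: "openin (subtopology B E) N" "f0 \<in> N" "\<delta> > 0"
        "h \<in> cameron_martin_space B \<mu> - range (\<lambda>c p. c * e p)"
        "\<forall>f\<in>N. AE s in lborel. s \<in> {-\<delta><..<\<delta>} \<longrightarrow> T_set V e f \<delta> h \<inter> ({s} \<times> UNIV) = {}"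
      by (elim exE conjE)
    have indep: "h \<notin> range (\<lambda>c p. c * e p)" using N(4) by blast
    obtain G where G: "openin B G" "N = G \<inter> E" using N(1) by (auto simp: openin_subtopology)
    from DiffD1[OF N(4), unfolded cameron_martin_space_def topspace_B mem_Collect_eq]
    obtain \<gamma> where h: "h \<in> S" and \<gamma>0: "\<gamma> \<in> borel_measurable \<mu>" "integrable \<mu> (\<lambda>x. (\<gamma> x)\<^sup>2)"
        "\<forall>\<epsilon>>0. \<exists>l\<in>?L. (LINT x|\<mu>. (\<gamma> x - l x)\<^sup>2) < \<epsilon>" "\<forall>l\<in>?L. l h = (LINT x|\<mu>. \<gamma> x * l x)"
      by (elim conjE exE)
    note \<gamma> = \<gamma>0(1,2) \<gamma>0(3)[rule_format] \<gamma>0(4)[rule_format]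
    \<comment> \<open>Otherwise every continuous functional would vanish at \<open>h\<close>, so
      \<open>h\<close> would be 0 and thus a multiple of \<open>e\<close>.\<close>
    have \<gamma>_nonzero: "(LINT x|\<mu>. (\<gamma> x)\<^sup>2) \<noteq> 0"
    proof
      assume "(LINT x|\<mu>. (\<gamma> x)\<^sup>2) = 0"
      then have AE0: "AE x in \<mu>. \<gamma> x = 0"
        using integral_nonneg_eq_0_iff_AE[OF \<gamma>(2)] by simp
      have "l h = 0" if l: "l \<in> ?L" for l
      proof -
        note [measurable] = l_meas[OF l] \<gamma>(1)
        have "(LINT x|\<mu>. \<gamma> x * l x) = (LINT x|\<mu>. 0)"
          using AE0 by (intro integral_cong_AE) auto
        then show ?thesis using \<gamma>(4)[OF l] by simp
      qed
      then have "h = (\<lambda>_. 0)" using d_dual by (intro d_separating[OF h]) blast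
      then have "h = (\<lambda>p. 0 * e p)" by simp
      then show False using indep by blast
    qed
    have "f0 \<in> G" using N(2) G(2) by blast
    then obtain \<rho>1 where \<rho>1: "\<rho>1 > 0" "\<And>g. g \<in> S \<Longrightarrow> nrm (\<lambda>p. g p - f0 p) < \<rho>1 \<Longrightarrow> g \<in> G"
      using G(1) openin_B by metis
    obtain \<rho>2 where \<rho>2: "\<rho>2 > 0" "\<And>s t. nrm (\<lambda>p. s * h p + t * e p) < \<rho>2 \<Longrightarrow>
        \<bar>s\<bar> < \<delta> \<and> (\<exists>t'. \<bar>t'\<bar> < \<delta> \<and> (\<forall>p. t' * e p = t * e p))"
      using independent_bound[OF h e indep N(3)] by blast
    \<comment> \<open>The bound \<open>\<rho>1\<close> keeps the ball inside the neighborhood of the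
      hypothesis; the half of \<open>\<rho>2\<close> is there because two points of the ball are at
      distance less than \<open>2 * r\<close>.\<close>
    define r where "r = min \<rho>1 (\<rho>2 / 2)"
    define W where "W = V \<inter> {g \<in> S. nrm (\<lambda>p. g p - f0 p) < r}"
    have f0S: "f0 \<in> S" using f0 V E by blast
    have W_N: "W \<subseteq> N" using V(1) \<rho>1(2) G(2) by (auto simp: W_def r_def)
    have W_S: "W \<subseteq> S" by (auto simp: W_def)
    have "\<exists>Z\<in>null_sets \<mu>. shadow e (real n) W \<subseteq> Z" for n
    proof (rule shadow_capacity[OF \<mu>.finite_measure_axioms sets_B e])
      show "W \<in> sets (borel_sigma B)"
        unfolding W_def using V(2) ball_cylinder[OF f0S] sets_borel_sigma_cylinder by blast
      fix K assume K: "closedin B K" "K \<subseteq> W"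
      have A: "shadow e (real n) K \<in> sets \<mu>"
        unfolding sets_B by (rule closed_sets[OF closedin_shadow[OF e K(1)]])
      show "emeasure \<mu> (shadow e (real n) K) = 0"
      proof (rule gaussian_null_if_lines_null[OF \<mu> sets_L S_line dual_nonempty dual_lin_comb dual_linear
            gauss h \<gamma> \<gamma>_nonzero A])
        fix f assume f: "f \<in> S"
        define Y where "Y = {s. (\<lambda>p. f p + s * h p) \<in> shadow e (real n) K}"
        have "(\<lambda>s. (\<lambda>p. f p + s * h p)) \<in> measurable lborel (cylinder_sigma S ?L)"
        proof (rule measurable_cylinder_sigmaI)
          show "(\<lambda>s. l (\<lambda>p. f p + s * h p)) \<in> borel_measurable lborel" if "l \<in> ?L" for l
            unfolding dual_linear[OF that f h] by measurable
        qed (intro S_line f h)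
        then have "(\<lambda>s. (\<lambda>p. f p + s * h p)) \<in> measurable lborel \<mu>"
          using sets_L by (simp cong: measurable_cong_sets)
        from measurable_sets[OF this A] have Y_sets: "Y \<in> sets lborel"
          by (simp add: Y_def vimage_def)
        show "Y \<in> null_sets lborel"
        proof (cases "Y = {}")
          case False
          then obtain s0 t0 where g: "(\<lambda>p. (f p + s0 * h p) + t0 * e p) \<in> K"
            by (auto simp: Y_def shadow_def)
          \<comment> \<open>The point \<open>f\<close> is arbitrary in the space, whereas
            \<open>g\<close> lies in \<open>W \<subseteq> N\<close>, where the hypothesis applies.
            The shift from \<open>f\<close> to \<open>g\<close> is accounted for by translating the
            null set by \<open>s0\<close>.\<close>
          define g where "g = (\<lambda>p. (f p + s0 * h p) + t0 * e p)"
          have gW: "g \<in> W" using g K(2) by (auto simp: g_def)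
          then have "AE s in lborel. s \<in> {-\<delta><..<\<delta>} \<longrightarrow> T_set V e g \<delta> h \<inter> ({s} \<times> UNIV) = {}"
            using W_N bspec[OF N(5)] by blast
          then obtain Z where Z: "Z \<in> null_sets lborel"
              "\<And>s. s \<notin> Z \<Longrightarrow> s \<in> {-\<delta><..<\<delta>} \<Longrightarrow> T_set V e g \<delta> h \<inter> ({s} \<times> UNIV) = {}"
            unfolding eventually_ae_filter by auto
          have "Y \<subseteq> {s. s - s0 \<in> Z}"
          proof (rule subsetI, rule ccontr)
            fix s assume "s \<in> Y" and s: "s \<notin> {s. s - s0 \<in> Z}"
            then obtain t where t: "(\<lambda>p. (f p + s * h p) + t * e p) \<in> K" by (auto simp: Y_def shadow_def)
            define k where "k = (\<lambda>p. (f p + s * h p) + t * e p)"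
            have kW: "k \<in> W" using t K(2) by (auto simp: k_def)
            have "nrm (\<lambda>p. k p - g p) \<le> nrm (\<lambda>p. k p - f0 p) + nrm (\<lambda>p. f0 p - g p)"
              using kW gW W_S f0S by (intro nrm_triangle) auto
            also have "\<dots> < r + r"
              using kW gW nrm_minus[of f0 g] f0S by (intro add_strict_mono) (auto simp: W_def)
            also have "\<dots> \<le> \<rho>2" by (simp add: r_def)
            finally have "nrm (\<lambda>p. k p - g p) < \<rho>2" .
            moreover have kg: "(\<lambda>p. k p - g p) = (\<lambda>p. (s - s0) * h p + (t - t0) * e p)"
              by (auto simp: k_def g_def algebra_simps)
            ultimately have "\<bar>s - s0\<bar> < \<delta> \<and> (\<exists>t'. \<bar>t'\<bar> < \<delta> \<and> (\<forall>p. t' * e p = (t - t0) * e p))"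
              using \<rho>2(2) by simp
            then obtain t' where t': "\<bar>s - s0\<bar> < \<delta>" "\<bar>t'\<bar> < \<delta>" "\<And>p. t' * e p = (t - t0) * e p" by blast
            \<comment> \<open>The second point \<open>k\<close> of \<open>W\<close> in the same
              plane thus witnesses that the slice of \<open>T_set V e g \<delta> h\<close> over
              \<open>s - s0\<close> is nonempty, which forces \<open>s - s0\<close> into
              \<open>Z\<close>.\<close>
            have "(\<lambda>p. g p + (s - s0) * h p + t' * e p) = k"
              unfolding t'(3) by (auto simp: k_def g_def algebra_simps)
            then have "(s - s0, t') \<in> T_set V e g \<delta> h"
              using t'(1,2) kW by (auto simp: T_set_def W_def)
            moreover have "T_set V e g \<delta> h \<inter> ({s - s0} \<times> UNIV) = {}"
              using s t'(1) by (intro Z(2)) auto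
            ultimately show False by blast
          qed
          then show ?thesis using null_sets_subset[OF null_sets_translation[OF Z(1), of s0] Y_sets] by blast
        qed simp
      qed
    qed
    moreover have "r > 0" using \<rho>1(1) \<rho>2(1) by (simp add: r_def)
    ultimately show ?thesis unfolding W_def by blast
  qed
  define ok where "ok f r \<longleftrightarrow> r > 0 \<and> (\<forall>n. \<exists>N\<in>null_sets \<mu>. shadow e (real n) (V \<inter> {g \<in> S. nrm (\<lambda>p. g p - f p) < r}) \<subseteq> N)" for f r
  have "\<forall>f\<in>V. \<exists>r. ok f r" using cover by (auto simp: ok_def)
  then obtain \<rho> where \<rho>: "\<And>f. f \<in> V \<Longrightarrow> ok f (\<rho> f)" by metis
  have VS: "V \<subseteq> S" using V E by blast
  have "\<And>f. f \<in> V \<Longrightarrow> \<rho> f > 0" using \<rho> by (simp add: ok_def)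
  then obtain V0 where V0: "countable V0" "V0 \<subseteq> V" "\<And>g. g \<in> V \<Longrightarrow> \<exists>f\<in>V0. nrm (\<lambda>p. g p - f p) < \<rho> f"
    using countable_subcover[OF VS, of \<rho>] by blast
  define covers where "covers f n N \<longleftrightarrow> N \<in> null_sets \<mu> \<and>
      shadow e (real n) (V \<inter> {g \<in> S. nrm (\<lambda>p. g p - f p) < \<rho> f}) \<subseteq> N" for f n N
  have "\<exists>N. f \<in> V0 \<longrightarrow> covers f n N" for f n
    using \<rho>[of f] V0(2) unfolding ok_def covers_def by blast
  then obtain N where "\<And>f n. f \<in> V0 \<Longrightarrow> covers f n (N f n)" by metis
  then have N: "N f n \<in> null_sets \<mu>" "shadow e (real n) (V \<inter> {g \<in> S. nrm (\<lambda>p. g p - f p) < \<rho> f}) \<subseteq> N f n"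
    if "f \<in> V0" for f n
    using that unfolding covers_def by blast+
  \<comment> \<open>The union over \<open>n\<close> removes the bound on \<open>t\<close>, and the
    union over the countable set \<open>V0\<close> of centers reaches all of
    \<open>V\<close>.\<close>
  define Z where "Z = (\<Union>f\<in>V0. \<Union>n. N f n)"
  have Z: "Z \<in> null_sets \<mu>"
    unfolding Z_def by (intro null_sets_UN' V0(1) null_sets_UN N(1))
  then have "X -` Z \<inter> space P \<in> null_sets P"
    unfolding \<mu>_def law_def null_sets_distr_iff[OF Xm] by blast
  moreover have "{\<omega> \<in> space P. \<exists>t. (\<lambda>p. X \<omega> p + t * e p) \<in> V} \<subseteq> X -` Z \<inter> space P"
  proof
    fix \<omega> assume "\<omega> \<in> {\<omega> \<in> space P. \<exists>t. (\<lambda>p. X \<omega> p + t * e p) \<in> V}"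
    then obtain t where \<omega>: "\<omega> \<in> space P" and t: "(\<lambda>p. X \<omega> p + t * e p) \<in> V" by blast
    obtain f where f: "f \<in> V0" "nrm (\<lambda>p. (X \<omega> p + t * e p) - f p) < \<rho> f" using V0(3)[OF t] by blast
    obtain n where n: "\<bar>t\<bar> \<le> real n" using real_arch_simple by blast
    have "X \<omega> \<in> S" using measurable_space[OF Xm \<omega>] by (simp add: space_borel_sigma)
    moreover have "t \<in> {- real n..real n}" using n by auto
    moreover have "(\<lambda>p. X \<omega> p + t * e p) \<in> V \<inter> {g \<in> S. nrm (\<lambda>p. g p - f p) < \<rho> f}" using t f(2) VS by auto
    ultimately have "X \<omega> \<in> shadow e (real n) (V \<inter> {g \<in> S. nrm (\<lambda>p. g p - f p) < \<rho> f})"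
      unfolding shadow_def by blast
    then have "X \<omega> \<in> Z" using N(2)[OF f(1)] f(1) unfolding Z_def by blast
    with \<omega> show "\<omega> \<in> X -` Z \<inter> space P" by simp
  qed
  ultimately show ?thesis
    using null_sets_completion_subset null_sets_completionI by blast
qed

end

section \<open>Functions of class \<open>C\<^sup>2\<close>\<close>

text \<open>Even at a boundary point, small steps in a direction \<open>u\<close> with
  \<open>0 \<le> u \<bullet> b\<close> stay in \<open>D\<close>, so the one-sided derivative along
  \<open>u\<close> is determined. Every other direction is the negative of such a
  \<open>u\<close>.\<close>

lemma half_space_derivative_unique:
  fixes g :: "'e::real_inner \<Rightarrow> 'f::real_normed_vector"
  assumes D: "openin (top_of_set {x. 0 \<le> x \<bullet> b}) D" and x: "x \<in> D"
    and L1: "(g has_derivative L1) (at x within D)" and L2: "(g has_derivative L2) (at x within D)"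
  shows "L1 = L2"
proof -
  define L where "L v = L1 v - L2 v" for v
  have L: "((\<lambda>y. 0) has_derivative L) (at x within D)"
    using has_derivative_diff[OF L1 L2] by (simp add: L_def[abs_def])
  interpret L: bounded_linear L using L by (rule has_derivative_bounded_linear)
  have x0: "0 \<le> x \<bullet> b" using x openin_imp_subset[OF D] by auto
  obtain r where r: "r > 0" "\<And>y. 0 \<le> y \<bullet> b \<Longrightarrow> dist y x < r \<Longrightarrow> y \<in> D"
    using D x unfolding openin_euclidean_subtopology_iff by (metis mem_Collect_eq)
  have half: "L u = 0" if u: "0 \<le> u \<bullet> b" for u
  proof -
    define \<delta> where "\<delta> = r / 2 / (norm u + 1)"
    have n: "norm u + 1 > 0" by (simp add: add_nonneg_pos)
    have \<delta>: "\<delta> > 0" using r(1) n by (simp add: \<delta>_def)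
    have sub: "(\<lambda>t. x + t *\<^sub>R u) ` {0..\<delta>} \<subseteq> D"
    proof clarify
      fix t assume t: "t \<in> {0..\<delta>}"
      have "t * norm u \<le> \<delta> * (norm u + 1)" using t by (intro mult_mono) auto
      also have "\<dots> = r / 2" by (metis n \<delta>_def less_irrefl nonzero_eq_divide_eq)
      finally have "dist (x + t *\<^sub>R u) x < r" using t r(1) by (simp add: dist_norm)
      then show "x + t *\<^sub>R u \<in> D" using t u x0 by (intro r(2)) (auto simp: inner_add_left)
    qed
    have "((\<lambda>t. x + t *\<^sub>R u) has_derivative (\<lambda>t. t *\<^sub>R u)) (at 0 within {0..\<delta>})"
      by (auto intro!: derivative_eq_intros)
    moreover have "((\<lambda>y. 0) has_derivative L) (at (x + 0 *\<^sub>R u) within (\<lambda>t. x + t *\<^sub>R u) ` {0..\<delta>})"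
      using has_derivative_subset[OF L sub] by simp
    ultimately have "((\<lambda>y. 0) \<circ> (\<lambda>t. x + t *\<^sub>R u) has_derivative L \<circ> (\<lambda>t. t *\<^sub>R u)) (at 0 within {0..\<delta>})"
      by (rule diff_chain_within)
    then have "((\<lambda>t. 0) has_vector_derivative L u) (at 0 within {0..\<delta>})"
      by (simp add: has_vector_derivative_def comp_def L.scaleR)
    moreover have "((\<lambda>t. 0) has_vector_derivative 0) (at 0 within {0..\<delta>})" by simp
    moreover have "at 0 within {0..\<delta>} \<noteq> bot"
      using \<delta> islimpt_Icc[of 0 \<delta> 0] by (simp add: trivial_limit_within)
    ultimately show ?thesis by (metis vector_derivative_unique_within)
  qed
  have "L v = 0" for v
  proof (cases "0 \<le> v \<bullet> b")
    case False
    then have "L (- v) = 0" by (intro half) simp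
    then show ?thesis using linear_neg[OF bounded_linear.linear[OF has_derivative_bounded_linear[OF L]], of v] by simp
  qed (rule half)
  then show ?thesis by (auto simp: L_def)
qed

lemma has_derivative_blin_deriv:
  assumes "g differentiable_on D" "x \<in> D"
  shows "(g has_derivative blinfun_apply (blin_deriv D g x)) (at x within D)"
proof -
  have "(g has_derivative frechet_derivative g (at x within D)) (at x within D)"
    using assms by (simp add: differentiable_on_def frechet_derivative_works)
  then show ?thesis
    unfolding blin_deriv_def by (simp add: bounded_linear_Blinfun_apply has_derivative_bounded_linear)
qed

text \<open>\<open>blin_deriv\<close> rests on a choice of derivative; uniqueness makes it equal to
  any derivative that has been exhibited.\<close>

lemma blin_deriv_eqI:
  fixes g :: "'e::real_inner \<Rightarrow> 'f::real_normed_vector"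
  assumes "openin (top_of_set {x. 0 \<le> x \<bullet> b}) D" "x \<in> D"
    and L: "(g has_derivative blinfun_apply L) (at x within D)"
  shows "blin_deriv D g x = L"
proof -
  have "(g has_derivative frechet_derivative g (at x within D)) (at x within D)"
    using L by (metis differentiableI frechet_derivative_works)
  then have "frechet_derivative g (at x within D) = blinfun_apply L"
    using half_space_derivative_unique[OF assms(1,2)] L by blast
  then show ?thesis by (simp add: blin_deriv_def blinfun_apply_inverse)
qed

text \<open>The relation between \<open>k\<close>, \<open>f\<close> and \<open>g\<close> is assumed
  on \<open>D\<close> only. This permits a second application to the first derivatives, whose linear
  relation is known just on \<open>D\<close>.\<close>

lemma blin_deriv_lin:
  fixes f g k :: "'e::real_inner \<Rightarrow> 'f::real_normed_vector"
  assumes D: "openin (top_of_set {x. 0 \<le> x \<bullet> b}) D"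
    and f: "f differentiable_on D" and g: "g differentiable_on D"
    and k: "\<And>x. x \<in> D \<Longrightarrow> k x = c *\<^sub>R f x + c' *\<^sub>R g x"
  shows "k differentiable_on D"
    and "\<And>x. x \<in> D \<Longrightarrow> blin_deriv D k x = c *\<^sub>R blin_deriv D f x + c' *\<^sub>R blin_deriv D g x"
proof -
  have *: "(k has_derivative blinfun_apply (c *\<^sub>R blin_deriv D f x + c' *\<^sub>R blin_deriv D g x)) (at x within D)"
    if x: "x \<in> D" for x
  proof (rule has_derivative_transform[OF x k])
    show "((\<lambda>x. c *\<^sub>R f x + c' *\<^sub>R g x) has_derivative
        blinfun_apply (c *\<^sub>R blin_deriv D f x + c' *\<^sub>R blin_deriv D g x)) (at x within D)"
      using has_derivative_add[OF has_derivative_scaleR_right[OF has_derivative_blin_deriv[OF f x]]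
          has_derivative_scaleR_right[OF has_derivative_blin_deriv[OF g x]], of c c']
      by (simp add: plus_blinfun.rep_eq scaleR_blinfun.rep_eq)
  qed
  show "k differentiable_on D" using * unfolding differentiable_on_def by (blast intro: differentiableI)
  show "blin_deriv D k x = c *\<^sub>R blin_deriv D f x + c' *\<^sub>R blin_deriv D g x" if "x \<in> D" for x
    using blin_deriv_eqI[OF D that *[OF that]] .
qed

lemma C2_on_lin:
  fixes f g k :: "'e::real_inner \<Rightarrow> 'f::real_normed_vector"
  assumes D: "openin (top_of_set {x. 0 \<le> x \<bullet> b}) D" and f: "C2_on D f" and g: "C2_on D g"
    and k_def: "k = (\<lambda>x. c *\<^sub>R f x + c' *\<^sub>R g x)"
  shows "C2_on D k"
    and "\<And>x. x \<in> D \<Longrightarrow> blin_deriv D k x = c *\<^sub>R blin_deriv D f x + c' *\<^sub>R blin_deriv D g x"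
    and "\<And>x. x \<in> D \<Longrightarrow> blin_deriv D (blin_deriv D k) x =
      c *\<^sub>R blin_deriv D (blin_deriv D f) x + c' *\<^sub>R blin_deriv D (blin_deriv D g) x"
proof -
  note first = blin_deriv_lin[OF D, of f g k c c']
  note second = blin_deriv_lin[OF D, of "blin_deriv D f" "blin_deriv D g" "blin_deriv D k" c c']
  show 1: "blin_deriv D k x = c *\<^sub>R blin_deriv D f x + c' *\<^sub>R blin_deriv D g x" if "x \<in> D" for x
    using f g that by (intro first) (auto simp: C2_on_def k_def)
  show 2: "blin_deriv D (blin_deriv D k) x =
      c *\<^sub>R blin_deriv D (blin_deriv D f) x + c' *\<^sub>R blin_deriv D (blin_deriv D g) x" if "x \<in> D" for x
    using f g that 1 by (intro second) (auto simp: C2_on_def)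
  have "continuous_on D (\<lambda>x. c *\<^sub>R blin_deriv D (blin_deriv D f) x + c' *\<^sub>R blin_deriv D (blin_deriv D g) x)"
    using f g by (auto simp: C2_on_def intro!: continuous_intros)
  then have "continuous_on D (blin_deriv D (blin_deriv D k))"
    by (rule continuous_on_eq) (simp add: 2)
  moreover have "k differentiable_on D" using f g by (intro first(1)) (auto simp: C2_on_def k_def)
  moreover have "blin_deriv D k differentiable_on D" using f g 1 by (intro second(1)) (auto simp: C2_on_def)
  ultimately show "C2_on D k" by (simp add: C2_on_def)
qed

lemma C2_on_zero:
  assumes D: "openin (top_of_set {x. 0 \<le> x \<bullet> b}) D"
  shows "C2_on D (\<lambda>x :: 'e::real_inner. 0 :: 'f::real_normed_vector)"
proof -
  let ?z = "\<lambda>x :: 'e. 0 :: 'f"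
  have z: "(g has_derivative blinfun_apply 0) (at x within D)" "blin_deriv D g x = 0"
    if "x \<in> D" "\<And>x. x \<in> D \<Longrightarrow> g x = 0" for x and g :: "'e \<Rightarrow> 'g::real_normed_vector"
  proof -
    have "((\<lambda>x. 0 :: 'g) has_derivative blinfun_apply 0) (at x within D)"
      by (simp add: zero_blinfun.rep_eq)
    then show "(g has_derivative blinfun_apply 0) (at x within D)"
      using that by (intro has_derivative_transform[OF that]) auto
    then show "blin_deriv D g x = 0" by (rule blin_deriv_eqI[OF D that(1)])
  qed
  have "?z differentiable_on D" by simp
  moreover have "blin_deriv D ?z differentiable_on D"
    unfolding differentiable_on_def by (intro ballI differentiableI[OF z(1)]) (auto simp: z)
  moreover have "continuous_on D (blin_deriv D (blin_deriv D ?z))"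
    by (rule continuous_on_eq[OF continuous_on_const[of _ 0]]) (simp add: z)
  ultimately show ?thesis by (simp add: C2_on_def)
qed

text \<open>Orthogonalization may leave the zero vector in the spanning set; it is dropped before
  normalizing. In dimension 0 the result is empty.\<close>

lemma finite_span_orthonormal:
  fixes B :: "'e::real_inner set"
  assumes "finite B" "span B = UNIV"
  obtains C :: "'e set" where "finite C" "span C = UNIV" "pairwise orthogonal C" "\<And>c. c \<in> C \<Longrightarrow> norm c = 1"
proof -
  obtain C0 :: "'e set" where C0: "finite C0" "span C0 = UNIV" "pairwise orthogonal C0"
    using basis_orthogonal[OF assms(1)] assms(2) by auto
  define C where "C = (\<lambda>c. c /\<^sub>R norm c) ` (C0 - {0})"
  have "c \<in> span C" if c: "c \<in> C0" for c
  proof (cases "c = 0")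
    case False
    then have "c /\<^sub>R norm c \<in> span C" using c by (intro span_base) (auto simp: C_def)
    from span_scale[OF this, of "norm c"] show ?thesis using False by simp
  qed (simp add: span_zero)
  then have "span C0 \<subseteq> span C" by (intro span_minimal) (auto simp: subspace_span)
  moreover have "pairwise orthogonal C"
    using C0(3) unfolding C_def pairwise_def by (auto simp: orthogonal_def)
  moreover have "norm c = 1" if "c \<in> C" for c
  proof -
    obtain c0 where "c = c0 /\<^sub>R norm c0" "c0 \<noteq> 0" using \<open>c \<in> C\<close> by (auto simp: C_def)
    then show ?thesis by simp
  qed
  moreover have "finite C" using C0(1) by (simp add: C_def)
  ultimately show thesis using C0(2) by (intro that[of C]) auto
qed

lemma norm_blinfun_le_sum:
  fixes L :: "'e::real_inner \<Rightarrow>\<^sub>L 'f::real_normed_vector" and C :: "'e set"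
  assumes C: "finite C" "span C = UNIV" "pairwise orthogonal C" "\<And>c. c \<in> C \<Longrightarrow> norm c = 1"
  shows "norm L \<le> (\<Sum>c\<in>C. norm (L c))"
proof (rule norm_blinfun_bound)
  fix v :: 'e
  have expand: "v = (\<Sum>c\<in>C. (v \<bullet> c) *\<^sub>R c)"
  proof -
    \<comment> \<open>The remainder of the expansion is orthogonal to \<open>C\<close>, hence to its
      span, which is the whole space and contains the remainder itself.\<close>
    define y where "y = v - (\<Sum>c\<in>C. (v \<bullet> c) *\<^sub>R c)"
    have "y \<bullet> c = 0" if c: "c \<in> C" for c
    proof -
      have "(\<Sum>c'\<in>C. (v \<bullet> c') * (c' \<bullet> c)) = (\<Sum>c'\<in>C. if c' = c then v \<bullet> c else 0)"
      proof (rule sum.cong[OF refl])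
        fix c' assume "c' \<in> C"
        then show "(v \<bullet> c') * (c' \<bullet> c) = (if c' = c then v \<bullet> c else 0)"
          using C(3) C(4)[OF c] c by (auto simp: pairwise_def orthogonal_def dot_square_norm)
      qed
      then show ?thesis using C(1) c by (simp add: y_def inner_diff_left inner_sum_left)
    qed
    then have "orthogonal y y"
      using C(2) by (intro orthogonal_to_span[of y C]) (auto simp: orthogonal_def)
    then show ?thesis by (simp add: y_def orthogonal_def)
  qed
  have "L v = (\<Sum>c\<in>C. (v \<bullet> c) *\<^sub>R L c)"
    by (subst expand) (simp add: blinfun.sum_right blinfun.scaleR_right)
  then have "norm (L v) \<le> (\<Sum>c\<in>C. norm ((v \<bullet> c) *\<^sub>R L c))" by (simp only: norm_sum)
  also have "\<dots> \<le> (\<Sum>c\<in>C. norm v * norm (L c))"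
  proof (rule sum_mono)
    fix c assume "c \<in> C"
    then have "\<bar>v \<bullet> c\<bar> \<le> norm v" using Cauchy_Schwarz_ineq2[of v c] C(4) by simp
    then show "norm ((v \<bullet> c) *\<^sub>R L c) \<le> norm v * norm (L c)" by (simp add: mult_right_mono)
  qed
  also have "\<dots> = (\<Sum>c\<in>C. norm (L c)) * norm v" by (simp add: sum_distrib_left mult.commute)
  finally show "norm (L v) \<le> (\<Sum>c\<in>C. norm (L c)) * norm v" .
qed (simp add: sum_nonneg)

text \<open>Lists of length 0, 1 and 2 encode the scalar coordinates of a second-order jet;
  \<open>directions\<close> supplies no longer ones.\<close>

fun directional :: "'e::real_inner set \<Rightarrow> ('e \<Rightarrow> real) \<Rightarrow> 'e list \<Rightarrow> 'e \<Rightarrow> real" where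
  "directional D g [] x = g x"
| "directional D g [c] x = blin_deriv D g x c"
| "directional D g (c # c' # _) x = blin_deriv D (blin_deriv D g) x c c'"

definition directions :: "'e set \<Rightarrow> 'e list set" where
  "directions C = insert [] ((\<lambda>c. [c]) ` C \<union> (\<lambda>(c, c'). [c, c']) ` (C \<times> C))"

lemma finite_directions: "finite C \<Longrightarrow> finite (directions C)"
  by (simp add: directions_def)

text \<open>This is the expression under the supremum in \<open>C2_norm\<close>.\<close>

definition jet_norm :: "'e::real_inner set \<Rightarrow> ('e \<Rightarrow> real) \<Rightarrow> 'e \<Rightarrow> real" where
  "jet_norm D g x = \<bar>g x\<bar> + norm (blin_deriv D g x) + norm (blin_deriv D (blin_deriv D g) x)"

lemma directional_le_jet_norm:
  assumes cs: "cs \<in> directions C" and C: "\<And>c. c \<in> C \<Longrightarrow> norm c = 1"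
  shows "\<bar>directional D g cs x\<bar> \<le> jet_norm D g x"
proof -
  consider "cs = []" | c where "cs = [c]" "c \<in> C" | c c' where "cs = [c, c']" "c \<in> C" "c' \<in> C"
    using cs by (auto simp: directions_def)
  then show ?thesis
  proof cases
    case 1
    then show ?thesis by (simp add: jet_norm_def)
  next
    case 2
    then show ?thesis
      using norm_blinfun[of "blin_deriv D g x" c] C by (simp add: jet_norm_def add_increasing add_increasing2)
  next
    case 3
    let ?L = "blin_deriv D (blin_deriv D g) x"
    have "\<bar>?L c c'\<bar> \<le> norm (?L c)" using norm_blinfun[of "?L c" c'] C 3 by simp
    also have "\<dots> \<le> norm ?L" using norm_blinfun[of ?L c] C 3 by simp
    finally show ?thesis using 3 by (simp add: jet_norm_def add_increasing)
  qed
qed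

text \<open>An operator norm is at most the sum of the norms on an orthonormal basis. The second
  derivative is an operator with operator values, so the bound is used twice for it.\<close>

lemma jet_norm_le_directional:
  fixes C :: "'e::real_inner set"
  assumes C: "finite C" "span C = UNIV" "pairwise orthogonal C" "\<And>c. c \<in> C \<Longrightarrow> norm c = 1"
  shows "jet_norm D g x \<le> (\<Sum>cs\<in>directions C. \<bar>directional D g cs x\<bar>)"
proof -
  let ?L = "blin_deriv D (blin_deriv D g) x"
  have "norm ?L \<le> (\<Sum>c\<in>C. \<Sum>c'\<in>C. \<bar>?L c c'\<bar>)"
  proof -
    have "norm ?L \<le> (\<Sum>c\<in>C. norm (?L c))" by (rule norm_blinfun_le_sum[OF C])
    also have "\<dots> \<le> (\<Sum>c\<in>C. \<Sum>c'\<in>C. norm (?L c c'))" by (intro sum_mono norm_blinfun_le_sum[OF C])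
    finally show ?thesis by simp
  qed
  moreover have "norm (blin_deriv D g x) \<le> (\<Sum>c\<in>C. \<bar>blin_deriv D g x c\<bar>)"
    using norm_blinfun_le_sum[OF C, of "blin_deriv D g x"] by simp
  moreover have "(\<Sum>cs\<in>directions C. \<bar>directional D g cs x\<bar>) =
      \<bar>g x\<bar> + ((\<Sum>c\<in>C. \<bar>blin_deriv D g x c\<bar>) + (\<Sum>c\<in>C. \<Sum>c'\<in>C. \<bar>?L c c'\<bar>))"
    unfolding directions_def using C(1)
    by (subst sum.insert, simp, force, subst sum.union_disjoint)
       (auto simp: sum.reindex inj_on_def sum.cartesian_product case_prod_beta)
  ultimately show ?thesis by (simp add: jet_norm_def)
qed

text \<open>The index \<open>((U, \<phi>, K), cs)\<close> stands for the partial derivative in the directions \<open>cs\<close> in the chart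
  \<open>(U, \<phi>)\<close>, with the point ranging over \<open>\<phi> ` K\<close>.\<close>

fun jet_domain :: "('m set \<times> ('m \<Rightarrow> 'e) \<times> 'm set) \<times> 'e list \<Rightarrow> 'e set" where
  "jet_domain ((U, \<phi>, K), cs) = \<phi> ` K"

fun jet_coord :: "('m set \<times> ('m \<Rightarrow> 'e::real_inner) \<times> 'm set) \<times> 'e list \<Rightarrow> 'e \<Rightarrow> ('m \<Rightarrow> real) \<Rightarrow> real" where
  "jet_coord ((U, \<phi>, K), cs) x f = directional (\<phi> ` U) (f \<circ> inv_into U \<phi>) cs x"

text \<open>The two norms are equivalent on \<open>C2_space\<close>, hence have the same open sets.
  Compactness of the images of the covering sets and continuity of the jets up to the boundary
  supply the remaining properties.\<close>

lemma sup_normed_functions_C2: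
  fixes T :: "'m topology"
    and \<A> :: "('m set \<times> ('m \<Rightarrow> 'e::real_inner)) set"
    and \<K> :: "('m set \<times> ('m \<Rightarrow> 'e) \<times> 'm set) set"
  assumes M: "compact_C2_manifold T \<A>" and \<K>: "C2_cover T \<A> \<K>"
    and C: "finite C" "span C = UNIV" "pairwise orthogonal C" "\<And>c. c \<in> C \<Longrightarrow> norm c = 1"
  shows "sup_normed_functions (C2_space T \<A>) (\<K> \<times> directions C) jet_domain jet_coord (C2_topology T \<A> \<K>)"
proof -
  let ?S = "C2_space T \<A>" and ?J = "\<K> \<times> directions C" and ?I = "directions C"
  let ?nrm = "sup_nrm ?J jet_domain jet_coord"
  have finI: "finite ?I" using C(1) by (rule finite_directions)
  have fin\<K>: "finite \<K>" using \<K> by (simp add: C2_cover_def)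
  have chart: "openin T U" "\<exists>b. openin (top_of_set {x. 0 \<le> x \<bullet> b}) (\<phi> ` U)"
      "homeomorphic_map (subtopology T U) (top_of_set (\<phi> ` U)) \<phi>" if "(U, \<phi>) \<in> \<A>" for U \<phi>
    using M that unfolding compact_C2_manifold_def by fast+
  have cover: "(U, \<phi>) \<in> \<A>" "K \<subseteq> U" "compactin T K" "K \<noteq> {}" if "(U, \<phi>, K) \<in> \<K>" for U \<phi> K
    using \<K> that unfolding C2_cover_def by fast+
  have f_C2: "C2_on (\<phi> ` U) (f \<circ> inv_into U \<phi>)" if "f \<in> ?S" "(U, \<phi>) \<in> \<A>" for f U \<phi>
    using that unfolding C2_space_def by fast
  have compact_image: "compact (\<phi> ` K)" if k: "(U, \<phi>, K) \<in> \<K>" for U \<phi> K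
  proof -
    note c = cover[OF k]
    have "continuous_map (subtopology T U) (top_of_set (\<phi> ` U)) \<phi>"
      using chart(3)[OF c(1)] by (rule homeomorphic_imp_continuous_map)
    moreover have "compactin (subtopology T U) K" using c(2,3) by (simp add: compactin_subtopology)
    ultimately have "compactin (top_of_set (\<phi> ` U)) (\<phi> ` K)" by (metis image_compactin)
    then show ?thesis by (simp add: compactin_subtopology)
  qed
  have lin: "(\<lambda>p. a * f p + b * g p) \<circ> inv_into U \<phi> =
      (\<lambda>x. a *\<^sub>R (f \<circ> inv_into U \<phi>) x + b *\<^sub>R (g \<circ> inv_into U \<phi>) x)" for a b f g U and \<phi> :: "'m \<Rightarrow> 'e"
    by (simp add: comp_def)
  have S_lin: "(\<lambda>p. a * f p + b * g p) \<in> ?S" if f: "f \<in> ?S" and g: "g \<in> ?S" for a b f g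
  proof -
    have "C2_on (\<phi> ` U) ((\<lambda>p. a * f p + b * g p) \<circ> inv_into U \<phi>)" if A: "(U, \<phi>) \<in> \<A>" for U \<phi>
      using chart(2)[OF A] C2_on_lin(1)[OF _ f_C2[OF f A] f_C2[OF g A] lin] by blast
    moreover have "a * f p + b * g p = 0" if "p \<notin> topspace T" for p
      using f g that by (simp add: C2_space_def)
    ultimately show ?thesis unfolding C2_space_def by blast
  qed
  have S_diff: "(\<lambda>p. g p - f p) \<in> ?S" if "f \<in> ?S" "g \<in> ?S" for f g
    using S_lin[OF that(2,1), of 1 "-1"] by simp
  have cont: "continuous_on (\<phi> ` U) g" "continuous_on (\<phi> ` U) (blin_deriv (\<phi> ` U) g)"
      "continuous_on (\<phi> ` U) (blin_deriv (\<phi> ` U) (blin_deriv (\<phi> ` U) g))"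
    if "C2_on (\<phi> ` U) g" for U g and \<phi> :: "'m \<Rightarrow> 'e"
    using that by (auto simp: C2_on_def intro: differentiable_imp_continuous_on)
  have d_cont: "continuous_on (\<phi> ` K) (\<lambda>x. jet_coord ((U, \<phi>, K), cs) x f)"
    if k: "(U, \<phi>, K) \<in> \<K>" and cs: "cs \<in> ?I" and f: "f \<in> ?S" for U \<phi> K cs f
  proof -
    note c = cont[OF f_C2[OF f cover(1)[OF k]]]
    have "continuous_on (\<phi> ` U) (\<lambda>x. jet_coord ((U, \<phi>, K), cs) x f)"
      using cs c by (auto simp: directions_def intro!: continuous_intros)
    then show ?thesis using cover(2)[OF k] by (rule continuous_on_subset[OF _ image_mono])
  qed
  have jet_bdd: "bdd_above (jet_norm (\<phi> ` U) (f \<circ> inv_into U \<phi>) ` \<phi> ` K)"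
    if k: "(U, \<phi>, K) \<in> \<K>" and f: "f \<in> ?S" for U \<phi> K f
  proof -
    note c = cont[OF f_C2[OF f cover(1)[OF k]]]
    have "continuous_on (\<phi> ` U) (jet_norm (\<phi> ` U) (f \<circ> inv_into U \<phi>))"
      unfolding jet_norm_def using c by (intro continuous_intros)
    then have "continuous_on (\<phi> ` K) (jet_norm (\<phi> ` U) (f \<circ> inv_into U \<phi>))"
      using cover(2)[OF k] by (rule continuous_on_subset[OF _ image_mono])
    then show ?thesis
      by (intro bounded_imp_bdd_above compact_imp_bounded compact_continuous_image compact_image[OF k])
  qed
  have C2_norm: "C2_norm \<K> f = (\<Sum>(U, \<phi>, K)\<in>\<K>. SUP x\<in>\<phi> ` K. jet_norm (\<phi> ` U) (f \<circ> inv_into U \<phi>) x)" for f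
    unfolding C2_norm_def jet_norm_def Let_def ..
  have jet_nonneg: "0 \<le> jet_norm D g x" for D and g :: "'e \<Rightarrow> real" and x by (simp add: jet_norm_def)
  have sup_jet_nonneg: "0 \<le> (SUP x\<in>\<phi> ` K. jet_norm (\<phi> ` U) (f \<circ> inv_into U \<phi>) x)"
    if k: "(U, \<phi>, K) \<in> \<K>" and f: "f \<in> ?S" for U \<phi> K f
  proof -
    obtain x where "x \<in> \<phi> ` K" using cover(4)[OF k] by blast
    then show ?thesis using jet_nonneg by (rule cSUP_upper2[OF jet_bdd[OF k f]])
  qed
  have d_le: "\<bar>jet_coord ((U, \<phi>, K), cs) x f\<bar> \<le> C2_norm \<K> f"
    if k: "(U, \<phi>, K) \<in> \<K>" and cs: "cs \<in> ?I" and x: "x \<in> \<phi> ` K" and f: "f \<in> ?S" for U \<phi> K cs x f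
  proof -
    have "\<bar>jet_coord ((U, \<phi>, K), cs) x f\<bar> \<le> jet_norm (\<phi> ` U) (f \<circ> inv_into U \<phi>) x"
      using directional_le_jet_norm[OF cs C(4)] by simp
    also have "\<dots> \<le> (SUP x\<in>\<phi> ` K. jet_norm (\<phi> ` U) (f \<circ> inv_into U \<phi>) x)"
      by (rule cSUP_upper[OF x jet_bdd[OF k f]])
    also have "\<dots> = (\<lambda>(U, \<phi>, K). SUP x\<in>\<phi> ` K. jet_norm (\<phi> ` U) (f \<circ> inv_into U \<phi>) x) (U, \<phi>, K)" by simp
    also have "\<dots> \<le> C2_norm \<K> f"
      unfolding C2_norm using sup_jet_nonneg[OF _ f] by (intro member_le_sum k fin\<K>) auto
    finally show ?thesis .
  qed
  have upper: "?nrm f \<le> real (card ?J) * C2_norm \<K> f" if f: "f \<in> ?S" for f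
  proof -
    have "?nrm f \<le> (\<Sum>j\<in>?J. C2_norm \<K> f)"
      unfolding sup_nrm_def
    proof (rule sum_mono)
      fix j assume j: "j \<in> ?J"
      obtain U \<phi> K cs where j_eq: "j = ((U, \<phi>, K), cs)" by (cases j) auto
      then have k: "(U, \<phi>, K) \<in> \<K>" "cs \<in> ?I" using j by auto
      show "(SUP x\<in>jet_domain j. \<bar>jet_coord j x f\<bar>) \<le> C2_norm \<K> f"
        unfolding j_eq jet_domain.simps using cover(4)[OF k(1)] d_le[OF k _ f] by (intro cSUP_least) auto
    qed
    then show ?thesis by simp
  qed
  \<comment> \<open>The supremum of a sum over directions is at most the sum of the suprema.\<close>
  have lower: "C2_norm \<K> f \<le> ?nrm f" if f: "f \<in> ?S" for f
  proof -
    have "C2_norm \<K> f \<le> (\<Sum>k\<in>\<K>. \<Sum>cs\<in>?I. SUP x\<in>jet_domain (k, cs). \<bar>jet_coord (k, cs) x f\<bar>)"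
      unfolding C2_norm
    proof (rule sum_mono)
      fix k assume "k \<in> \<K>"
      obtain U \<phi> K where k_eq: "k = (U, \<phi>, K)" by (cases k) auto
      then have k: "(U, \<phi>, K) \<in> \<K>" using \<open>k \<in> \<K>\<close> by simp
      have "(SUP x\<in>\<phi> ` K. jet_norm (\<phi> ` U) (f \<circ> inv_into U \<phi>) x) \<le>
          (\<Sum>cs\<in>?I. SUP x\<in>\<phi> ` K. \<bar>jet_coord ((U, \<phi>, K), cs) x f\<bar>)"
      proof (rule cSUP_least)
        fix x assume x: "x \<in> \<phi> ` K"
        have "jet_norm (\<phi> ` U) (f \<circ> inv_into U \<phi>) x \<le> (\<Sum>cs\<in>?I. \<bar>jet_coord ((U, \<phi>, K), cs) x f\<bar>)"
          using jet_norm_le_directional[OF C] by simp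
        also have "\<dots> \<le> (\<Sum>cs\<in>?I. SUP x\<in>\<phi> ` K. \<bar>jet_coord ((U, \<phi>, K), cs) x f\<bar>)"
        proof (rule sum_mono, rule cSUP_upper[OF x])
          fix cs assume "cs \<in> ?I"
          from d_cont[OF k this f] show "bdd_above ((\<lambda>x. \<bar>jet_coord ((U, \<phi>, K), cs) x f\<bar>) ` \<phi> ` K)"
            by (intro bounded_imp_bdd_above compact_imp_bounded compact_continuous_image compact_image[OF k]
                continuous_intros)
        qed
        finally show "jet_norm (\<phi> ` U) (f \<circ> inv_into U \<phi>) x \<le> \<dots>" .
      qed (use cover(4)[OF k] in auto)
      then show "(case k of (U, \<phi>, K) \<Rightarrow> SUP x\<in>\<phi> ` K. jet_norm (\<phi> ` U) (f \<circ> inv_into U \<phi>) x) \<le>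
          (\<Sum>cs\<in>?I. SUP x\<in>jet_domain (k, cs). \<bar>jet_coord (k, cs) x f\<bar>)"
        by (simp only: k_eq prod.case jet_domain.simps)
    qed
    also have "\<dots> = ?nrm f" unfolding sup_nrm_def by (simp add: sum.cartesian_product case_prod_beta)
    finally show ?thesis .
  qed
  show ?thesis
  proof
    show "finite ?J" using fin\<K> finI by simp
    show "compact (jet_domain j)" "jet_domain j \<noteq> {}" if "j \<in> ?J" for j
      using that compact_image cover(4) by (cases j; auto)+
    have "C2_on (\<phi> ` U) (\<lambda>x. 0 :: real)" if "(U, \<phi>) \<in> \<A>" for U \<phi>
      using chart(2)[OF that] C2_on_zero by blast
    then have "(\<lambda>_. 0) \<in> ?S" by (auto simp: C2_space_def comp_def)
    then show "?S \<noteq> {}" by blast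
    show "(\<lambda>p. a * f p + b * g p) \<in> ?S" if "f \<in> ?S" "g \<in> ?S" for f g a b using that by (rule S_lin)
    show "jet_coord j x (\<lambda>p. a * f p + b * g p) = a * jet_coord j x f + b * jet_coord j x g"
      if "j \<in> ?J" "x \<in> jet_domain j" "f \<in> ?S" "g \<in> ?S" for j x f g a b
    proof -
      obtain U \<phi> K cs where j: "j = ((U, \<phi>, K), cs)" by (cases j) auto
      then have k: "(U, \<phi>, K) \<in> \<K>" "cs \<in> ?I" using that by auto
      note A = cover(1)[OF k(1)]
      have x: "x \<in> \<phi> ` U" using that(2) cover(2)[OF k(1)] by (auto simp: j)
      obtain v where v: "openin (top_of_set {x. 0 \<le> x \<bullet> v}) (\<phi> ` U)" using chart(2)[OF A] by blast
      note D = C2_on_lin[OF v f_C2[OF that(3) A] f_C2[OF that(4) A] lin[of a f b g U \<phi>]]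
      show ?thesis
        using k(2) D(2,3)[OF x] by (auto simp: j comp_def directions_def plus_blinfun.rep_eq scaleR_blinfun.rep_eq)
    qed
    show "continuous_on (jet_domain j) (\<lambda>x. jet_coord j x f)" if "j \<in> ?J" "f \<in> ?S" for j f
    proof -
      obtain U \<phi> K cs where j: "j = ((U, \<phi>, K), cs)" by (cases j) auto
      then show ?thesis using that d_cont[of U \<phi> K cs f] unfolding j jet_domain.simps by blast
    qed
    show "f = (\<lambda>_. 0)" if f: "f \<in> ?S" and zero: "\<And>j x. j \<in> ?J \<Longrightarrow> x \<in> jet_domain j \<Longrightarrow> jet_coord j x f = 0" for f
    proof
      fix p
      show "f p = 0"
      proof (cases "p \<in> topspace T")
        case True
        then have "p \<in> (\<Union>(U, \<phi>, K)\<in>\<K>. K)" using \<K> by (simp only: C2_cover_def)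
        then obtain U \<phi> K where k: "(U, \<phi>, K) \<in> \<K>" "p \<in> K" by (elim UN_E) (auto split: prod.splits)
        note A = cover(1)[OF k(1)]
        have "inj_on \<phi> (topspace (subtopology T U))"
          using homeomorphic_imp_injective_map[OF chart(3)[OF A]] .
        then have inj: "inj_on \<phi> U" using openin_subset[OF chart(1)[OF A]] by (simp add: Int_absorb1)
        \<comment> \<open>The empty list of directions is evaluation of \<open>f\<close> itself, and
          the compact sets of the cover reach every point of the manifold.\<close>
        have "jet_coord ((U, \<phi>, K), []) (\<phi> p) f = 0"
          using k by (intro zero) (auto simp: directions_def)
        then show ?thesis using inj cover(2)[OF k(1)] k(2) by (auto simp: inv_into_f_f)
      next
        case False
        then show ?thesis using f by (simp add: C2_space_def)
      qed
    qed
    show "openin (C2_topology T \<A> \<K>) G \<longleftrightarrow> G \<subseteq> ?S \<and>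
      (\<forall>f\<in>G. \<exists>\<epsilon>>0. \<forall>g\<in>?S. ?nrm (\<lambda>p. g p - f p) < \<epsilon> \<longrightarrow> g \<in> G)" for G
      unfolding openin_C2_topology
    proof (intro conj_cong refl ball_cong iffI)
      fix f assume GS: "G \<subseteq> ?S" and fG: "f \<in> G"
      then have f: "f \<in> ?S" by blast
      {
        assume "\<exists>\<epsilon>>0. \<forall>g\<in>?S. C2_norm \<K> (\<lambda>p. g p - f p) < \<epsilon> \<longrightarrow> g \<in> G"
        then show "\<exists>\<epsilon>>0. \<forall>g\<in>?S. ?nrm (\<lambda>p. g p - f p) < \<epsilon> \<longrightarrow> g \<in> G"
          using lower[OF S_diff[OF f]] by (meson le_less_trans)
      next
        assume "\<exists>\<epsilon>>0. \<forall>g\<in>?S. ?nrm (\<lambda>p. g p - f p) < \<epsilon> \<longrightarrow> g \<in> G"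
        then obtain \<epsilon> where \<epsilon>: "\<epsilon> > 0" "\<And>g. g \<in> ?S \<Longrightarrow> ?nrm (\<lambda>p. g p - f p) < \<epsilon> \<Longrightarrow> g \<in> G" by blast
        \<comment> \<open>The added 1 keeps the radius meaningful when \<open>\<K>\<close> is
          empty.\<close>
        have "g \<in> G" if g: "g \<in> ?S" "C2_norm \<K> (\<lambda>p. g p - f p) < \<epsilon> / (real (card ?J) + 1)" for g
        proof (rule \<epsilon>(2)[OF g(1)])
          have "?nrm (\<lambda>p. g p - f p) \<le> real (card ?J) * C2_norm \<K> (\<lambda>p. g p - f p)"
            by (rule upper[OF S_diff[OF f g(1)]])
          also have "\<dots> \<le> real (card ?J) * (\<epsilon> / (real (card ?J) + 1))"
            using g(2) by (intro mult_left_mono) auto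
          also have "\<dots> < \<epsilon>" using \<epsilon>(1) by (simp add: field_simps)
          finally show "?nrm (\<lambda>p. g p - f p) < \<epsilon>" .
        qed
        moreover have "\<epsilon> / (real (card ?J) + 1) > 0" using \<epsilon>(1) by simp
        ultimately show "\<exists>\<epsilon>>0. \<forall>g\<in>?S. C2_norm \<K> (\<lambda>p. g p - f p) < \<epsilon> \<longrightarrow> g \<in> G" by blast
      }
    qed
  qed
qed

theorem lemmaB3:
  fixes T :: "'m topology"
    and \<A> :: "('m set \<times> ('m \<Rightarrow> 'e::real_inner)) set"
    and \<K> :: "('m set \<times> ('m \<Rightarrow> 'e) \<times> 'm set) set"
    and B :: "('m \<Rightarrow> real) topology"
    and P :: "'w measure"
    and X :: "'w \<Rightarrow> 'm \<Rightarrow> real"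
    and E H V :: "('m \<Rightarrow> real) set"
    and e :: "'m \<Rightarrow> real"
  assumes "compact_C2_manifold T \<A>"
    and "C2_cover T \<A> \<K>"
    and "B = C2_topology T \<A> \<K>"
    and "prob_space P"
    and "centered_gaussian_element P B X"
    and "E = topological_support B (law P B X)"
    and "H = cameron_martin_space B (law P B X)"
    and "V \<subseteq> E"
    and "V \<in> sets (borel_sigma B)"
    and "e \<in> E"
    and "\<forall>f0\<in>V. \<exists>N \<delta> h.
           openin (subtopology B E) N \<and> f0 \<in> N \<and> \<delta> > 0 \<and>
           h \<in> H - range (\<lambda>c p. c * e p) \<and>
           (\<forall>f\<in>N. AE s in lborel. s \<in> {-\<delta><..<\<delta>} \<longrightarrow>
              T_set V e f \<delta> h \<inter> ({s} \<times> UNIV) = {})"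
  shows "{\<omega> \<in> space P. \<exists>t. (\<lambda>p. X \<omega> p + t * e p) \<in> V} \<in> null_sets (completion P)"
proof -
  obtain B0 :: "'e set" where "finite B0" "span B0 = UNIV"
    using assms(1) unfolding compact_C2_manifold_def by blast
  then obtain C :: "'e set" where C: "finite C" "span C = UNIV" "pairwise orthogonal C" "\<And>c. c \<in> C \<Longrightarrow> norm c = 1"
    by (rule finite_span_orthonormal) blast
  interpret sup_normed_functions "C2_space T \<A>" "\<K> \<times> directions C" jet_domain jet_coord B
    unfolding assms(3) using assms(1,2) C by (rule sup_normed_functions_C2)
  \<comment> \<open>The whole space is itself one of the closed sets in the intersection defining
    the support.\<close>
  have "E \<subseteq> C2_space T \<A>"
    unfolding assms(6) topological_support_def using closedin_topspace[of B] topspace_B by auto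
  then show ?thesis
    using assms(10) by (intro gaussian_null[OF assms(4,5) _ assms(8,9) _ assms(11)[unfolded assms(7)]]) auto
qed

end
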